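(* Let $\mathcal{H}$ be a complex separable Hilbert space and $X\subset\mathbb{R}^d$ a relatively separated set. Let $u$ be an admissible weight on $\mathbb{R}^d$, let $\delta,s>0$, suppose $u\ge\nu_\delta$ on $\mathbb{R}^d$, and set $\nu=u\,\nu_s$, where $\nu_t(x)=(1+|x|)^t$. Then $$r_{\mathcal{B}_{u,s}}(A)=r_{\mathcal{B}(\ell^2(X;\mathcal{H}))}(A)\qquad\text{for all } A=A^*\in\mathcal{B}_{u,s}.$$ In particular, $\mathcal{B}_{u,s}=\mathcal{B}_{u,s}(X)$ is inverse-closed in $\mathcal{B}(\ell^2(X;\mathcal{H}))$, and $\mathcal{B}_{u,s}$ is a symmetric Banach algebra.
   Context: $|\cdot|$ is the Euclidean norm on $\mathbb{R}^d$. A countable set $X\subset\mathbb{R}^d$ is relatively separated if $\sup_{x\in\mathbb{R}^d}|X\cap(x+[0,1]^d)|<\infty$ (cardinality). $\ell^2(X;\mathcal{H})$ is the Hilbert space of families $(f_k)_{k\in X}$ in $\mathcal{H}$ with $\sum_k\|f_k\|^2<\infty$. A weight is a continuous function $u:\mathbb{R}^d\to(0,\infty)$. It is admissible if (a) $u(x)=e^{\rho(\|x\|)}$ for some norm $\|\cdot\|$ on $\mathbb{R}^d$ and some continuous concave $\rho:[0,\infty)\to[0,\infty)$ with $\rho(0)=0$, and (b) $\lim_{n\to\infty}u(nz)^{1/n}=1$ for all $z\in\mathbb{R}^d$. For matrices $A=[A_{k,l}]_{k,l\in X}$ with entries in $\mathcal{B}(\mathcal{H})$ put $$\|A\|_{\mathcal{S}^1_u}=\max\Big\{\sup_{k}\sum_{l}\|A_{k,l}\|u(k-l),\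 \sup_{l}\sum_{k}\|A_{k,l}\|u(k-l)\Big\},\qquad \|A\|_{\mathcal{J}_\nu}=\sup_{k,l\in X}\|A_{k,l}\|\nu(k-l).$$ With $\nu=u\nu_s$, $\mathcal{B}_{u,s}(X)$ is the space of all such matrices for which both quantities are finite, with norm $\|A\|_{\mathcal{B}_{u,s}}=2^s\|A\|_{\mathcal{S}^1_u}+\|A\|_{\mathcal{J}_\nu}$. It is a unital Banach algebra under matrix multiplication $[AB]_{k,l}=\sum_nA_{k,n}B_{n,l}$ with isometric involution $[A^*]_{k,l}=(A_{l,k})^*$. A matrix acts on families by $A(f_l)_l=(\sum_lA_{k,l}f_l)_k$; this identifies $\mathcal{B}_{u,s}$ with a subalgebra of $\mathcal{B}(\ell^2(X;\mathcal{H}))$. For a unital Banach algebra $\mathcal{A}$, $\sigma_{\mathcal{A}}(A)$ is the spectrum and $r_{\mathcal{A}}(A)$ the spectral radius of $A$ in $\mathcal{A}$. $\mathcal{A}\subseteq\mathcal{B}$ (common identity) is inverse-closed in $\mathcal{B}$ if $A\in\mathcal{A}$ invertible in $\mathcal{B}$ implies $A^{-1}\in\mathcal{A}$. A unital Banach algebra with involution is symmetric if $\sigma_{\mathcal{A}}(A^*A)\subseteq[0,\infty)$ for all $A\in\mathcal{A}$. *)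

theory Defs
  imports "HOL-Analysis.Analysis" "HOL-Algebra.Ring"
begin

section \<open>Complex Hilbert spaces\<close>

text \<open>The inner product is linear in the first and conjugate-linear in the second argument.\<close>

class chilbert_space = banach +
  fixes scaleC :: "complex \<Rightarrow> 'a \<Rightarrow> 'a" (infixr \<open>*\<^sub>C\<close> 75)
    and cinner :: "'a \<Rightarrow> 'a \<Rightarrow> complex"
  assumes scaleC_add_right: "c *\<^sub>C (x + y) = c *\<^sub>C x + c *\<^sub>C y"
    and scaleC_add_left: "(b + c) *\<^sub>C x = b *\<^sub>C x + c *\<^sub>C x"
    and scaleC_scaleC: "b *\<^sub>C (c *\<^sub>C x) = (b * c) *\<^sub>C x"
    and scaleC_of_real: "complex_of_real r *\<^sub>C x = r *\<^sub>R x"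
    and cinner_commute: "cinner x y = cnj (cinner y x)"
    and cinner_add_left: "cinner (x + y) z = cinner x z + cinner y z"
    and cinner_scaleC_left: "cinner (c *\<^sub>C x) y = c * cinner x y"
    and cinner_self_nonneg: "0 \<le> Re (cinner x x)"
    and norm_eq_sqrt_cinner: "norm x = sqrt (Re (cinner x x))"

instantiation complex :: chilbert_space
begin

definition "scaleC_complex (c :: complex) (x :: complex) = c * x"

definition "cinner_complex (x :: complex) (y :: complex) = x * cnj y"

instance
  by standard
    (simp_all add: scaleC_complex_def cinner_complex_def algebra_simps scaleR_conv_of_real
      cmod_def power2_eq_square)

end

lemma norm_scaleC:
  fixes x :: "'h::chilbert_space"
  shows "norm (c *\<^sub>C x) = cmod c * norm x"
proof -
  have "cinner (c *\<^sub>C x) (c *\<^sub>C x) = c * cnj (cinner (c *\<^sub>C x) x)"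
    by (metis cinner_commute cinner_scaleC_left)
  also have "\<dots> = (c * cnj c) * cnj (cinner x x)"
    by (simp add: cinner_scaleC_left)
  finally have "Re (cinner (c *\<^sub>C x) (c *\<^sub>C x)) = (cmod c)\<^sup>2 * Re (cinner x x)"
    by (simp flip: complex_norm_square of_real_power)
  then show ?thesis
    by (simp add: norm_eq_sqrt_cinner[where 'a = 'h] real_sqrt_mult)
qed

lemma scaleC_scaleR_commute:
  fixes x :: "'h::chilbert_space"
  shows "c *\<^sub>C (r *\<^sub>R x) = r *\<^sub>R (c *\<^sub>C x)"
  by (simp add: scaleC_scaleC mult.commute flip: scaleC_of_real)


section \<open>Bounded operators on a complex Hilbert space\<close>

text \<open>
  \<open>\<B>(\<H>)\<close> consists of the complex-linear elements of the library type of bounded real-linear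
  maps; the operator norm is the norm of that type.
\<close>

definition bounded_clinear_ops :: "('h::chilbert_space \<Rightarrow>\<^sub>L 'h) set" where
  "bounded_clinear_ops =
     {T. \<forall>c x. blinfun_apply T (c *\<^sub>C x) = c *\<^sub>C blinfun_apply T x}"

lift_definition scaleC_blinfun ::
  "complex \<Rightarrow> ('h::chilbert_space \<Rightarrow>\<^sub>L 'h) \<Rightarrow> ('h \<Rightarrow>\<^sub>L 'h)" is
  "\<lambda>c T x. c *\<^sub>C T x"
proof -
  fix c and T :: "'h \<Rightarrow> 'h"
  assume T: "bounded_linear T"
  have "bounded_linear (\<lambda>x::'h. c *\<^sub>C x)"
    by (rule bounded_linear_intro[where K = "cmod c"])
      (simp_all add: scaleC_add_right scaleC_scaleR_commute norm_scaleC mult.commute)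
  from bounded_linear_compose[OF this T]
  show "bounded_linear (\<lambda>x. c *\<^sub>C T x)" .
qed

definition adj_blinfun :: "('h::chilbert_space \<Rightarrow>\<^sub>L 'h) \<Rightarrow> ('h \<Rightarrow>\<^sub>L 'h)" where
  "adj_blinfun T =
     (THE S. \<forall>x y. cinner (blinfun_apply T x) y = cinner x (blinfun_apply S y))"


section \<open>Unital Banach algebras with involution\<close>

record 'a calgebra = "'a ring" +
  cscale :: "complex \<Rightarrow> 'a \<Rightarrow> 'a" (infixr \<open>\<odot>\<index>\<close> 75)

record 'a star_calgebra = "'a calgebra" +
  anorm :: "'a \<Rightarrow> real"
  invol :: "'a \<Rightarrow> 'a"

locale unital_complex_algebra = ring R for R (structure) +
  assumes cscale_closed: "x \<in> carrier R \<Longrightarrow> c \<odot> x \<in> carrier R"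
    and cscale_add_right:
      "\<lbrakk>x \<in> carrier R; y \<in> carrier R\<rbrakk> \<Longrightarrow> c \<odot> (x \<oplus> y) = c \<odot> x \<oplus> c \<odot> y"
    and cscale_add_left: "x \<in> carrier R \<Longrightarrow> (b + c) \<odot> x = b \<odot> x \<oplus> c \<odot> x"
    and cscale_cscale: "x \<in> carrier R \<Longrightarrow> b \<odot> (c \<odot> x) = (b * c) \<odot> x"
    and cscale_one: "x \<in> carrier R \<Longrightarrow> 1 \<odot> x = x"
    and cscale_mult_left:
      "\<lbrakk>x \<in> carrier R; y \<in> carrier R\<rbrakk> \<Longrightarrow> (c \<odot> x) \<otimes> y = c \<odot> (x \<otimes> y)"
    and cscale_mult_right:
      "\<lbrakk>x \<in> carrier R; y \<in> carrier R\<rbrakk> \<Longrightarrow> x \<otimes> (c \<odot> y) = c \<odot> (x \<otimes> y)"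

text \<open>The norm of the unit is not required to be 1; in \<open>\<B>\<^bsub>u,s\<^esub>\<close> it is in general larger.\<close>

locale unital_banach_star_algebra = unital_complex_algebra R for R (structure) +
  assumes anorm_nonneg: "x \<in> carrier R \<Longrightarrow> 0 \<le> anorm R x"
    and anorm_eq_0_iff: "x \<in> carrier R \<Longrightarrow> anorm R x = 0 \<longleftrightarrow> x = \<zero>"
    and anorm_triangle:
      "\<lbrakk>x \<in> carrier R; y \<in> carrier R\<rbrakk> \<Longrightarrow> anorm R (x \<oplus> y) \<le> anorm R x + anorm R y"
    and anorm_cscale: "x \<in> carrier R \<Longrightarrow> anorm R (c \<odot> x) = cmod c * anorm R x"
    and anorm_mult:
      "\<lbrakk>x \<in> carrier R; y \<in> carrier R\<rbrakk> \<Longrightarrow> anorm R (x \<otimes> y) \<le> anorm R x * anorm R y"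
    and anorm_complete:
      "\<lbrakk>\<And>n. F n \<in> carrier R;
        \<forall>e>0. \<exists>N. \<forall>m\<ge>N. \<forall>n\<ge>N. anorm R (F m \<ominus> F n) < e\<rbrakk>
       \<Longrightarrow> \<exists>x\<in>carrier R. (\<lambda>n::nat. anorm R (F n \<ominus> x)) \<longlonglongrightarrow> 0"
    and invol_closed: "x \<in> carrier R \<Longrightarrow> invol R x \<in> carrier R"
    and invol_invol: "x \<in> carrier R \<Longrightarrow> invol R (invol R x) = x"
    and invol_add:
      "\<lbrakk>x \<in> carrier R; y \<in> carrier R\<rbrakk> \<Longrightarrow> invol R (x \<oplus> y) = invol R x \<oplus> invol R y"
    and invol_cscale: "x \<in> carrier R \<Longrightarrow> invol R (c \<odot> x) = cnj c \<odot> invol R x"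
    and invol_mult:
      "\<lbrakk>x \<in> carrier R; y \<in> carrier R\<rbrakk> \<Longrightarrow> invol R (x \<otimes> y) = invol R y \<otimes> invol R x"
    and anorm_invol: "x \<in> carrier R \<Longrightarrow> anorm R (invol R x) = anorm R x"

definition alg_spectrum :: "('a, 'm) calgebra_scheme \<Rightarrow> 'a \<Rightarrow> complex set" where
  "alg_spectrum R a = {z. (z \<odot>\<^bsub>R\<^esub> \<one>\<^bsub>R\<^esub>) \<ominus>\<^bsub>R\<^esub> a \<notin> Units R}"

text \<open>
  With values in \<^typ>\<open>ennreal\<close> the supremum is meaningful without further assumptions; it is 0
  for the empty spectrum, which occurs only in the zero algebra.
\<close>

definition alg_spectral_radius :: "('a, 'm) calgebra_scheme \<Rightarrow> 'a \<Rightarrow> ennreal" where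
  "alg_spectral_radius R a = (SUP z\<in>alg_spectrum R a. ennreal (cmod z))"

definition symmetric_banach_algebra :: "('a, 'm) star_calgebra_scheme \<Rightarrow> bool" where
  "symmetric_banach_algebra R \<longleftrightarrow>
     unital_banach_star_algebra R \<and>
     (\<forall>a\<in>carrier R. alg_spectrum R (invol R a \<otimes>\<^bsub>R\<^esub> a) \<subseteq> \<real>\<^sub>\<ge>\<^sub>0)"

text \<open>
  \<open>R\<close> is regarded as a subalgebra of \<open>S\<close> with the same identity by means of a map \<open>h\<close>, which
  therefore has to be an injective unital algebra homomorphism.
\<close>

definition subalgebra_via ::
  "('a \<Rightarrow> 'b) \<Rightarrow> ('a, 'm) calgebra_scheme \<Rightarrow> ('b, 'n) calgebra_scheme \<Rightarrow> bool" where
  "subalgebra_via h R S \<longleftrightarrow>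
     h \<in> ring_hom R S \<and>
     (\<forall>c. \<forall>a\<in>carrier R. h (c \<odot>\<^bsub>R\<^esub> a) = c \<odot>\<^bsub>S\<^esub> h a) \<and>
     inj_on h (carrier R)"

definition inverse_closed_via ::
  "('a \<Rightarrow> 'b) \<Rightarrow> ('a, 'm) calgebra_scheme \<Rightarrow> ('b, 'n) calgebra_scheme \<Rightarrow> bool" where
  "inverse_closed_via h R S \<longleftrightarrow>
     subalgebra_via h R S \<and>
     (\<forall>a\<in>carrier R. h a \<in> Units S \<longrightarrow> inv\<^bsub>S\<^esub> (h a) \<in> h ` carrier R)"


section \<open>The algebra of bounded operators on \<open>\<ell>\<^sup>2(X; \<H>)\<close>\<close>

text \<open>
  Families indexed by \<open>X\<close> are functions on the ambient type that vanish outside \<open>X\<close>; operators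
  are extensional functions on the set of square-summable families.
\<close>

definition l2_space :: "'i set \<Rightarrow> ('i \<Rightarrow> 'h::chilbert_space) set" where
  "l2_space X = {f. (\<forall>k. k \<notin> X \<longrightarrow> f k = 0) \<and> (\<lambda>k. (norm (f k))\<^sup>2) summable_on X}"

definition l2_norm :: "'i set \<Rightarrow> ('i \<Rightarrow> 'h::chilbert_space) \<Rightarrow> real" where
  "l2_norm X f = sqrt (\<Sum>\<^sub>\<infinity>k\<in>X. (norm (f k))\<^sup>2)"

definition l2_bounded_ops ::
  "'i set \<Rightarrow> (('i \<Rightarrow> 'h::chilbert_space) \<Rightarrow> ('i \<Rightarrow> 'h)) set" where
  "l2_bounded_ops X =
     {T \<in> l2_space X \<rightarrow>\<^sub>E l2_space X.
        (\<forall>f\<in>l2_space X. \<forall>g\<in>l2_space X. T (\<lambda>k. f k + g k) = (\<lambda>k. T f k + T g k)) \<and>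
        (\<forall>c. \<forall>f\<in>l2_space X. T (\<lambda>k. c *\<^sub>C f k) = (\<lambda>k. c *\<^sub>C T f k)) \<and>
        (\<exists>C. \<forall>f\<in>l2_space X. l2_norm X (T f) \<le> C * l2_norm X f)}"

definition l2_op_algebra ::
  "'i set \<Rightarrow> (('i \<Rightarrow> 'h::chilbert_space) \<Rightarrow> ('i \<Rightarrow> 'h)) calgebra" where
  "l2_op_algebra X =
     \<lparr>carrier = l2_bounded_ops X,
      mult = compose (l2_space X),
      one = (\<lambda>f\<in>l2_space X. f),
      zero = (\<lambda>f\<in>l2_space X. \<lambda>k. 0),
      add = (\<lambda>S T. \<lambda>f\<in>l2_space X. \<lambda>k. S f k + T f k),
      cscale = (\<lambda>c T. \<lambda>f\<in>l2_space X. \<lambda>k. c *\<^sub>C T f k)\<rparr>"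


section \<open>Relatively separated sets and admissible weights\<close>

definition relatively_separated :: "(real ^ 'd) set \<Rightarrow> bool" where
  "relatively_separated X \<longleftrightarrow>
     countable X \<and>
     (\<exists>N::nat. \<forall>x. finite (X \<inter> (+) x ` cbox 0 1) \<and> card (X \<inter> (+) x ` cbox 0 1) \<le> N)"

definition is_norm :: "('v::real_vector \<Rightarrow> real) \<Rightarrow> bool" where
  "is_norm N \<longleftrightarrow>
     (\<forall>x. 0 \<le> N x) \<and> (\<forall>x. N x = 0 \<longleftrightarrow> x = 0) \<and>
     (\<forall>c x. N (c *\<^sub>R x) = \<bar>c\<bar> * N x) \<and> (\<forall>x y. N (x + y) \<le> N x + N y)"

definition is_weight :: "(real ^ 'd \<Rightarrow> real) \<Rightarrow> bool" where
  "is_weight u \<longleftrightarrow> continuous_on UNIV u \<and> (\<forall>x. 0 < u x)"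

definition admissible_weight :: "(real ^ 'd \<Rightarrow> real) \<Rightarrow> bool" where
  "admissible_weight u \<longleftrightarrow>
     is_weight u \<and>
     (\<exists>N \<rho>. is_norm N \<and>
        continuous_on {0..} \<rho> \<and> concave_on {0..} \<rho> \<and> (\<forall>t\<ge>0. 0 \<le> \<rho> t) \<and> \<rho> 0 = 0 \<and>
        (\<forall>x. u x = exp (\<rho> (N x)))) \<and>
     (\<forall>z. (\<lambda>n::nat. u (real n *\<^sub>R z) powr (1 / real n)) \<longlonglongrightarrow> 1)"

definition poly_weight :: "real \<Rightarrow> real ^ 'd \<Rightarrow> real" where
  "poly_weight t x = (1 + norm x) powr t"


section \<open>The matrix algebra \<open>\<B>\<^bsub>u,s\<^esub>(X)\<close>\<close>

text \<open>
  A matrix indexed by \<open>X\<close> is a function on pairs of points that vanishes outside \<open>X \<times> X\<close>.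
\<close>

type_synonym ('d, 'h) op_matrix = "real ^ 'd \<Rightarrow> real ^ 'd \<Rightarrow> ('h \<Rightarrow>\<^sub>L 'h)"

definition op_matrices :: "(real ^ 'd) set \<Rightarrow> ('d, 'h::chilbert_space) op_matrix set" where
  "op_matrices X =
     {A. (\<forall>k\<in>X. \<forall>l\<in>X. A k l \<in> bounded_clinear_ops) \<and>
         (\<forall>k l. k \<notin> X \<or> l \<notin> X \<longrightarrow> A k l = 0)}"

definition schur_norm ::
  "(real ^ 'd) set \<Rightarrow> (real ^ 'd \<Rightarrow> real) \<Rightarrow> ('d, 'h::chilbert_space) op_matrix \<Rightarrow> ennreal" where
  "schur_norm X u A =
     max (SUP k\<in>X. \<Sum>\<^sub>\<infinity>l\<in>X. ennreal (norm (A k l) * u (k - l)))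
         (SUP l\<in>X. \<Sum>\<^sub>\<infinity>k\<in>X. ennreal (norm (A k l) * u (k - l)))"

definition jaffard_norm ::
  "(real ^ 'd) set \<Rightarrow> (real ^ 'd \<Rightarrow> real) \<Rightarrow> ('d, 'h::chilbert_space) op_matrix \<Rightarrow> ennreal" where
  "jaffard_norm X v A = (SUP k\<in>X. SUP l\<in>X. ennreal (norm (A k l) * v (k - l)))"

definition Bus_algebra ::
  "(real ^ 'd) set \<Rightarrow> (real ^ 'd \<Rightarrow> real) \<Rightarrow> real \<Rightarrow>
     ('d, 'h::chilbert_space) op_matrix star_calgebra" where
  "Bus_algebra X u s =
     (let v = (\<lambda>x. u x * poly_weight s x) in
     \<lparr>carrier = {A \<in> op_matrices X. schur_norm X u A < \<infinity> \<and> jaffard_norm X v A < \<infinity>},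
      mult = (\<lambda>A B k l. \<Sum>\<^sub>\<infinity>n\<in>X. A k n o\<^sub>L B n l),
      one = (\<lambda>k l. if k = l \<and> k \<in> X then id_blinfun else 0),
      zero = (\<lambda>k l. 0),
      add = (\<lambda>A B k l. A k l + B k l),
      cscale = (\<lambda>c A k l. scaleC_blinfun c (A k l)),
      anorm = (\<lambda>A. 2 powr s * enn2real (schur_norm X u A) + enn2real (jaffard_norm X v A)),
      invol = (\<lambda>A k l. adj_blinfun (A l k))\<rparr>)"

definition matrix_op ::
  "(real ^ 'd) set \<Rightarrow> ('d, 'h::chilbert_space) op_matrix \<Rightarrow>
     (real ^ 'd \<Rightarrow> 'h) \<Rightarrow> (real ^ 'd \<Rightarrow> 'h)" where
  "matrix_op X A = (\<lambda>f\<in>l2_space X. \<lambda>k. \<Sum>\<^sub>\<infinity>l\<in>X. blinfun_apply (A k l) (f l))"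

end

(* The spectral radius in B_{u,s} of a matrix A is at most its operator norm, by the following argument.
   Write u = exp (rho (N x)). The weights u_a = exp (rho (a + N x) - rho a) are equivalent to u, so
   they define equivalent submultiplicative norms on B_{u,s}. As rho is concave and grows
   sublinearly, for a large u_a is at most 2 where u <= e^sigma and at most 2 e^(-sigma) u elsewhere.
   Since u >= nu_delta, the first region has polynomial size in L = e^(sigma/delta), whence
   |A|_a <= C (L^p |A|_op + L^(-delta) |A|). Applying this to powers of A and optimising in L gives
   lim |A^n|^(1/n) <= |A|_op. For self-adjoint A the norm |A|_op is the spectral radius on l^2.

   If M is bounded below on l^2, then |1 - t M*M|_op < 1 for small t > 0, so M*M is invertible in
   B_{u,s} by the Neumann series. This yields inverse-closedness, and symmetry with M = z - A*A. *)

theory Submission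
  imports Defs
begin

section \<open>Adjoints of bounded operators\<close>

text \<open>For a purely polynomial weight, u (x + y) is at most a constant times u x + u y, and
  products can be estimated directly. A general u is only submultiplicative, so the gain has to come
  from changing the norm along with L. The price is the constant K = exp (rho a) in u <= K u_a, over
  which there is no control as L grows. It is harmless because it stays outside the nth power: |A^(m
  n)| <= K |1|_a (|A^m|_a)^n. The constant C that does get raised to the nth power is the same for
  all shifted weights, and letting m grow removes it.

  The exponent is p = d + s: a ball of radius L contains at most a constant times L^d points of X,
  which is the cost in the Schur norm, and nu_s is of order L^s there, which is the cost in the
  Jaffard norm.

  Lower bounds |M f| >= c |f| take the place of functional calculus: they yield the left inverse
  inv(adj M M) adj M inside B_{u,s}. The right inverse comes from the operator inverse or, for
  symmetry, from the same argument applied to the adjoint.\<close>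

lemma cinner_add_right: "cinner x (y + z) = cinner x y + cinner x z"
  by (metis cinner_commute cinner_add_left complex_cnj_add)

lemma cinner_scaleC_right: "cinner x (c *\<^sub>C y) = cnj c * cinner x y"
  by (metis cinner_commute cinner_scaleC_left complex_cnj_mult)

lemma cinner_scaleR_left: "cinner (r *\<^sub>R x) y = r *\<^sub>R cinner x y"
  by (metis scaleC_of_real cinner_scaleC_left scaleR_conv_of_real)

lemma cinner_scaleR_right: "cinner x (r *\<^sub>R y) = r *\<^sub>R cinner x y"
  by (metis scaleC_of_real cinner_scaleC_right scaleR_conv_of_real complex_cnj_complex_of_real)

lemma cinner_minus_left: "cinner (- x) y = - cinner x y"
  using cinner_scaleR_left[of "-1" x y] by simp

lemma cinner_minus_right: "cinner x (- y) = - cinner x y"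
  using cinner_scaleR_right[of x "-1" y] by simp

lemma cinner_diff_left: "cinner (x - y) z = cinner x z - cinner y z"
  using cinner_add_left[of x "- y" z] by (simp add: cinner_minus_left)

lemma cinner_diff_right: "cinner z (x - y) = cinner z x - cinner z y"
  using cinner_add_right[of z x "- y"] by (simp add: cinner_minus_right)

lemma cinner_zero_left [simp]: "cinner 0 y = 0"
  using cinner_diff_left[of 0 0 y] by simp

lemma cinner_zero_right [simp]: "cinner y 0 = 0"
  using cinner_diff_right[of y 0 0] by simp

lemma cinner_self: "cinner x (x::'h::chilbert_space) = of_real ((norm x)\<^sup>2)"
proof -
  have "Im (cinner x x) = 0"
    using cinner_commute[of x x] by (metis cnj.simps(2) equal_neg_zero)
  moreover have "(norm x)\<^sup>2 = Re (cinner x x)"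
    by (simp add: norm_eq_sqrt_cinner[where 'a='h] cinner_self_nonneg)
  ultimately show ?thesis
    by (simp add: complex_eq_iff)
qed

lemma norm_diff_sq: "(norm (x - y))\<^sup>2 = (norm x)\<^sup>2 - 2 * Re (cinner x y) + (norm y)\<^sup>2"
proof -
  have "complex_of_real ((norm (x - y))\<^sup>2) =
      of_real ((norm x)\<^sup>2) - (cinner x y + cnj (cinner x y)) + of_real ((norm y)\<^sup>2)"
    unfolding cinner_self[symmetric] cinner_commute[of x y, symmetric]
    by (simp add: cinner_diff_left cinner_diff_right cinner_commute[of y x, symmetric])
  then have "Re (complex_of_real ((norm (x - y))\<^sup>2)) =
      Re (of_real ((norm x)\<^sup>2) - (cinner x y + cnj (cinner x y)) + of_real ((norm y)\<^sup>2))"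
    by simp
  then show ?thesis by simp
qed

lemma cinner_cauchy_schwarz: "cmod (cinner x y) \<le> norm x * norm y"
proof (cases "y = 0")
  case False
  define c where "c = cinner x y / of_real ((norm y)\<^sup>2)"
  have n: "(norm y)\<^sup>2 > 0" using False by simp
  have "0 \<le> (norm (x - c *\<^sub>C y))\<^sup>2" by simp
  also have "\<dots> = (norm x)\<^sup>2 - 2 * Re (cnj c * cinner x y) + (cmod c)\<^sup>2 * (norm y)\<^sup>2"
    by (simp add: norm_diff_sq cinner_scaleC_right norm_scaleC power_mult_distrib)
  also have "cnj c * cinner x y = of_real ((cmod (cinner x y))\<^sup>2 / (norm y)\<^sup>2)"
    by (simp add: c_def complex_norm_square mult.commute del: of_real_power)
  also have "(cmod c)\<^sup>2 * (norm y)\<^sup>2 = (cmod (cinner x y))\<^sup>2 / (norm y)\<^sup>2"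
    using n by (simp add: c_def norm_divide power_divide norm_mult power2_eq_square)
  finally have "(cmod (cinner x y))\<^sup>2 / (norm y)\<^sup>2 \<le> (norm x)\<^sup>2" by simp
  then have "(cmod (cinner x y))\<^sup>2 \<le> (norm x * norm y)\<^sup>2"
    using n by (simp add: divide_le_eq power_mult_distrib)
  then show ?thesis by (rule power2_le_imp_le) simp
qed simp

lemma bounded_bilinear_cinner: "bounded_bilinear (cinner :: 'h::chilbert_space \<Rightarrow> 'h \<Rightarrow> complex)"
  by (rule bounded_bilinear.intro)
    (auto simp: cinner_add_left cinner_add_right cinner_scaleR_left cinner_scaleR_right
      intro!: exI[of _ 1] cinner_cauchy_schwarz)

lemma bounded_linear_scaleC: "bounded_linear (\<lambda>x::'h::chilbert_space. c *\<^sub>C x)"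
  by (rule bounded_linear_intro[where K = "cmod c"])
    (simp_all add: scaleC_add_right scaleC_scaleR_commute norm_scaleC mult.commute)

lemma scaleC_simps [simp]:
  "c *\<^sub>C (0::'h::chilbert_space) = 0" "0 *\<^sub>C (x::'h) = 0" "1 *\<^sub>C x = x"
  using scaleC_of_real[of 0 "x"] scaleC_of_real[of 1 "x"]
    linear_0[OF bounded_linear.linear[OF bounded_linear_scaleC]] by auto

lemma scaleC_minus_right: "c *\<^sub>C (- x) = - (c *\<^sub>C x)"
  using linear_neg[OF bounded_linear.linear[OF bounded_linear_scaleC]] .

lemma scaleC_minus_left: "(- c) *\<^sub>C x = - (c *\<^sub>C x)"
  using scaleC_add_left[of "-c" c x] by (simp add: eq_neg_iff_add_eq_0)

lemma cinner_eqI: "(\<And>x::'h::chilbert_space. cinner x y = cinner x z) \<Longrightarrow> y = z"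
proof -
  assume *: "\<And>x::'h. cinner x y = cinner x z"
  have "cinner (y - z) (y - z) = 0"
    using *[of "y - z"] by (simp add: cinner_diff_right)
  then show "y = z" by (simp add: cinner_self)
qed

text \<open>Written with the midpoint on the right, the form in which the parallelogram law makes
  minimising sequences Cauchy.\<close>

lemma parallelogram:
  "(norm ((x::'h::chilbert_space) - y))\<^sup>2 = 2 * (norm x)\<^sup>2 + 2 * (norm y)\<^sup>2 - 4 * (norm ((1/2) *\<^sub>R (x + y)))\<^sup>2"
proof -
  have "(norm (x - (-y)))\<^sup>2 = (norm x)\<^sup>2 + 2 * Re (cinner x y) + (norm y)\<^sup>2"
    unfolding norm_diff_sq by (simp add: cinner_minus_right)
  then have "(norm (x + y))\<^sup>2 = (norm x)\<^sup>2 + 2 * Re (cinner x y) + (norm y)\<^sup>2"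
    by simp
  moreover have "4 * (norm ((1/2) *\<^sub>R (x + y)))\<^sup>2 = (norm (x + y))\<^sup>2"
    by (simp add: power_divide)
  ultimately show ?thesis
    unfolding norm_diff_sq by linarith
qed

lemma square_le_mult_imp_le:
  fixes a b :: real
  assumes "a * a \<le> a * b" "0 \<le> b"
  shows "a \<le> b"
proof (cases "a > 0")
  case True
  then show ?thesis using assms by simp
qed (use assms in simp)

text \<open>The Riesz vector is the minimiser of \<open>\<parallel>x\<parallel>\<^sup>2 - 2 Re (\<phi> x)\<close>.\<close>

lemma riesz_representation:
  fixes \<phi> :: "'h::chilbert_space \<Rightarrow> complex"
  assumes \<phi>: "bounded_linear \<phi>" and sc: "\<And>c x. \<phi> (c *\<^sub>C x) = c * \<phi> x"
  shows "\<exists>z. \<forall>x. \<phi> x = cinner x z"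
proof -
  interpret bounded_linear \<phi> by fact
  obtain K where K: "\<And>x. cmod (\<phi> x) \<le> norm x * K" using bounded by blast
  define J where "J x = (norm x)\<^sup>2 - 2 * Re (\<phi> x)" for x
  have low: "- K\<^sup>2 \<le> J x" for x
  proof -
    have "Re (\<phi> x) \<le> norm x * K" using K[of x] complex_Re_le_cmod order_trans by blast
    moreover have "0 \<le> (norm x - K)\<^sup>2" by simp
    ultimately show ?thesis unfolding J_def by (simp add: power2_diff)
  qed
  define m where "m = Inf (range J)"
  have bdd: "bdd_below (range J)" using low by (rule bdd_belowI2)
  have m_le: "m \<le> J x" for x unfolding m_def by (rule cInf_lower[OF _ bdd]) simp
  \<comment> \<open>The linear part of \<open>J\<close> cancels in the parallelogram law and the
    midpoint value is at least \<open>m\<close>, so near-minimisers are close together.\<close>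
  have mid: "(norm (x - y))\<^sup>2 \<le> 2 * J x + 2 * J y - 4 * m" for x y
  proof -
    have "Re (\<phi> ((1/2) *\<^sub>R (x + y))) = (Re (\<phi> x) + Re (\<phi> y)) / 2"
      by (simp add: scaleR add)
    then have "(norm (x - y))\<^sup>2 = 2 * J x + 2 * J y - 4 * J ((1/2) *\<^sub>R (x + y))"
      unfolding J_def parallelogram by simp
    moreover have "4 * m \<le> 4 * J ((1/2) *\<^sub>R (x + y))"
      using m_le[of "(1/2) *\<^sub>R (x + y)"] by simp
    ultimately show ?thesis by linarith
  qed
  have "\<exists>x. J x < m + 1 / Suc n" for n
    using cInf_lessD[of "range J" "m + 1 / Suc n"] by (auto simp: m_def[symmetric])
  then obtain f where f: "\<And>n. J (f n) < m + 1 / Suc n" by metis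
  have "Cauchy f"
  proof (rule metric_CauchyI)
    fix e :: real assume "e > 0"
    then obtain M where M: "1 / Suc M < e\<^sup>2 / 4"
      using nat_approx_posE[of "e\<^sup>2/4"] by auto
    have "dist (f n) (f k) < e" if "n \<ge> M" "k \<ge> M" for n k
    proof -
      have "1 / real (Suc n) \<le> 1 / Suc M" "1 / real (Suc k) \<le> 1 / Suc M"
        using that by (simp_all add: frac_le)
      then have "J (f n) < m + e\<^sup>2 / 4" "J (f k) < m + e\<^sup>2 / 4"
        using f[of n] f[of k] M by auto
      then have "(norm (f n - f k))\<^sup>2 < e\<^sup>2"
        using mid[of "f n" "f k"] by simp
      then show ?thesis using \<open>e > 0\<close> power_less_imp_less_base[of "norm (f n - f k)" 2 e]
          by (simp add: dist_norm)
    qed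
    then show "\<exists>M. \<forall>m\<ge>M. \<forall>n\<ge>M. dist (f m) (f n) < e" by blast
  qed
  then obtain z where z: "f \<longlonglongrightarrow> z" using Cauchy_convergent_iff convergent_def by metis
  have "(\<lambda>n. J (f n)) \<longlonglongrightarrow> J z"
    unfolding J_def by (intro tendsto_intros z tendsto)
  moreover have "(\<lambda>n. m + 1 / real (Suc n)) \<longlonglongrightarrow> m + 0"
    by (rule tendsto_add[OF tendsto_const LIMSEQ_Suc[OF lim_1_over_n]])
  ultimately have "J z \<le> m + 0"
    using f by (intro LIMSEQ_le) (auto intro: less_imp_le)
  then have zmin: "J z \<le> J x" for x using m_le[of x] by simp
  \<comment> \<open>Perturbing the minimiser \<open>z\<close> along \<open>w\<close> by real
    multiples cannot lower \<open>J\<close>, so the first-order term vanishes. This gives the real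
    part of the claim.\<close>
  have re: "Re (\<phi> w) = Re (cinner w z)" for w
  proof (rule ccontr)
    define b where "b = Re (cinner w z) - Re (\<phi> w)"
    assume "Re (\<phi> w) \<noteq> Re (cinner w z)"
    then have "b \<noteq> 0" by (simp add: b_def)
    have q: "0 \<le> t\<^sup>2 * (norm w)\<^sup>2 - 2 * t * b" for t
    proof -
      have "J (z - t *\<^sub>R w) = J z - 2 * t * b + t\<^sup>2 * (norm w)\<^sup>2"
        unfolding J_def norm_diff_sq b_def
        by (simp add: diff scaleR cinner_scaleR_right power_mult_distrib algebra_simps
            cinner_commute[of z w])
      then show ?thesis using zmin[of "z - t *\<^sub>R w"] by linarith
    qed
    \<comment> \<open>With the perturbation \<open>b * r\<close> the quadratic term is at most half
      of the linear one. The summand 1 keeps the denominator positive when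
      \<open>w = 0\<close>.\<close>
    define r where "r = 1 / ((norm w)\<^sup>2 + 1)"
    have r: "r > 0" by (simp add: r_def add_nonneg_pos)
    have rw: "r * (norm w)\<^sup>2 \<le> 1" unfolding r_def by (simp add: divide_le_eq add_nonneg_pos)
    have "(b * r)\<^sup>2 * (norm w)\<^sup>2 - 2 * (b * r) * b = b\<^sup>2 * r * (r * (norm w)\<^sup>2 - 2)"
      by (simp add: power2_eq_square algebra_simps)
    also have "\<dots> < 0"
      using r rw \<open>b \<noteq> 0\<close> by (intro mult_pos_neg) auto
    finally show False using q[of "b * r"] by linarith
  qed
  have "\<phi> x = cinner x z" for x
  proof (rule complex_eqI)
    show "Re (\<phi> x) = Re (cinner x z)" by (rule re)
    \<comment> \<open>Complex linearity recovers the imaginary part as a real part at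
      \<open>- \<i>\<close> times \<open>x\<close>.\<close>
    show "Im (\<phi> x) = Im (cinner x z)"
      using re[of "(- \<i>) *\<^sub>C x"] by (simp add: sc cinner_scaleC_left)
  qed
  then show ?thesis by blast
qed

text \<open>Here \<open>S\<close> is a mere function, so the bound is available while the adjoint is
  still under construction. It comes from |S x|^2 = <T (S x), x> by cancelling one factor |S
  x|.\<close>

lemma norm_adjoint_le:
  fixes T :: "'h::chilbert_space \<Rightarrow>\<^sub>L 'h"
  assumes S: "\<And>x y. cinner (T x) y = cinner x (S y)"
  shows "norm (S x) \<le> norm T * norm x"
proof -
  have "(norm (S x))\<^sup>2 = cmod (cinner (T (S x)) x)"
    by (simp add: S cinner_self norm_power)
  also have "\<dots> \<le> norm (T (S x)) * norm x" by (rule cinner_cauchy_schwarz)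
  also have "\<dots> \<le> (norm T * norm (S x)) * norm x"
    by (intro mult_right_mono norm_blinfun) simp
  finally have "norm (S x) * norm (S x) \<le> norm (S x) * (norm T * norm x)"
    by (simp add: power2_eq_square algebra_simps)
  then show ?thesis by (rule square_le_mult_imp_le) simp
qed

lemma adj_blinfun_exists:
  assumes T: "T \<in> bounded_clinear_ops"
  shows "\<exists>S. \<forall>x y. cinner (blinfun_apply T x) y = cinner x (blinfun_apply S y)"
proof -
  have "\<exists>z. \<forall>x. cinner (T x) y = cinner x z" for y
  proof (rule riesz_representation)
    show "bounded_linear (\<lambda>x. cinner (T x) y)"
      using bounded_linear_compose[OF bounded_bilinear.bounded_linear_left[OF bounded_bilinear_cinner]
          blinfun.bounded_linear_right] .
    show "cinner (T (c *\<^sub>C x)) y = c * cinner (T x) y" for c x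
      using T by (simp add: bounded_clinear_ops_def cinner_scaleC_left)
  qed
  then obtain S where S: "\<And>x y. cinner (T x) y = cinner x (S y)" by metis
  have "bounded_linear S"
  proof (rule bounded_linear_intro[where K = "norm T"])
    show "S (x + y) = S x + S y" for x y
      by (rule cinner_eqI) (simp add: S[symmetric] cinner_add_right)
    show "S (r *\<^sub>R x) = r *\<^sub>R S x" for r x
      by (rule cinner_eqI) (simp add: S[symmetric] cinner_scaleR_right)
    show "norm (S x) \<le> norm x * norm T" for x
      using norm_adjoint_le[OF S, of x] by (simp add: mult.commute)
  qed
  then have "\<forall>x y. cinner (T x) y = cinner x (Blinfun S y)"
    by (simp add: bounded_linear_Blinfun_apply S)
  then show ?thesis by blast
qed

text \<open>Resolves the definite description: adjoints of sums, multiples and products are all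
  computed by exhibiting a candidate and verifying the defining identity for it.\<close>

lemma adj_blinfun_unique:
  fixes T S :: "'h::chilbert_space \<Rightarrow>\<^sub>L 'h"
  assumes S: "\<And>x y. cinner (T x) y = cinner x (S y)"
  shows "adj_blinfun T = S"
  unfolding adj_blinfun_def
proof (rule the_equality)
  fix S' :: "'h \<Rightarrow>\<^sub>L 'h"
  assume *: "\<forall>x y. cinner (T x) y = cinner x (S' y)"
  have "cinner x (S' y) = cinner x (S y)" for x y
    using * S[of x y] by simp
  then show "S' = S"
    by - (rule blinfun_eqI, rule cinner_eqI)
qed (use S in blast)

lemma cinner_adj_right:
  assumes "T \<in> bounded_clinear_ops"
  shows "cinner (T x) y = cinner x (adj_blinfun T y)"
proof -
  obtain S where S: "\<And>x y. cinner (T x) y = cinner x (blinfun_apply S y)"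
    using adj_blinfun_exists[OF assms] by blast
  then have "adj_blinfun T = S" by (rule adj_blinfun_unique)
  then show ?thesis using S by simp
qed

lemma cinner_adj_left:
  assumes "T \<in> bounded_clinear_ops"
  shows "cinner (adj_blinfun T x) y = cinner x (T y)"
  using cinner_adj_right[OF assms, of y x] cinner_commute[of "adj_blinfun T x" y]
    cinner_commute[of x "T y"] by simp

lemma adj_blinfun_closed:
  assumes T: "T \<in> bounded_clinear_ops"
  shows "adj_blinfun T \<in> bounded_clinear_ops"
proof -
  have "adj_blinfun T (c *\<^sub>C x) = c *\<^sub>C adj_blinfun T x" for c x
    by (rule cinner_eqI) (simp add: cinner_adj_right[OF T, symmetric] cinner_scaleC_right)
  then show ?thesis by (simp add: bounded_clinear_ops_def)
qed

lemma adj_adj_blinfun: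
  assumes T: "T \<in> bounded_clinear_ops"
  shows "adj_blinfun (adj_blinfun T) = T"
  by (rule adj_blinfun_unique) (rule cinner_adj_left[OF T])

lemma norm_adj_blinfun_le:
  assumes T: "T \<in> bounded_clinear_ops"
  shows "norm (adj_blinfun T) \<le> norm T"
  by (rule norm_blinfun_bound, simp, rule norm_adjoint_le, rule cinner_adj_right[OF T])

lemma norm_adj_blinfun:
  assumes T: "T \<in> bounded_clinear_ops"
  shows "norm (adj_blinfun T) = norm T"
  using norm_adj_blinfun_le[OF T] norm_adj_blinfun_le[OF adj_blinfun_closed[OF T]]
  by (simp add: adj_adj_blinfun[OF T])

lemma adj_blinfun_add:
  assumes "T \<in> bounded_clinear_ops" "S \<in> bounded_clinear_ops"
  shows "adj_blinfun (T + S) = adj_blinfun T + adj_blinfun S"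
  by (rule adj_blinfun_unique)
    (simp add: blinfun.add_left cinner_add_left cinner_add_right cinner_adj_right assms)

lemma adj_blinfun_scaleC:
  assumes "T \<in> bounded_clinear_ops"
  shows "adj_blinfun (scaleC_blinfun c T) = scaleC_blinfun (cnj c) (adj_blinfun T)"
  by (rule adj_blinfun_unique)
    (simp add: scaleC_blinfun.rep_eq cinner_scaleC_left cinner_scaleC_right cinner_adj_right assms)

lemma adj_blinfun_0 [simp]: "adj_blinfun (0 :: 'h::chilbert_space \<Rightarrow>\<^sub>L 'h) = 0"
  by (rule adj_blinfun_unique) simp

lemma bounded_clinear_ops_closed:
  shows "0 \<in> bounded_clinear_ops"
    and "id_blinfun \<in> bounded_clinear_ops"
    and "S \<in> bounded_clinear_ops \<Longrightarrow> T \<in> bounded_clinear_ops \<Longrightarrow> S + T \<in> bounded_clinear_ops"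
    and "T \<in> bounded_clinear_ops \<Longrightarrow> scaleC_blinfun c T \<in> bounded_clinear_ops"
    and "S \<in> bounded_clinear_ops \<Longrightarrow> T \<in> bounded_clinear_ops \<Longrightarrow> S o\<^sub>L T \<in> bounded_clinear_ops"
  by (auto simp: bounded_clinear_ops_def blinfun.add_left scaleC_add_right
      scaleC_blinfun.rep_eq scaleC_scaleC mult.commute)

text \<open>Keeps the entrywise limit of a Cauchy sequence of matrices complex linear. The set is an
  intersection of closed conditions, one for each scalar and vector.\<close>

lemma closed_bounded_clinear_ops: "closed (bounded_clinear_ops :: ('h::chilbert_space \<Rightarrow>\<^sub>L 'h) set)"
proof -
  have "(bounded_clinear_ops :: ('h \<Rightarrow>\<^sub>L 'h) set) =
      (\<Inter>c x. {T. blinfun_apply T (c *\<^sub>C x) - c *\<^sub>C blinfun_apply T x = 0})"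
    by (auto simp: bounded_clinear_ops_def)
  also have "closed \<dots>"
    by (intro closed_INT ballI closed_Collect_eq continuous_intros
        bounded_linear.continuous_on[OF bounded_linear_scaleC]
        bounded_linear.continuous_on[OF blinfun.bounded_linear_left])
  finally show ?thesis .
qed

lemma norm_scaleC_blinfun: "norm (scaleC_blinfun c (T :: 'h::chilbert_space \<Rightarrow>\<^sub>L 'h)) = cmod c * norm T"
proof -
  have le: "norm (scaleC_blinfun c (T :: 'h \<Rightarrow>\<^sub>L 'h)) \<le> cmod c * norm T" for c T
    by (rule norm_blinfun_bound)
      (auto simp: scaleC_blinfun.rep_eq norm_scaleC mult.assoc intro!: mult_left_mono norm_blinfun)
  show ?thesis
  proof (cases "c = 0")
    case False
    have "scaleC_blinfun (inverse c) (scaleC_blinfun c T) = T"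
      by (rule blinfun_eqI) (simp add: scaleC_blinfun.rep_eq scaleC_scaleC False)
    then have "norm T \<le> cmod (inverse c) * norm (scaleC_blinfun c T)"
      by (metis le)
    then have "norm T \<le> inverse (cmod c) * norm (scaleC_blinfun c T)"
      by (metis norm_inverse)
    then have "cmod c * norm T \<le> norm (scaleC_blinfun c T)"
      using False by (simp add: field_simps)
    then show ?thesis using le[of c T] by simp
  qed (use le[of 0 T] in simp)
qed

section \<open>Square-summable families\<close>

text \<open>Summability is reduced to a uniform bound on finite partial sums, so that all estimates
  can be carried out on finite sets.\<close>

lemma abs_summable_onI_sum_le:
  fixes f :: "'a \<Rightarrow> 'b::real_normed_vector"
  assumes "\<And>F. finite F \<Longrightarrow> F \<subseteq> A \<Longrightarrow> (\<Sum>x\<in>F. norm (f x)) \<le> C"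
  shows "f abs_summable_on A"
  unfolding abs_summable_iff_bdd_above by (rule bdd_aboveI2[where M = C]) (use assms in auto)

lemma norm_infsum_le:
  fixes f :: "'a \<Rightarrow> 'b::real_normed_vector"
  assumes "\<And>F. finite F \<Longrightarrow> F \<subseteq> A \<Longrightarrow> (\<Sum>x\<in>F. norm (f x)) \<le> C"
  shows "norm (infsum f A) \<le> C"
proof -
  have abs: "f abs_summable_on A" using assms by (rule abs_summable_onI_sum_le)
  have "norm (infsum f A) \<le> infsum (\<lambda>x. norm (f x)) A"
    using abs by (rule norm_infsum_bound)
  also have "\<dots> \<le> C" using abs assms by (rule infsum_le_finite_sums)
  finally show ?thesis .
qed

text \<open>A finite subset of the product lies in the rectangle of its two projections, so bounds
  on finite rectangles suffice.\<close>

lemma abs_summable_on_TimesI_sum_le: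
  fixes f :: "'a \<Rightarrow> 'b \<Rightarrow> 'c::real_normed_vector"
  assumes "\<And>F G. finite F \<Longrightarrow> finite G \<Longrightarrow> F \<subseteq> A \<Longrightarrow> G \<subseteq> B \<Longrightarrow>
    (\<Sum>x\<in>F. \<Sum>y\<in>G. norm (f x y)) \<le> C"
  shows "(\<lambda>(x, y). f x y) abs_summable_on A \<times> B"
proof (rule abs_summable_onI_sum_le)
  fix H assume H: "finite H" "H \<subseteq> A \<times> B"
  have "(\<Sum>p\<in>H. norm (case p of (x, y) \<Rightarrow> f x y)) \<le>
      (\<Sum>p\<in>fst ` H \<times> snd ` H. norm (case p of (x, y) \<Rightarrow> f x y))"
    using H by (intro sum_mono2) (auto simp: rev_image_eqI)
  also have "\<dots> = (\<Sum>x\<in>fst ` H. \<Sum>y\<in>snd ` H. norm (f x y))"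
    by (simp add: sum.cartesian_product case_prod_beta)
  also have "\<dots> \<le> C" using H by (intro assms) auto
  finally show "(\<Sum>p\<in>H. norm (case p of (x, y) \<Rightarrow> f x y)) \<le> C" .
qed

lemma infsum_swap_abs:
  fixes f :: "'a \<Rightarrow> 'b \<Rightarrow> 'c::banach"
  assumes "\<And>F G. finite F \<Longrightarrow> finite G \<Longrightarrow> F \<subseteq> A \<Longrightarrow> G \<subseteq> B \<Longrightarrow>
    (\<Sum>x\<in>F. \<Sum>y\<in>G. norm (f x y)) \<le> C"
  shows "(\<Sum>\<^sub>\<infinity>x\<in>A. \<Sum>\<^sub>\<infinity>y\<in>B. f x y) = (\<Sum>\<^sub>\<infinity>y\<in>B. \<Sum>\<^sub>\<infinity>x\<in>A. f x y)"
  by (rule infsum_swap_banach, rule abs_summable_summable,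
      rule abs_summable_on_TimesI_sum_le, rule assms)

lemma l2_spaceD:
  assumes "f \<in> l2_space X"
  shows "k \<notin> X \<Longrightarrow> f k = 0" and "(\<lambda>k. (norm (f k))\<^sup>2) summable_on X"
  using assms by (auto simp: l2_space_def)

lemma l2_norm_nonneg [simp]: "0 \<le> l2_norm X f"
  by (simp add: l2_norm_def infsum_nonneg)

lemma l2_norm_sq: "(l2_norm X f)\<^sup>2 = (\<Sum>\<^sub>\<infinity>k\<in>X. (norm (f k))\<^sup>2)"
  by (simp add: l2_norm_def infsum_nonneg)

lemma sum_le_l2_norm_sq:
  assumes "f \<in> l2_space X" "finite F" "F \<subseteq> X"
  shows "(\<Sum>k\<in>F. (norm (f k))\<^sup>2) \<le> (l2_norm X f)\<^sup>2"
  unfolding l2_norm_sq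
  by (rule finite_sum_le_infsum) (use assms l2_spaceD in auto)

lemma norm_le_l2_norm:
  assumes "f \<in> l2_space X"
  shows "norm (f k) \<le> l2_norm X f"
proof (cases "k \<in> X")
  case True
  then have "(norm (f k))\<^sup>2 \<le> (l2_norm X f)\<^sup>2"
    using sum_le_l2_norm_sq[OF assms, of "{k}"] by simp
  then show ?thesis by (rule power2_le_imp_le) simp
qed (simp add: l2_spaceD[OF assms])

lemma
  assumes supp: "\<And>k. k \<notin> X \<Longrightarrow> f k = 0"
    and le: "\<And>F. finite F \<Longrightarrow> F \<subseteq> X \<Longrightarrow> (\<Sum>k\<in>F. (norm (f k))\<^sup>2) \<le> C\<^sup>2"
  shows l2_spaceI: "f \<in> l2_space X"
    and l2_norm_leI: "0 \<le> C \<Longrightarrow> l2_norm X f \<le> C"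
proof -
  have s: "(\<lambda>k. (norm (f k))\<^sup>2) summable_on X"
    by (rule nonneg_bdd_above_summable_on) (auto intro!: bdd_aboveI2[where M = "C\<^sup>2"] le)
  then show "f \<in> l2_space X" using supp by (auto simp: l2_space_def)
  have "(l2_norm X f)\<^sup>2 \<le> C\<^sup>2"
    unfolding l2_norm_sq using s le by (rule infsum_le_finite_sums)
  then show "0 \<le> C \<Longrightarrow> l2_norm X f \<le> C" by (rule power2_le_imp_le)
qed

lemma l2_space_0 [simp]: "(\<lambda>k. 0) \<in> l2_space X"
  by (rule l2_spaceI[where C = 0]) auto

lemma l2_space_add:
  assumes f: "f \<in> l2_space X" and g: "g \<in> l2_space X"
  shows "(\<lambda>k. f k + g k) \<in> l2_space X"
proof (rule l2_spaceI)
  show "f k + g k = 0" if "k \<notin> X" for k using that f g by (simp add: l2_spaceD)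
  fix F assume F: "finite F" "F \<subseteq> X"
  \<comment> \<open>The triangle inequality for \<open>l2_norm\<close> will follow only from the
    inner product; for mere membership this crude quadratic bound is enough.\<close>
  have "(norm (f k + g k))\<^sup>2 \<le> 2 * (norm (f k))\<^sup>2 + 2 * (norm (g k))\<^sup>2" for k
  proof -
    have "(norm (f k + g k))\<^sup>2 \<le> (norm (f k) + norm (g k))\<^sup>2"
      by (intro power_mono norm_triangle_ineq) simp
    also have "\<dots> \<le> 2 * (norm (f k))\<^sup>2 + 2 * (norm (g k))\<^sup>2"
      using sum_squares_bound[of "norm (f k)" "norm (g k)"] by (simp add: power2_sum)
    finally show ?thesis .
  qed
  then have "(\<Sum>k\<in>F. (norm (f k + g k))\<^sup>2) \<le> (\<Sum>k\<in>F. 2 * (norm (f k))\<^sup>2 + 2 * (norm (g k))\<^sup>2)"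
    by (rule sum_mono)
  also have "\<dots> = 2 * (\<Sum>k\<in>F. (norm (f k))\<^sup>2) + 2 * (\<Sum>k\<in>F. (norm (g k))\<^sup>2)"
    by (simp add: sum.distrib sum_distrib_left)
  also have "\<dots> \<le> 2 * (l2_norm X f)\<^sup>2 + 2 * (l2_norm X g)\<^sup>2"
    using sum_le_l2_norm_sq[OF f F] sum_le_l2_norm_sq[OF g F] by simp
  also have "\<dots> = (sqrt (2 * (l2_norm X f)\<^sup>2 + 2 * (l2_norm X g)\<^sup>2))\<^sup>2" by simp
  finally show "(\<Sum>k\<in>F. (norm (f k + g k))\<^sup>2) \<le> \<dots>" .
qed

lemma l2_norm_scaleC: "l2_norm X (\<lambda>k. c *\<^sub>C f k) = cmod c * l2_norm X f"
  by (simp add: l2_norm_def norm_scaleC power_mult_distrib infsum_cmult_right' real_sqrt_mult)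

lemma l2_space_scaleC:
  assumes "f \<in> l2_space X"
  shows "(\<lambda>k. c *\<^sub>C f k) \<in> l2_space X"
  using assms
  by (auto simp: l2_space_def norm_scaleC power_mult_distrib intro!: summable_on_cmult_right)

lemma l2_space_diff:
  assumes "f \<in> l2_space X" and "g \<in> l2_space X"
  shows "(\<lambda>k. f k - g k) \<in> l2_space X"
  using l2_space_add[OF assms(1) l2_space_scaleC[OF assms(2), of "-1"]]
  by (simp add: scaleC_minus_left)

section \<open>The inner product of square-summable families\<close>

definition l2_inner :: "'i set \<Rightarrow> ('i \<Rightarrow> 'h::chilbert_space) \<Rightarrow> ('i \<Rightarrow> 'h) \<Rightarrow> complex" where
  "l2_inner X f g = (\<Sum>\<^sub>\<infinity>k\<in>X. cinner (f k) (g k))"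

lemma sum_norm_mult_le_l2_norm:
  assumes f: "f \<in> l2_space X" and g: "g \<in> l2_space X" and F: "finite F" "F \<subseteq> X"
  shows "(\<Sum>k\<in>F. norm (f k) * norm (g k)) \<le> l2_norm X f * l2_norm X g"
proof (rule power2_le_imp_le)
  have "(\<Sum>k\<in>F. norm (f k) * norm (g k))\<^sup>2 \<le> (\<Sum>k\<in>F. (norm (f k))\<^sup>2) * (\<Sum>k\<in>F. (norm (g k))\<^sup>2)"
    by (rule Cauchy_Schwarz_ineq_sum)
  also have "\<dots> \<le> (l2_norm X f)\<^sup>2 * (l2_norm X g)\<^sup>2"
    by (intro mult_mono sum_le_l2_norm_sq assms sum_nonneg) auto
  finally show "(\<Sum>k\<in>F. norm (f k) * norm (g k))\<^sup>2 \<le> (l2_norm X f * l2_norm X g)\<^sup>2"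
    by (simp add: power_mult_distrib)
qed simp

lemma sum_norm_cinner_le:
  assumes f: "f \<in> l2_space X" and g: "g \<in> l2_space X" and F: "finite F" "F \<subseteq> X"
  shows "(\<Sum>k\<in>F. cmod (cinner (f k) (g k))) \<le> l2_norm X f * l2_norm X g"
  by (rule order_trans[OF sum_mono[OF cinner_cauchy_schwarz] sum_norm_mult_le_l2_norm[OF assms]])

lemma l2_inner_summable:
  assumes "f \<in> l2_space X" and "g \<in> l2_space X"
  shows "(\<lambda>k. cinner (f k) (g k)) summable_on X"
  by (rule abs_summable_summable, rule abs_summable_onI_sum_le, rule sum_norm_cinner_le[OF assms])

lemma l2_inner_cauchy_schwarz:
  assumes "f \<in> l2_space X" and "g \<in> l2_space X"
  shows "cmod (l2_inner X f g) \<le> l2_norm X f * l2_norm X g"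
  unfolding l2_inner_def by (rule norm_infsum_le, rule sum_norm_cinner_le[OF assms])

lemma l2_inner_self:
  assumes "f \<in> l2_space X"
  shows "l2_inner X f f = of_real ((l2_norm X f)\<^sup>2)"
proof -
  have "((\<lambda>k. complex_of_real ((norm (f k))\<^sup>2)) has_sum of_real ((l2_norm X f)\<^sup>2)) X"
    unfolding has_sum_of_real_iff l2_norm_sq
    using l2_spaceD(2)[OF assms] by (rule has_sum_infsum)
  then show ?thesis
    unfolding l2_inner_def cinner_self by (rule infsumI)
qed

lemma l2_inner_diff_left:
  assumes "f \<in> l2_space X" "g \<in> l2_space X" "h \<in> l2_space X"
  shows "l2_inner X (\<lambda>k. f k - g k) h = l2_inner X f h - l2_inner X g h"
proof -
  have "((\<lambda>k. cinner (f k) (h k) - cinner (g k) (h k)) has_sum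
      (l2_inner X f h - l2_inner X g h)) X"
    unfolding diff_conv_add_uminus l2_inner_def
    by (intro has_sum_add has_sum_uminusI has_sum_infsum l2_inner_summable assms)
  then show ?thesis
    unfolding l2_inner_def cinner_diff_left by (rule infsumI)
qed

lemma l2_inner_scaleC_left: "l2_inner X (\<lambda>k. c *\<^sub>C f k) g = c * l2_inner X f g"
  unfolding l2_inner_def cinner_scaleC_left by (rule infsum_cmult_right')

lemma l2_inner_commute: "l2_inner X f g = cnj (l2_inner X g f)"
  unfolding l2_inner_def infsum_cnj[symmetric] by (rule infsum_cong) (rule cinner_commute)

lemma l2_inner_scaleC_right: "l2_inner X f (\<lambda>k. c *\<^sub>C g k) = cnj c * l2_inner X f g"
  by (subst (1 2) l2_inner_commute) (simp add: l2_inner_scaleC_left)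

lemma l2_norm_diff_sq:
  assumes f: "f \<in> l2_space X" and g: "g \<in> l2_space X"
  shows "(l2_norm X (\<lambda>k. f k - g k))\<^sup>2 =
    (l2_norm X f)\<^sup>2 - 2 * Re (l2_inner X f g) + (l2_norm X g)\<^sup>2"
proof -
  let ?d = "\<lambda>k. f k - g k"
  note d = l2_space_diff[OF f g]
  have r: "l2_inner X h ?d = l2_inner X h f - l2_inner X h g" if "h \<in> l2_space X" for h
    unfolding l2_inner_commute[of X h] by (simp add: l2_inner_diff_left f g that)
  have "complex_of_real ((l2_norm X ?d)\<^sup>2) =
      of_real ((l2_norm X f)\<^sup>2) - l2_inner X f g - (l2_inner X g f - of_real ((l2_norm X g)\<^sup>2))"
    using l2_inner_self[OF f] l2_inner_self[OF g] l2_inner_self[OF d]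
    by (simp add: l2_inner_diff_left f g d r)
  then have "Re (complex_of_real ((l2_norm X ?d)\<^sup>2)) =
      Re (of_real ((l2_norm X f)\<^sup>2) - l2_inner X f g - (l2_inner X g f - of_real ((l2_norm X g)\<^sup>2)))"
    by simp
  moreover have "Re (l2_inner X g f) = Re (l2_inner X f g)"
    by (subst l2_inner_commute) simp
  ultimately show ?thesis by (simp del: of_real_power)
qed

lemma l2_norm_triangle:
  assumes f: "f \<in> l2_space X" and g: "g \<in> l2_space X"
  shows "l2_norm X (\<lambda>k. f k + g k) \<le> l2_norm X f + l2_norm X g"
proof (rule power2_le_imp_le)
  \<comment> \<open>The sum is treated as f - (- g), so that the expansion of a squared difference
    and Cauchy-Schwarz apply.\<close>
  have "- Re (l2_inner X f (\<lambda>k. - g k)) \<le> l2_norm X f * l2_norm X g"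
  proof -
    have "- Re (l2_inner X f (\<lambda>k. - g k)) \<le> cmod (l2_inner X f (\<lambda>k. - g k))"
      using abs_Re_le_cmod[of "l2_inner X f (\<lambda>k. - g k)"] by linarith
    also have "\<dots> = cmod (l2_inner X f g)"
      using l2_inner_scaleC_right[of X f "-1" g] by (simp add: scaleC_minus_left norm_mult)
    also have "\<dots> \<le> l2_norm X f * l2_norm X g" by (rule l2_inner_cauchy_schwarz[OF f g])
    finally show ?thesis .
  qed
  moreover have "(\<lambda>k. - g k) \<in> l2_space X"
    using l2_space_scaleC[OF g, of "-1"] by (simp add: scaleC_minus_left)
  moreover have "l2_norm X (\<lambda>k. - g k) = l2_norm X g"
    using l2_norm_scaleC[of X "-1" g] by (simp add: scaleC_minus_left)
  ultimately show "(l2_norm X (\<lambda>k. f k + g k))\<^sup>2 \<le> (l2_norm X f + l2_norm X g)\<^sup>2"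
    using l2_norm_diff_sq[OF f, of "\<lambda>k. - g k"] by (simp add: power2_sum)
qed simp

lemma l2_space_single:
  assumes "l \<in> X"
  shows "(\<lambda>k. if k = l then x else 0) \<in> l2_space X"
    and "l2_norm X (\<lambda>k. if k = l then x else 0) = norm x"
proof -
  let ?f = "\<lambda>k. if k = l then x else 0"
  have le: "(\<Sum>k\<in>F. (norm (?f k))\<^sup>2) \<le> (norm x)\<^sup>2" if "finite F" for F
  proof -
    have "(\<Sum>k\<in>F. (norm (?f k))\<^sup>2) = (\<Sum>k\<in>F. if k = l then (norm x)\<^sup>2 else 0)"
      by (rule sum.cong) auto
    also have "\<dots> \<le> (norm x)\<^sup>2" using that by simp
    finally show ?thesis .
  qed
  show f: "?f \<in> l2_space X" by (rule l2_spaceI[OF _ le]) (use assms in auto)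
  have "l2_norm X ?f \<le> norm x" by (rule l2_norm_leI[OF _ le]) (use assms in auto)
  moreover have "norm x \<le> l2_norm X ?f" using norm_le_l2_norm[OF f, of l] by simp
  ultimately show "l2_norm X ?f = norm x" by simp
qed

section \<open>The Schur test\<close>

text \<open>The Schur condition in terms of finite partial sums: it speaks of real numbers only and
  involves no summability, yet one constant controls rows and columns at once.\<close>

definition row_col_le :: "'i set \<Rightarrow> ('i \<Rightarrow> 'i \<Rightarrow> real) \<Rightarrow> real \<Rightarrow> bool" where
  "row_col_le X a C \<longleftrightarrow>
     (\<forall>k\<in>X. \<forall>F. finite F \<longrightarrow> F \<subseteq> X \<longrightarrow> (\<Sum>l\<in>F. a k l) \<le> C) \<and>
     (\<forall>l\<in>X. \<forall>F. finite F \<longrightarrow> F \<subseteq> X \<longrightarrow> (\<Sum>k\<in>F. a k l) \<le> C)"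

lemma row_col_leD:
  assumes "row_col_le X a C" "finite F" "F \<subseteq> X"
  shows "k \<in> X \<Longrightarrow> (\<Sum>l\<in>F. a k l) \<le> C" and "l \<in> X \<Longrightarrow> (\<Sum>k\<in>F. a k l) \<le> C"
  using assms by (auto simp: row_col_le_def)

lemma row_col_le_mono:
  assumes "row_col_le X a C" "\<And>k l. k \<in> X \<Longrightarrow> l \<in> X \<Longrightarrow> b k l \<le> a k l" "C \<le> D"
  shows "row_col_le X b D"
  unfolding row_col_le_def
proof (intro conjI ballI allI impI)
  fix k F assume F: "k \<in> X" "finite F" "F \<subseteq> X"
  have "(\<Sum>l\<in>F. b k l) \<le> (\<Sum>l\<in>F. a k l)" using F assms(2) by (intro sum_mono) auto
  then show "(\<Sum>l\<in>F. b k l) \<le> D" using row_col_leD(1)[OF assms(1)] F assms(3) by force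
  have "(\<Sum>l\<in>F. b l k) \<le> (\<Sum>l\<in>F. a l k)" using F assms(2) by (intro sum_mono) auto
  then show "(\<Sum>l\<in>F. b l k) \<le> D" using row_col_leD(2)[OF assms(1)] F assms(3) by force
qed

text \<open>Each condition involves a finite sum, so it survives entrywise limits; in the
  completeness proof this replaces Fatou's lemma.\<close>

lemma row_col_le_LIMSEQ:
  assumes lim: "\<And>k l. (\<lambda>n. a n k l) \<longlonglongrightarrow> b k l" and le: "\<And>n. n \<ge> N \<Longrightarrow> row_col_le X (a n) C"
  shows "row_col_le X b C"
  unfolding row_col_le_def
proof (intro conjI ballI allI impI)
  fix k F assume F: "k \<in> X" "finite F" "F \<subseteq> X"
  have "(\<lambda>n. \<Sum>l\<in>F. a n k l) \<longlonglongrightarrow> (\<Sum>l\<in>F. b k l)" "(\<lambda>n. \<Sum>l\<in>F. a n l k) \<longlonglongrightarrow> (\<Sum>l\<in>F. b l k)"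
    by (intro tendsto_sum lim)+
  moreover have "\<forall>n\<ge>N. (\<Sum>l\<in>F. a n k l) \<le> C" "\<forall>n\<ge>N. (\<Sum>l\<in>F. a n l k) \<le> C"
    using row_col_leD[OF le F(2,3)] F(1) by blast+
  ultimately show "(\<Sum>l\<in>F. b k l) \<le> C" "(\<Sum>l\<in>F. b l k) \<le> C"
    by (blast intro: LIMSEQ_le_const2)+
qed

lemma row_col_le_transpose: "row_col_le X a C \<Longrightarrow> row_col_le X (\<lambda>k l. a l k) C"
  by (auto simp: row_col_le_def)

lemma row_col_le_add:
  assumes "row_col_le X a C" "row_col_le X b D"
  shows "row_col_le X (\<lambda>k l. a k l + b k l) (C + D)"
  using assms by (auto simp: row_col_le_def sum.distrib intro!: add_mono)

lemma sum_mult_le_row_col: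
  fixes a b :: "'i \<Rightarrow> 'i \<Rightarrow> real"
  assumes a: "row_col_le X a C" and b: "row_col_le X b D" and "0 \<le> D"
    and nn: "\<And>k l. 0 \<le> a k l" "\<And>k l. 0 \<le> b k l"
    and F: "finite F" "F \<subseteq> X" and G: "finite G" "G \<subseteq> X" and k: "k \<in> X"
  shows "(\<Sum>l\<in>G. \<Sum>n\<in>F. a k n * b n l) \<le> C * D"
proof -
  have "(\<Sum>l\<in>G. \<Sum>n\<in>F. a k n * b n l) = (\<Sum>n\<in>F. a k n * (\<Sum>l\<in>G. b n l))"
    by (subst sum.swap) (simp add: sum_distrib_left)
  also have "\<dots> \<le> (\<Sum>n\<in>F. a k n * D)"
    using F G nn row_col_leD(1)[OF b G] by (intro sum_mono mult_left_mono) auto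
  also have "\<dots> \<le> C * D"
    unfolding sum_distrib_right[symmetric]
    using row_col_leD(1)[OF a F k] \<open>0 \<le> D\<close> by (intro mult_right_mono)
  finally show ?thesis .
qed

text \<open>Cauchy-Schwarz after splitting each entry into two square roots: row sums bound the
  first factor, and column sums bound the second once the order of summation is exchanged.\<close>

lemma schur_test_finite:
  fixes a :: "'i \<Rightarrow> 'i \<Rightarrow> real"
  assumes a: "row_col_le X a C" and nn: "\<And>k l. 0 \<le> a k l" and "0 \<le> C"
    and F: "finite F" "F \<subseteq> X" and G: "finite G" "G \<subseteq> X"
  shows "(\<Sum>k\<in>F. (\<Sum>l\<in>G. a k l * x l)\<^sup>2) \<le> C\<^sup>2 * (\<Sum>l\<in>G. (x l)\<^sup>2)"
proof -
  have "(\<Sum>l\<in>G. a k l * x l)\<^sup>2 \<le> C * (\<Sum>l\<in>G. a k l * (x l)\<^sup>2)" if k: "k \<in> X" for k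
  proof -
    have "(\<Sum>l\<in>G. a k l * x l)\<^sup>2 = (\<Sum>l\<in>G. sqrt (a k l) * (sqrt (a k l) * x l))\<^sup>2"
      by (simp add: nn flip: mult.assoc)
    also have "\<dots> \<le> (\<Sum>l\<in>G. (sqrt (a k l))\<^sup>2) * (\<Sum>l\<in>G. (sqrt (a k l) * x l)\<^sup>2)"
      by (rule Cauchy_Schwarz_ineq_sum)
    also have "\<dots> = (\<Sum>l\<in>G. a k l) * (\<Sum>l\<in>G. a k l * (x l)\<^sup>2)"
      by (simp add: nn power_mult_distrib)
    also have "\<dots> \<le> C * (\<Sum>l\<in>G. a k l * (x l)\<^sup>2)"
      using row_col_leD(1)[OF a G k] by (intro mult_right_mono sum_nonneg) (auto simp: nn)
    finally show ?thesis .
  qed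
  then have "(\<Sum>k\<in>F. (\<Sum>l\<in>G. a k l * x l)\<^sup>2) \<le> (\<Sum>k\<in>F. C * (\<Sum>l\<in>G. a k l * (x l)\<^sup>2))"
    using F by (intro sum_mono) auto
  also have "\<dots> = C * (\<Sum>l\<in>G. (\<Sum>k\<in>F. a k l) * (x l)\<^sup>2)"
    by (simp add: sum_distrib_left[symmetric] sum_distrib_right sum.swap[of _ F])
  also have "\<dots> \<le> C * (\<Sum>l\<in>G. C * (x l)\<^sup>2)"
    using F G row_col_leD(2)[OF a F] \<open>0 \<le> C\<close> by (intro mult_left_mono sum_mono mult_right_mono) auto
  also have "\<dots> = C\<^sup>2 * (\<Sum>l\<in>G. (x l)\<^sup>2)"
    by (simp add: sum_distrib_left power2_eq_square mult.assoc)
  finally show ?thesis .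
qed

section \<open>Matrices as operators on square-summable families\<close>

lemma infsum_bounded_linear:
  fixes h :: "'a::real_normed_vector \<Rightarrow> 'b::real_normed_vector"
  assumes "bounded_linear h" and "f summable_on A"
  shows "(\<Sum>\<^sub>\<infinity>x\<in>A. h (f x)) = h (infsum f A)"
  by (rule infsumI, rule has_sum_bounded_linear[OF assms(1) has_sum_infsum[OF assms(2)]])

text \<open>Transfers a bound from finite truncations of the inner series to the series itself, by
  continuity. The functions \<phi> will be the squared norm or the norm times a weight.\<close>

lemma sum_infsum_le:
  fixes f :: "'i \<Rightarrow> 'j \<Rightarrow> 'b::banach" and \<phi> :: "'i \<Rightarrow> 'b \<Rightarrow> real"
  assumes sm: "\<And>l. l \<in> F \<Longrightarrow> f l summable_on X"
    and cont: "\<And>l y. l \<in> F \<Longrightarrow> isCont (\<phi> l) y"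
    and le: "\<And>G. finite G \<Longrightarrow> G \<subseteq> X \<Longrightarrow> (\<Sum>l\<in>F. \<phi> l (\<Sum>n\<in>G. f l n)) \<le> C"
  shows "(\<Sum>l\<in>F. \<phi> l (\<Sum>\<^sub>\<infinity>n\<in>X. f l n)) \<le> C"
proof (rule tendsto_upperbound)
  show "((\<lambda>G. \<Sum>l\<in>F. \<phi> l (\<Sum>n\<in>G. f l n)) \<longlongrightarrow> (\<Sum>l\<in>F. \<phi> l (\<Sum>\<^sub>\<infinity>n\<in>X. f l n)))
      (finite_subsets_at_top X)"
    by (intro tendsto_sum isCont_tendsto_compose[OF cont] infsum_tendsto sm)
  show "\<forall>\<^sub>F G in finite_subsets_at_top X. (\<Sum>l\<in>F. \<phi> l (\<Sum>n\<in>G. f l n)) \<le> C"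
    by (rule eventually_finite_subsets_at_top_weakI) (rule le)
qed (rule finite_subsets_at_top_neq_bot)

text \<open>The product of the algebra, detached from \<open>u\<close> and \<open>s\<close>, so that
  facts about it serve all weights at once.\<close>

definition mat_mult :: "'i set \<Rightarrow> ('i \<Rightarrow> 'i \<Rightarrow> ('h::chilbert_space \<Rightarrow>\<^sub>L 'h)) \<Rightarrow>
    ('i \<Rightarrow> 'i \<Rightarrow> ('h \<Rightarrow>\<^sub>L 'h)) \<Rightarrow> 'i \<Rightarrow> 'i \<Rightarrow> ('h \<Rightarrow>\<^sub>L 'h)" where
  "mat_mult X A B = (\<lambda>k l. \<Sum>\<^sub>\<infinity>n\<in>X. A k n o\<^sub>L B n l)"

definition mat_adj :: "('i \<Rightarrow> 'i \<Rightarrow> ('h::chilbert_space \<Rightarrow>\<^sub>L 'h)) \<Rightarrow> 'i \<Rightarrow> 'i \<Rightarrow> ('h \<Rightarrow>\<^sub>L 'h)" where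
  "mat_adj A = (\<lambda>k l. adj_blinfun (A l k))"

abbreviation schur_bounded ::
    "(real ^ 'd) set \<Rightarrow> ('d, 'h::chilbert_space) op_matrix \<Rightarrow> real \<Rightarrow> bool" where
  "schur_bounded X A C \<equiv> row_col_le X (\<lambda>k l. norm (A k l)) C"

lemma op_matricesD:
  assumes "A \<in> op_matrices X"
  shows "A k l \<in> bounded_clinear_ops" and "k \<notin> X \<or> l \<notin> X \<Longrightarrow> A k l = 0"
proof -
  show "A k l \<in> bounded_clinear_ops"
    using assms bounded_clinear_ops_closed(1) unfolding op_matrices_def
    by (cases "k \<in> X \<and> l \<in> X") auto
qed (use assms in \<open>auto simp: op_matrices_def\<close>)

lemma op_matricesI:
  assumes "\<And>k l. k \<in> X \<Longrightarrow> l \<in> X \<Longrightarrow> A k l \<in> bounded_clinear_ops"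
    "\<And>k l. k \<notin> X \<or> l \<notin> X \<Longrightarrow> A k l = 0"
  shows "A \<in> op_matrices X"
  using assms by (auto simp: op_matrices_def)

context
  fixes X :: "(real ^ 'd) set" and A :: "('d, 'h::chilbert_space) op_matrix" and C :: real
  assumes A: "A \<in> op_matrices X" and C: "schur_bounded X A C" "0 \<le> C"
begin

lemma sum_norm_row_apply_le:
  assumes f: "\<And>l. norm (f l) \<le> M" and k: "k \<in> X" and F: "finite F" "F \<subseteq> X" and "0 \<le> M"
  shows "(\<Sum>l\<in>F. norm (A k l (f l))) \<le> C * M"
proof -
  have "(\<Sum>l\<in>F. norm (A k l (f l))) \<le> (\<Sum>l\<in>F. norm (A k l) * M)"
    by (intro sum_mono order_trans[OF norm_blinfun] mult_left_mono f) simp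
  also have "\<dots> \<le> C * M"
    unfolding sum_distrib_right[symmetric]
    using row_col_leD(1)[OF C(1) F k] \<open>0 \<le> M\<close> by (rule mult_right_mono)
  finally show ?thesis .
qed

lemma row_apply_summable:
  assumes f: "f \<in> l2_space X" and k: "k \<in> X"
  shows "(\<lambda>l. A k l (f l)) summable_on X"
  by (rule abs_summable_summable, rule abs_summable_onI_sum_le,
      rule sum_norm_row_apply_le[OF norm_le_l2_norm[OF f] k]) auto

lemma
  assumes f: "f \<in> l2_space X"
  shows matrix_op_in_l2: "matrix_op X A f \<in> l2_space X"
    and matrix_op_norm_le: "l2_norm X (matrix_op X A f) \<le> C * l2_norm X f"
proof -
  have supp: "matrix_op X A f k = 0" if "k \<notin> X" for k
    using that f by (simp add: matrix_op_def op_matricesD[OF A])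
  have le: "(\<Sum>k\<in>F. (norm (matrix_op X A f k))\<^sup>2) \<le> (C * l2_norm X f)\<^sup>2" if F: "finite F" "F \<subseteq> X" for F
  proof -
    have "(\<Sum>k\<in>F. (norm (\<Sum>\<^sub>\<infinity>l\<in>X. A k l (f l)))\<^sup>2) \<le> (C * l2_norm X f)\<^sup>2"
    proof (rule sum_infsum_le)
      show "(\<lambda>l. A k l (f l)) summable_on X" if "k \<in> F" for k
        using that F f by (intro row_apply_summable) auto
      show "isCont (\<lambda>x. (norm x)\<^sup>2) y" for y :: 'h by simp
      fix G assume G: "finite G" "G \<subseteq> X"
      have "(\<Sum>k\<in>F. (norm (\<Sum>l\<in>G. A k l (f l)))\<^sup>2) \<le>
          (\<Sum>k\<in>F. (\<Sum>l\<in>G. norm (A k l) * norm (f l))\<^sup>2)"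
        by (intro sum_mono power_mono sum_norm_le norm_blinfun) simp
      also have "\<dots> \<le> C\<^sup>2 * (\<Sum>l\<in>G. (norm (f l))\<^sup>2)"
        using C F G by (intro schur_test_finite) auto
      also have "\<dots> \<le> C\<^sup>2 * (l2_norm X f)\<^sup>2"
        by (intro mult_left_mono sum_le_l2_norm_sq f G) simp
      finally show "(\<Sum>k\<in>F. (norm (\<Sum>l\<in>G. A k l (f l)))\<^sup>2) \<le> (C * l2_norm X f)\<^sup>2"
        by (simp add: power_mult_distrib)
    qed
    then show ?thesis using f by (simp add: matrix_op_def)
  qed
  show "matrix_op X A f \<in> l2_space X" by (rule l2_spaceI[OF supp le])
  show "l2_norm X (matrix_op X A f) \<le> C * l2_norm X f"
    by (rule l2_norm_leI[OF supp le]) (simp_all add: C)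
qed

lemma matrix_op_single:
  assumes l: "l \<in> X" and k: "k \<in> X"
  shows "matrix_op X A (\<lambda>k. if k = l then x else 0) k = A k l x"
proof -
  have "(\<Sum>\<^sub>\<infinity>n\<in>X. A k n (if n = l then x else 0)) = (\<Sum>\<^sub>\<infinity>n\<in>{l}. A k n (if n = l then x else 0))"
    by (rule infsum_cong_neutral) (use l in auto)
  then show ?thesis using l2_space_single(1)[OF l, of x] by (simp add: matrix_op_def)
qed

text \<open>Testing on families supported at the single point \<open>l\<close>. Through this bound
  the operator norm enters the estimate of entries near the diagonal.\<close>

lemma norm_entry_le_op_bound:
  assumes q: "\<And>f. f \<in> l2_space X \<Longrightarrow> l2_norm X (matrix_op X A f) \<le> q * l2_norm X f"
    and "0 \<le> q"
  shows "norm (A k l) \<le> q"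
proof (cases "k \<in> X \<and> l \<in> X")
  case True
  show ?thesis
  proof (rule norm_blinfun_bound)
    fix x :: 'h
    let ?f = "\<lambda>k. if k = l then x else 0"
    have f: "?f \<in> l2_space X" using True by (intro l2_space_single) simp
    have "norm (A k l x) = norm (matrix_op X A ?f k)"
      using True matrix_op_single[of l k x] by simp
    also have "\<dots> \<le> l2_norm X (matrix_op X A ?f)" by (intro norm_le_l2_norm matrix_op_in_l2 f)
    also have "\<dots> \<le> q * norm x" using q[OF f] l2_space_single(2)[of l X x] True by simp
    finally show "norm (A k l x) \<le> q * norm x" .
  qed (rule \<open>0 \<le> q\<close>)
next
  case False
  then show ?thesis using op_matricesD[OF A] \<open>0 \<le> q\<close> by force
qed

lemma matrix_op_add:
  assumes f: "f \<in> l2_space X" and g: "g \<in> l2_space X"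
  shows "matrix_op X A (\<lambda>k. f k + g k) = (\<lambda>k. matrix_op X A f k + matrix_op X A g k)"
proof
  fix k
  show "matrix_op X A (\<lambda>k. f k + g k) k = matrix_op X A f k + matrix_op X A g k"
  proof (cases "k \<in> X")
    case True
    then show ?thesis using f g l2_space_add[OF f g]
      by (simp add: matrix_op_def blinfun.add_right infsum_add row_apply_summable)
  next
    case False
    then show ?thesis using f g l2_space_add[OF f g]
      by (simp add: matrix_op_def op_matricesD[OF A])
  qed
qed

lemma matrix_op_scaleC:
  assumes f: "f \<in> l2_space X"
  shows "matrix_op X A (\<lambda>k. c *\<^sub>C f k) = (\<lambda>k. c *\<^sub>C matrix_op X A f k)"
proof
  fix k
  show "matrix_op X A (\<lambda>k. c *\<^sub>C f k) k = c *\<^sub>C matrix_op X A f k"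
  proof (cases "k \<in> X")
    case True
    have "A k l (c *\<^sub>C f l) = c *\<^sub>C A k l (f l)" for l
      using op_matricesD(1)[OF A] by (simp add: bounded_clinear_ops_def)
    moreover have "(\<Sum>\<^sub>\<infinity>l\<in>X. c *\<^sub>C A k l (f l)) = c *\<^sub>C (\<Sum>\<^sub>\<infinity>l\<in>X. A k l (f l))"
      by (rule infsum_bounded_linear[OF bounded_linear_scaleC row_apply_summable[OF f True]])
    ultimately show ?thesis using f l2_space_scaleC[OF f] by (simp add: matrix_op_def)
  next
    case False
    then show ?thesis using f l2_space_scaleC[OF f]
      by (simp add: matrix_op_def op_matricesD[OF A])
  qed
qed

lemma mat_adj_closed: "mat_adj A \<in> op_matrices X"
  by (rule op_matricesI) (auto simp: mat_adj_def op_matricesD[OF A] adj_blinfun_closed)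

lemma norm_mat_adj: "norm (mat_adj A k l) = norm (A l k)"
  by (simp add: mat_adj_def norm_adj_blinfun op_matricesD[OF A])

lemma schur_bounded_mat_adj: "schur_bounded X (mat_adj A) C"
  unfolding norm_mat_adj using C(1) by (rule row_col_le_transpose)

end

text \<open>Entrywise adjoints turn one iterated series into the other; the content is the absolute
  convergence that allows the exchange.\<close>

lemma matrix_op_adj:
  fixes X :: "(real ^ 'd) set" and A :: "('d, 'h::chilbert_space) op_matrix"
  assumes A: "A \<in> op_matrices X" and C: "schur_bounded X A C" "0 \<le> C"
    and f: "f \<in> l2_space X" and g: "g \<in> l2_space X"
  shows "l2_inner X (matrix_op X A f) g = l2_inner X f (matrix_op X (mat_adj A) g)"
proof -
  note adj = mat_adj_closed[OF A C] schur_bounded_mat_adj[OF A C] C(2)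
  have 1: "cinner (matrix_op X A f k) (g k) = (\<Sum>\<^sub>\<infinity>l\<in>X. cinner (A k l (f l)) (g k))" if "k \<in> X" for k
    using infsum_bounded_linear[OF bounded_bilinear.bounded_linear_left[OF bounded_bilinear_cinner]
        row_apply_summable[OF A C f that], of "g k"] f
    by (simp add: matrix_op_def)
  have 2: "cinner (f l) (matrix_op X (mat_adj A) g l) = (\<Sum>\<^sub>\<infinity>k\<in>X. cinner (A k l (f l)) (g k))"
    if "l \<in> X" for l
    using infsum_bounded_linear[OF bounded_bilinear.bounded_linear_right[OF bounded_bilinear_cinner]
        row_apply_summable[OF adj g that], of "f l"] g
    by (simp add: matrix_op_def mat_adj_def cinner_adj_right[OF op_matricesD(1)[OF A]])
  have "(\<Sum>\<^sub>\<infinity>k\<in>X. \<Sum>\<^sub>\<infinity>l\<in>X. cinner (A k l (f l)) (g k)) =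
      (\<Sum>\<^sub>\<infinity>l\<in>X. \<Sum>\<^sub>\<infinity>k\<in>X. cinner (A k l (f l)) (g k))"
  proof (rule infsum_swap_abs)
    fix F G assume F: "finite F" "F \<subseteq> X" and G: "finite G" "G \<subseteq> X"
    let ?a = "\<lambda>k l. norm (A k l)"
    have "(\<Sum>k\<in>F. \<Sum>l\<in>G. cmod (cinner (A k l (f l)) (g k))) \<le>
        (\<Sum>k\<in>F. \<Sum>l\<in>G. ?a k l * (norm (f l))\<^sup>2 + ?a k l * (norm (g k))\<^sup>2)"
    proof (intro sum_mono)
      fix k l
      have "cmod (cinner (A k l (f l)) (g k)) \<le> norm (A k l (f l)) * norm (g k)"
        by (rule cinner_cauchy_schwarz)
      also have "\<dots> \<le> ?a k l * norm (f l) * norm (g k)"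
        by (intro mult_right_mono norm_blinfun) simp
      \<comment> \<open>Bounding the product of the two norms by the sum of their squares separates
        \<open>f\<close> from \<open>g\<close>: column sums then take care of the first term and row
        sums of the second.\<close>
      also have "\<dots> \<le> ?a k l * ((norm (f l))\<^sup>2 + (norm (g k))\<^sup>2)"
        unfolding mult.assoc using sum_squares_bound[of "norm (f l)" "norm (g k)"]
        by (intro mult_left_mono) (auto intro: order_trans[rotated])
      finally show "cmod (cinner (A k l (f l)) (g k)) \<le>
          ?a k l * (norm (f l))\<^sup>2 + ?a k l * (norm (g k))\<^sup>2" by (simp add: distrib_left)
    qed
    also have "\<dots> = (\<Sum>l\<in>G. (\<Sum>k\<in>F. ?a k l) * (norm (f l))\<^sup>2) + (\<Sum>k\<in>F. (\<Sum>l\<in>G. ?a k l) * (norm (g k))\<^sup>2)"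
      by (simp add: sum.distrib sum_distrib_right sum.swap[of _ F G])
    also have "\<dots> \<le> (\<Sum>l\<in>G. C * (norm (f l))\<^sup>2) + (\<Sum>k\<in>F. C * (norm (g k))\<^sup>2)"
      using F G row_col_leD[OF C(1)] by (intro add_mono sum_mono mult_right_mono) auto
    also have "\<dots> \<le> C * (l2_norm X f)\<^sup>2 + C * (l2_norm X g)\<^sup>2"
      unfolding sum_distrib_left[symmetric]
      using F G f g C(2) by (intro add_mono mult_left_mono sum_le_l2_norm_sq)
    finally show "(\<Sum>k\<in>F. \<Sum>l\<in>G. cmod (cinner (A k l (f l)) (g k))) \<le>
        C * (l2_norm X f)\<^sup>2 + C * (l2_norm X g)\<^sup>2" .
  qed
  then show ?thesis
    unfolding l2_inner_def by (simp add: 1 2 cong: infsum_cong)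
qed

context
  fixes X :: "(real ^ 'd) set" and A B :: "('d, 'h::chilbert_space) op_matrix" and C D :: real
  assumes A: "A \<in> op_matrices X" and C: "schur_bounded X A C" "0 \<le> C"
    and B: "B \<in> op_matrices X" and D: "schur_bounded X B D" "0 \<le> D"
begin

lemma mat_mult_summable:
  assumes k: "k \<in> X" and l: "l \<in> X"
  shows "(\<lambda>n. A k n o\<^sub>L B n l) summable_on X"
proof (rule abs_summable_summable, rule abs_summable_onI_sum_le)
  fix F assume F: "finite F" "F \<subseteq> X"
  \<comment> \<open>The sum over a singleton brings the estimate into the shape of
    \<open>sum_mult_le_row_col\<close>.\<close>
  have "(\<Sum>n\<in>F. norm (A k n o\<^sub>L B n l)) \<le> (\<Sum>l\<in>{l}. \<Sum>n\<in>F. norm (A k n) * norm (B n l))"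
    by (auto intro!: sum_mono norm_blinfun_compose)
  also have "\<dots> \<le> C * D"
    using C D F k l by (intro sum_mult_le_row_col) auto
  finally show "(\<Sum>n\<in>F. norm (A k n o\<^sub>L B n l)) \<le> C * D" .
qed

lemma mat_mult_apply:
  assumes "k \<in> X" and "l \<in> X"
  shows "mat_mult X A B k l x = (\<Sum>\<^sub>\<infinity>n\<in>X. A k n (B n l x))"
  using infsum_bounded_linear[OF blinfun.bounded_linear_left mat_mult_summable[OF assms]]
  by (simp add: mat_mult_def)

lemma mat_mult_apply_summable:
  assumes "k \<in> X" and "l \<in> X"
  shows "(\<lambda>n. A k n (B n l x)) summable_on X"
  using summable_on_bounded_linear[OF blinfun.bounded_linear_left mat_mult_summable[OF assms], of x]
  by simp

lemma mat_mult_closed: "mat_mult X A B \<in> op_matrices X"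
proof (rule op_matricesI)
  fix k l assume kl: "k \<in> X" "l \<in> X"
  have "mat_mult X A B k l (c *\<^sub>C x) = c *\<^sub>C mat_mult X A B k l x" for c x
  proof -
    have "mat_mult X A B k l (c *\<^sub>C x) = (\<Sum>\<^sub>\<infinity>n\<in>X. c *\<^sub>C A k n (B n l x))"
      using op_matricesD(1)[OF A] op_matricesD(1)[OF B]
      by (simp add: mat_mult_apply[OF kl] bounded_clinear_ops_def)
    also have "\<dots> = c *\<^sub>C (\<Sum>\<^sub>\<infinity>n\<in>X. A k n (B n l x))"
      by (rule infsum_bounded_linear[OF bounded_linear_scaleC mat_mult_apply_summable[OF kl]])
    finally show ?thesis by (simp add: mat_mult_apply[OF kl])
  qed
  then show "mat_mult X A B k l \<in> bounded_clinear_ops" by (simp add: bounded_clinear_ops_def)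
next
  fix k l assume "k \<notin> X \<or> l \<notin> X"
  then have "A k n o\<^sub>L B n l = 0" for n
    using op_matricesD(2)[OF A, of k n] op_matricesD(2)[OF B, of n l] by auto
  then show "mat_mult X A B k l = 0" by (simp add: mat_mult_def)
qed

text \<open>The double series converges absolutely because \<open>f\<close> is bounded by its norm
  and the product of the two matrices has bounded row sums of entry norms.\<close>

lemma matrix_op_mult:
  assumes f: "f \<in> l2_space X"
  shows "matrix_op X (mat_mult X A B) f = matrix_op X A (matrix_op X B f)"
proof
  fix k
  note Bf = matrix_op_in_l2[OF B D f]
  show "matrix_op X (mat_mult X A B) f k = matrix_op X A (matrix_op X B f) k"
  proof (cases "k \<in> X")
    case k: True
    have "matrix_op X (mat_mult X A B) f k = (\<Sum>\<^sub>\<infinity>l\<in>X. \<Sum>\<^sub>\<infinity>n\<in>X. A k n (B n l (f l)))"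
      using f k by (simp add: matrix_op_def mat_mult_apply cong: infsum_cong)
    also have "\<dots> = (\<Sum>\<^sub>\<infinity>n\<in>X. \<Sum>\<^sub>\<infinity>l\<in>X. A k n (B n l (f l)))"
    proof (rule infsum_swap_abs)
      fix G F assume G: "finite G" "G \<subseteq> X" and F: "finite F" "F \<subseteq> X"
      have "(\<Sum>l\<in>G. \<Sum>n\<in>F. norm (A k n (B n l (f l)))) \<le>
          (\<Sum>l\<in>G. \<Sum>n\<in>F. (norm (A k n) * norm (B n l)) * l2_norm X f)"
        unfolding mult.assoc
        by (intro sum_mono order_trans[OF norm_blinfun] mult_left_mono norm_le_l2_norm[OF f]) auto
      also have "\<dots> = (\<Sum>l\<in>G. \<Sum>n\<in>F. norm (A k n) * norm (B n l)) * l2_norm X f"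
        by (simp add: sum_distrib_right)
      also have "\<dots> \<le> (C * D) * l2_norm X f"
        using C D F G k by (intro mult_right_mono sum_mult_le_row_col) auto
      finally show "(\<Sum>l\<in>G. \<Sum>n\<in>F. norm (A k n (B n l (f l)))) \<le> (C * D) * l2_norm X f" .
    qed
    also have "\<dots> = (\<Sum>\<^sub>\<infinity>n\<in>X. A k n (\<Sum>\<^sub>\<infinity>l\<in>X. B n l (f l)))"
      by (intro infsum_cong infsum_bounded_linear[OF blinfun.bounded_linear_right]
          row_apply_summable[OF B D f])
    also have "\<dots> = matrix_op X A (matrix_op X B f) k"
      using f Bf by (simp add: matrix_op_def)
    finally show ?thesis .
  next
    case False
    then show ?thesis
      using f Bf by (simp add: matrix_op_def op_matricesD[OF A] op_matricesD[OF mat_mult_closed])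
  qed
qed

end

lemma mat_adj_mult:
  fixes X :: "(real ^ 'd) set" and A B :: "('d, 'h::chilbert_space) op_matrix"
  assumes A: "A \<in> op_matrices X" "schur_bounded X A C" "0 \<le> C"
    and B: "B \<in> op_matrices X" "schur_bounded X B D" "0 \<le> D"
  shows "mat_adj (mat_mult X A B) = mat_mult X (mat_adj B) (mat_adj A)"
proof (intro ext)
  fix k l
  show "mat_adj (mat_mult X A B) k l = mat_mult X (mat_adj B) (mat_adj A) k l"
  proof (cases "k \<in> X \<and> l \<in> X")
    case True
    then have k: "k \<in> X" and l: "l \<in> X" by auto
    have sm: "(\<lambda>n. adj_blinfun (B n k) o\<^sub>L adj_blinfun (A l n)) summable_on X"
      using mat_mult_summable[OF mat_adj_closed[OF B] schur_bounded_mat_adj[OF B] B(3)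
          mat_adj_closed[OF A] schur_bounded_mat_adj[OF A] A(3) k l]
      by (simp add: mat_adj_def)
    \<comment> \<open>The candidate series is checked against the defining identity of the adjoint;
      both evaluation at a vector and the inner product pass through it termwise.\<close>
    have "adj_blinfun (mat_mult X A B l k) = (\<Sum>\<^sub>\<infinity>n\<in>X. adj_blinfun (B n k) o\<^sub>L adj_blinfun (A l n))"
    proof (rule adj_blinfun_unique)
      fix x y
      have "cinner (mat_mult X A B l k x) y = (\<Sum>\<^sub>\<infinity>n\<in>X. cinner (A l n (B n k x)) y)"
        using infsum_bounded_linear[OF bounded_bilinear.bounded_linear_left[OF bounded_bilinear_cinner]
            mat_mult_apply_summable[OF A B l k], of x y]
        by (simp add: mat_mult_apply[OF A B l k])
      also have "\<dots> = (\<Sum>\<^sub>\<infinity>n\<in>X. cinner x ((adj_blinfun (B n k) o\<^sub>L adj_blinfun (A l n)) y))"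
        by (simp add: cinner_adj_right op_matricesD[OF A(1)] op_matricesD[OF B(1)])
      also have "\<dots> = cinner x (\<Sum>\<^sub>\<infinity>n\<in>X. (adj_blinfun (B n k) o\<^sub>L adj_blinfun (A l n)) y)"
        by (rule infsum_bounded_linear[OF bounded_bilinear.bounded_linear_right[OF bounded_bilinear_cinner]
              summable_on_bounded_linear[OF blinfun.bounded_linear_left sm]])
      also have "(\<Sum>\<^sub>\<infinity>n\<in>X. (adj_blinfun (B n k) o\<^sub>L adj_blinfun (A l n)) y) =
          (\<Sum>\<^sub>\<infinity>n\<in>X. adj_blinfun (B n k) o\<^sub>L adj_blinfun (A l n)) y"
        by (rule infsum_bounded_linear[OF blinfun.bounded_linear_left sm])
      finally show "cinner (mat_mult X A B l k x) y =
          cinner x ((\<Sum>\<^sub>\<infinity>n\<in>X. adj_blinfun (B n k) o\<^sub>L adj_blinfun (A l n)) y)" .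
    qed
    then show ?thesis by (simp add: mat_adj_def mat_mult_def)
  next
    case False
    then have "adj_blinfun (B n k) o\<^sub>L adj_blinfun (A l n) = 0" for n
      using op_matricesD(2)[OF B(1), of n k] op_matricesD(2)[OF A(1), of l n] by auto
    moreover have "mat_mult X A B l k = 0"
      using False op_matricesD[OF mat_mult_closed[OF A B]] by auto
    ultimately show ?thesis by (simp add: mat_adj_def mat_mult_def)
  qed
qed

text \<open>Families supported at one point recover the entries. This lets matrix identities be
  verified as identities between operators.\<close>

lemma matrix_op_inject:
  fixes X :: "(real ^ 'd) set" and A B :: "('d, 'h::chilbert_space) op_matrix"
  assumes A: "A \<in> op_matrices X" "schur_bounded X A C" "0 \<le> C"
    and B: "B \<in> op_matrices X" "schur_bounded X B D" "0 \<le> D"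
    and eq: "\<And>f. f \<in> l2_space X \<Longrightarrow> matrix_op X A f = matrix_op X B f"
  shows "A = B"
proof (intro ext)
  fix k l
  show "A k l = B k l"
  proof (cases "k \<in> X \<and> l \<in> X")
    case True
    then show ?thesis
      using eq[OF l2_space_single(1), of l] matrix_op_single[OF A, of l k]
        matrix_op_single[OF B, of l k]
      by (intro blinfun_eqI) metis
  next
    case False
    then show ?thesis using op_matricesD[OF A(1)] op_matricesD[OF B(1)] by metis
  qed
qed

section \<open>The algebra \<open>\<B>\<^bsub>u,s\<^esub>\<close> is a Banach algebra with isometric involution\<close>

lemma infsum_ennreal_le_iff:
  fixes a :: "'i \<Rightarrow> real"
  assumes "\<And>x. 0 \<le> a x" and "0 \<le> C"
  shows "(\<Sum>\<^sub>\<infinity>x\<in>X. ennreal (a x)) \<le> ennreal C \<longleftrightarrow>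
    (\<forall>F. finite F \<longrightarrow> F \<subseteq> X \<longrightarrow> sum a F \<le> C)"
  by (subst nonneg_infsum_complete) (auto simp: SUP_le_iff sum_ennreal assms)

lemma schur_norm_le_iff:
  fixes A :: "('d::finite, 'h::chilbert_space) op_matrix"
  assumes "\<And>x. 0 \<le> w x" and "0 \<le> C"
  shows "schur_norm X w A \<le> ennreal C \<longleftrightarrow> row_col_le X (\<lambda>k l. norm (A k l) * w (k - l)) C"
  unfolding schur_norm_def row_col_le_def max.bounded_iff SUP_le_iff
  by (subst (1 2) infsum_ennreal_le_iff) (use assms in auto)

lemma jaffard_norm_le_iff:
  fixes A :: "('d::finite, 'h::chilbert_space) op_matrix"
  assumes "0 \<le> D"
  shows "jaffard_norm X v A \<le> ennreal D \<longleftrightarrow> (\<forall>k\<in>X. \<forall>l\<in>X. norm (A k l) * v (k - l) \<le> D)"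
  unfolding jaffard_norm_def by (simp add: SUP_le_iff assms)

lemma poly_weight_ge_1: "0 \<le> s \<Longrightarrow> 1 \<le> poly_weight s x"
  by (simp add: poly_weight_def ge_one_powr_ge_zero)

lemma poly_weight_minus: "poly_weight s (- x) = poly_weight s x"
  by (simp add: poly_weight_def)

text \<open>Of the two quantities 1 + |x| and 1 + |y| the larger, doubled, dominates 1 + |x + y|.
  This is where the factor \<open>2 powr s\<close> in the norm of the algebra originates.\<close>

lemma poly_weight_add:
  assumes "0 \<le> s"
  shows "poly_weight s (x + y) \<le> 2 powr s * (poly_weight s x + poly_weight s y)"
proof -
  let ?m = "max (1 + norm x) (1 + norm y)"
  have "poly_weight s (x + y) \<le> (2 * ?m) powr s"
    unfolding poly_weight_def
    using norm_triangle_ineq[of x y] assms by (intro powr_mono2) (auto simp: max_def)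
  also have "\<dots> = 2 powr s * ?m powr s" by (rule powr_mult)
  also have "?m powr s \<le> poly_weight s x + poly_weight s y"
    by (auto simp: poly_weight_def max_def)
  finally show ?thesis by simp
qed

definition mat_one :: "'i set \<Rightarrow> 'i \<Rightarrow> 'i \<Rightarrow> ('h::chilbert_space \<Rightarrow>\<^sub>L 'h)" where
  "mat_one X = (\<lambda>k l. if k = l \<and> k \<in> X then id_blinfun else 0)"

lemma Bus_algebra_simps [simp]:
  fixes X :: "(real ^ 'd) set"
  shows
  "mult (Bus_algebra X w s) = mat_mult X"
  "one (Bus_algebra X w s) = mat_one X"
  "zero (Bus_algebra X w s) = (\<lambda>k l. 0)"
  "add (Bus_algebra X w s) = (\<lambda>A B k l. A k l + B k l)"
  "cscale (Bus_algebra X w s) = (\<lambda>c A k l. scaleC_blinfun c (A k l))"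
  "invol (Bus_algebra X w s) = mat_adj"
  by (simp_all add: Bus_algebra_def Let_def mat_mult_def mat_one_def mat_adj_def fun_eq_iff)

text \<open>The properties of a weight on which the Banach algebra structure rests. The locale is
  instantiated both by \<open>u\<close> and by the shifted weights, over the same
  \<open>X\<close>.\<close>

locale bus_weight =
  fixes w :: "real ^ 'd \<Rightarrow> real" and X :: "(real ^ 'd) set" and s :: real
  assumes w_ge_1: "1 \<le> w x" and w_zero: "w 0 = 1" and w_minus: "w (- x) = w x"
    and w_add: "w (x + y) \<le> w x * w y" and s_nonneg: "0 \<le> s"
begin

abbreviation Bus :: "('d, 'h::chilbert_space) op_matrix star_calgebra" where
  "Bus \<equiv> Bus_algebra X w s"

abbreviation v :: "real ^ 'd \<Rightarrow> real" where "v x \<equiv> w x * poly_weight s x"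

text \<open>Real versions of the extended norms. They are faithful on the carrier, where the
  extended values are finite; an infinite value would be sent to 0.\<close>

definition snorm :: "('d, 'h::chilbert_space) op_matrix \<Rightarrow> real" where
  "snorm A = enn2real (schur_norm X w A)"

definition jnorm :: "('d, 'h::chilbert_space) op_matrix \<Rightarrow> real" where
  "jnorm A = enn2real (jaffard_norm X v A)"

lemma w_nonneg [simp]: "0 \<le> w x"
  using w_ge_1[of x] by simp

lemma v_ge_1: "1 \<le> v x"
  using mult_mono[OF w_ge_1 poly_weight_ge_1[OF s_nonneg], of x x] by simp

lemma snorm_nonneg [simp]: "0 \<le> snorm A" and jnorm_nonneg [simp]: "0 \<le> jnorm A"
  by (simp_all add: snorm_def jnorm_def)

lemma anorm_eq: "anorm Bus A = 2 powr s * snorm A + jnorm A"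
  by (simp add: Bus_algebra_def Let_def snorm_def jnorm_def)

context
  fixes A :: "('d, 'h::chilbert_space) op_matrix"
  assumes "A \<in> carrier Bus"
begin

lemma Bus_op_matrices: "A \<in> op_matrices X"
  and Bus_finite: "schur_norm X w A < \<infinity>" "jaffard_norm X v A < \<infinity>"
  using \<open>A \<in> _\<close> by (simp_all add: Bus_algebra_def Let_def)

lemma Bus_row_col_le: "row_col_le X (\<lambda>k l. norm (A k l) * w (k - l)) (snorm A)"
  using Bus_finite(1)
  by (subst schur_norm_le_iff[symmetric]) (simp_all add: snorm_def)

lemma Bus_jaffard_le: "k \<in> X \<Longrightarrow> l \<in> X \<Longrightarrow> norm (A k l) * v (k - l) \<le> jnorm A"
  using Bus_finite(2) jaffard_norm_le_iff[of "jnorm A" X v A]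
  by (simp add: jnorm_def)

lemma Bus_schur_bounded: "schur_bounded X A (snorm A)"
proof (rule row_col_le_mono[OF Bus_row_col_le])
  show "norm (A k l) \<le> norm (A k l) * w (k - l)" for k l
    using mult_left_mono[OF w_ge_1, of "norm (A k l)"] by simp
qed simp

lemmas Bus_D = Bus_op_matrices Bus_schur_bounded snorm_nonneg

text \<open>Makes Cauchy sequences Cauchy in every entry, and gives definiteness of the
  norm.\<close>

lemma norm_entry_le_anorm: "norm (A k l) \<le> anorm Bus A"
proof (cases "k \<in> X \<and> l \<in> X")
  case True
  have "norm (A k l) \<le> norm (A k l) * v (k - l)"
    using mult_left_mono[OF v_ge_1, of "norm (A k l)"] by simp
  also have "\<dots> \<le> jnorm A" using True Bus_jaffard_le by simp
  finally show ?thesis by (simp add: anorm_eq add_increasing)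
next
  case False
  then show ?thesis using op_matricesD(2)[OF Bus_op_matrices, of k l] by (simp add: anorm_eq)
qed

end

lemma
  assumes A: "A \<in> op_matrices X"
    and C: "row_col_le X (\<lambda>k l. norm (A k l) * w (k - l)) C" "0 \<le> C"
    and D: "\<And>k l. k \<in> X \<Longrightarrow> l \<in> X \<Longrightarrow> norm (A k l) * v (k - l) \<le> D" "0 \<le> D"
  shows Bus_carrierI: "A \<in> carrier Bus"
    and anorm_le: "anorm Bus A \<le> 2 powr s * C + D"
proof -
  have S: "schur_norm X w A \<le> ennreal C" using C by (simp add: schur_norm_le_iff)
  have J: "jaffard_norm X v A \<le> ennreal D" using D by (simp add: jaffard_norm_le_iff)
  show "A \<in> carrier Bus"
    using A le_less_trans[OF S ennreal_less_top] le_less_trans[OF J ennreal_less_top]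
    by (simp add: Bus_algebra_def Let_def)
  have sn: "snorm A \<le> C"
    using enn2real_mono[OF S ennreal_less_top] C by (simp add: snorm_def)
  have jn: "jnorm A \<le> D"
    using enn2real_mono[OF J ennreal_less_top] D by (simp add: jnorm_def)
  show "anorm Bus A \<le> 2 powr s * C + D"
    unfolding anorm_eq using sn jn by (intro add_mono mult_left_mono) auto
qed

lemma zero_closed: "(\<lambda>k l. 0) \<in> carrier Bus"
  by (rule Bus_carrierI[where C = 0 and D = 0])
    (auto simp: row_col_le_def op_matrices_def bounded_clinear_ops_closed)

lemma one_closed: "(mat_one X :: ('d, 'h::chilbert_space) op_matrix) \<in> carrier Bus"
proof (rule Bus_carrierI[where C = 1 and D = 1])
  have n: "norm (id_blinfun :: 'h \<Rightarrow>\<^sub>L 'h) \<le> 1"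
    by (rule norm_blinfun_bound) auto
  have p0: "poly_weight s (0 :: real ^ 'd) = 1" by (simp add: poly_weight_def)
  have le: "norm (mat_one X k l :: 'h \<Rightarrow>\<^sub>L 'h) * w (k - l) \<le> (if k = l then 1 else 0)" for k l
    using n by (simp add: mat_one_def w_zero)
  have "(\<Sum>l\<in>F. if k = l then 1 else 0 :: real) \<le> 1" if "finite F" for k and F :: "(real ^ 'd) set"
    using that by simp
  moreover have "(\<Sum>l\<in>F. if l = k then 1 else 0 :: real) \<le> 1" if "finite F" for k and F :: "(real ^ 'd) set"
    using that by simp
  ultimately have "row_col_le X (\<lambda>k l. if k = l then 1 else 0) 1"
    by (auto simp: row_col_le_def)
  then show "row_col_le X (\<lambda>k l. norm (mat_one X k l :: 'h \<Rightarrow>\<^sub>L 'h) * w (k - l)) 1"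
    by (rule row_col_le_mono) (use le in auto)
  show "norm (mat_one X k l :: 'h \<Rightarrow>\<^sub>L 'h) * v (k - l) \<le> 1" for k l
    using n by (simp add: mat_one_def w_zero p0)
qed (auto simp: op_matrices_def mat_one_def bounded_clinear_ops_closed)

lemma
  assumes A: "A \<in> carrier Bus" and B: "B \<in> carrier Bus"
  shows add_closed: "(\<lambda>k l. A k l + B k l) \<in> carrier Bus"
    and anorm_add: "anorm Bus (\<lambda>k l. A k l + B k l) \<le> anorm Bus A + anorm Bus B"
proof -
  have le: "norm (A k l + B k l) * c \<le> norm (A k l) * c + norm (B k l) * c" if "0 \<le> c" for k l c
    using mult_right_mono[OF norm_triangle_ineq that, of "A k l" "B k l"] by (simp add: distrib_right)
  have S: "row_col_le X (\<lambda>k l. norm (A k l + B k l) * w (k - l)) (snorm A + snorm B)"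
    by (rule row_col_le_mono[OF row_col_le_add[OF Bus_row_col_le[OF A] Bus_row_col_le[OF B]]])
      (use le in auto)
  have J: "norm (A k l + B k l) * v (k - l) \<le> jnorm A + jnorm B" if "k \<in> X" "l \<in> X" for k l
    using Bus_jaffard_le[OF A that] Bus_jaffard_le[OF B that] le[of "v (k - l)" k l]
      order_trans[OF zero_le_one v_ge_1] by fastforce
  have op: "(\<lambda>k l. A k l + B k l) \<in> op_matrices X"
    using op_matricesD[OF Bus_op_matrices[OF A]] op_matricesD[OF Bus_op_matrices[OF B]]
    by (auto simp: op_matrices_def bounded_clinear_ops_closed)
  show "(\<lambda>k l. A k l + B k l) \<in> carrier Bus"
    by (rule Bus_carrierI[OF op S _ J]) auto
  show "anorm Bus (\<lambda>k l. A k l + B k l) \<le> anorm Bus A + anorm Bus B"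
    using anorm_le[OF op S _ J] by (simp add: anorm_eq distrib_left)
qed

lemma
  assumes A: "A \<in> carrier Bus"
  shows cscale_closed: "(\<lambda>k l. scaleC_blinfun c (A k l)) \<in> carrier Bus"
    and anorm_cscale_le: "anorm Bus (\<lambda>k l. scaleC_blinfun c (A k l)) \<le> cmod c * anorm Bus A"
proof -
  have S: "row_col_le X (\<lambda>k l. norm (scaleC_blinfun c (A k l)) * w (k - l)) (cmod c * snorm A)"
    using Bus_row_col_le[OF A]
    by (auto simp: row_col_le_def norm_scaleC_blinfun mult.assoc sum_distrib_left[symmetric]
        intro!: mult_left_mono)
  have J: "norm (scaleC_blinfun c (A k l)) * v (k - l) \<le> cmod c * jnorm A" if "k \<in> X" "l \<in> X" for k l
    using mult_left_mono[OF Bus_jaffard_le[OF A that], of "cmod c"]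
    by (simp add: norm_scaleC_blinfun mult.assoc)
  have 0: "scaleC_blinfun c 0 = (0 :: 'a \<Rightarrow>\<^sub>L 'a)"
    by (rule blinfun_eqI) (simp add: scaleC_blinfun.rep_eq)
  have op: "(\<lambda>k l. scaleC_blinfun c (A k l)) \<in> op_matrices X"
    using op_matricesD[OF Bus_op_matrices[OF A]]
    by (auto simp: op_matrices_def bounded_clinear_ops_closed 0)
  show "(\<lambda>k l. scaleC_blinfun c (A k l)) \<in> carrier Bus"
    by (rule Bus_carrierI[OF op S _ J]) auto
  show "anorm Bus (\<lambda>k l. scaleC_blinfun c (A k l)) \<le> cmod c * anorm Bus A"
    using anorm_le[OF op S _ J] by (simp add: anorm_eq algebra_simps)
qed

lemma
  assumes A: "A \<in> carrier Bus"
  shows mat_adj_in_Bus: "mat_adj A \<in> carrier Bus"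
    and anorm_mat_adj_le: "anorm Bus (mat_adj A) \<le> anorm Bus A"
proof -
  have sym: "w (k - l) = w (l - k)" "poly_weight s (k - l) = poly_weight s (l - k)" for k l
    using w_minus[of "k - l"] poly_weight_minus[of s "k - l"] by simp_all
  have n: "norm (mat_adj A k l) = norm (A l k)" for k l
    by (rule norm_mat_adj[OF Bus_D[OF A]])
  have S: "row_col_le X (\<lambda>k l. norm (mat_adj A k l) * w (k - l)) (snorm A)"
    unfolding n using row_col_le_transpose[OF Bus_row_col_le[OF A]] by (simp add: sym)
  have J: "norm (mat_adj A k l) * v (k - l) \<le> jnorm A" if "k \<in> X" "l \<in> X" for k l
    unfolding n using Bus_jaffard_le[OF A that(2,1)] by (simp add: sym)
  have op: "mat_adj A \<in> op_matrices X" by (rule mat_adj_closed[OF Bus_D[OF A]])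
  show "mat_adj A \<in> carrier Bus"
    by (rule Bus_carrierI[OF op S _ J]) auto
  show "anorm Bus (mat_adj A) \<le> anorm Bus A"
    using anorm_le[OF op S _ J] by (simp add: anorm_eq)
qed

lemma
  fixes A B :: "('d, 'h::chilbert_space) op_matrix"
  assumes A: "A \<in> carrier Bus" and B: "B \<in> carrier Bus"
  shows mat_mult_in_Bus: "mat_mult X A B \<in> carrier Bus"
    and anorm_mult_le: "anorm Bus (mat_mult X A B) \<le> anorm Bus A * anorm Bus B"
proof -
  let ?a = "\<lambda>k l. norm (A k l) * w (k - l)" and ?b = "\<lambda>k l. norm (B k l) * w (k - l)"
  note SA = Bus_row_col_le[OF A] and SB = Bus_row_col_le[OF B]
  \<comment> \<open>Stated for finite truncations of the product. Submultiplicativity distributes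
    the weight of k - l = (k - n) + (n - l) over the two factors.\<close>
  have ptw: "norm (\<Sum>n\<in>G. A k n o\<^sub>L B n l) * w (k - l) \<le> (\<Sum>n\<in>G. ?a k n * ?b n l)" for G k l
  proof -
    have "norm (\<Sum>n\<in>G. A k n o\<^sub>L B n l) * w (k - l) \<le>
        (\<Sum>n\<in>G. norm (A k n) * norm (B n l)) * w (k - l)"
      by (intro mult_right_mono sum_norm_le norm_blinfun_compose) simp
    also have "\<dots> = (\<Sum>n\<in>G. norm (A k n) * norm (B n l) * w ((k - n) + (n - l)))"
      by (simp add: sum_distrib_right)
    also have "\<dots> \<le> (\<Sum>n\<in>G. norm (A k n) * norm (B n l) * (w (k - n) * w (n - l)))"
      by (intro sum_mono mult_left_mono w_add) simp
    also have "\<dots> = (\<Sum>n\<in>G. ?a k n * ?b n l)"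
      by (simp add: mult_ac)
    finally show ?thesis .
  qed
  have sm: "(\<lambda>n. A k n o\<^sub>L B n l) summable_on X" if "k \<in> X" "l \<in> X" for k l
    by (rule mat_mult_summable[OF Bus_D[OF A] Bus_D[OF B] that])
  have S: "row_col_le X (\<lambda>k l. norm (mat_mult X A B k l) * w (k - l)) (snorm A * snorm B)"
    unfolding row_col_le_def mat_mult_def
  proof (intro conjI ballI allI impI)
    fix k F assume k: "k \<in> X" and F: "finite F" "F \<subseteq> X"
    show "(\<Sum>l\<in>F. norm (\<Sum>\<^sub>\<infinity>n\<in>X. A k n o\<^sub>L B n l) * w (k - l)) \<le> snorm A * snorm B"
    proof (rule sum_infsum_le)
      fix G assume G: "finite G" "G \<subseteq> X"
      have "(\<Sum>l\<in>F. norm (\<Sum>n\<in>G. A k n o\<^sub>L B n l) * w (k - l)) \<le> (\<Sum>l\<in>F. \<Sum>n\<in>G. ?a k n * ?b n l)"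
        by (intro sum_mono ptw)
      also have "\<dots> \<le> snorm A * snorm B"
        by (rule sum_mult_le_row_col[OF SA SB]) (use F G k in auto)
      finally show "(\<Sum>l\<in>F. norm (\<Sum>n\<in>G. A k n o\<^sub>L B n l) * w (k - l)) \<le> snorm A * snorm B" .
    qed (use sm k F in \<open>auto intro!: continuous_intros\<close>)
    show "(\<Sum>l\<in>F. norm (\<Sum>\<^sub>\<infinity>n\<in>X. A l n o\<^sub>L B n k) * w (l - k)) \<le> snorm A * snorm B"
    proof (rule sum_infsum_le)
      fix G assume G: "finite G" "G \<subseteq> X"
      \<comment> \<open>Column sums are row sums of the transposed product, in which the factors
        change places.\<close>
      have "(\<Sum>l\<in>F. norm (\<Sum>n\<in>G. A l n o\<^sub>L B n k) * w (l - k)) \<le> (\<Sum>l\<in>F. \<Sum>n\<in>G. ?b n k * ?a l n)"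
        by (intro sum_mono order_trans[OF ptw]) (simp add: mult.commute)
      also have "\<dots> \<le> snorm B * snorm A"
        by (rule sum_mult_le_row_col[OF row_col_le_transpose[OF SB] row_col_le_transpose[OF SA]])
          (use F G k in auto)
      finally show "(\<Sum>l\<in>F. norm (\<Sum>n\<in>G. A l n o\<^sub>L B n k) * w (l - k)) \<le> snorm A * snorm B"
        by (simp add: mult.commute)
    qed (use sm k F in \<open>auto intro!: continuous_intros\<close>)
  qed
  \<comment> \<open>The polynomial weight splits into a sum, so in each resulting term one factor
    carries it and is bounded in the Jaffard norm, while the other is summed in the Schur
    norm.\<close>
  have J: "norm (mat_mult X A B k l) * v (k - l) \<le>
      2 powr s * (jnorm A * snorm B + snorm A * jnorm B)" if k: "k \<in> X" and l: "l \<in> X" for k l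
  proof -
    let ?p = "poly_weight s"
    have p0: "0 \<le> ?p x" for x :: "real ^ 'd" using poly_weight_ge_1[OF s_nonneg, of x] by simp
    have "(\<Sum>l\<in>{l}. norm (\<Sum>\<^sub>\<infinity>n\<in>X. A k n o\<^sub>L B n l) * v (k - l)) \<le>
        2 powr s * (jnorm A * snorm B + snorm A * jnorm B)"
    proof (rule sum_infsum_le)
      fix G assume G: "finite G" "G \<subseteq> X"
      have "norm (\<Sum>n\<in>G. A k n o\<^sub>L B n l) * v (k - l) \<le> (\<Sum>n\<in>G. ?a k n * ?b n l) * ?p (k - l)"
        using mult_right_mono[OF ptw p0] by (simp add: mult.assoc)
      also have "\<dots> = (\<Sum>n\<in>G. ?a k n * ?b n l * ?p ((k - n) + (n - l)))"
        by (simp add: sum_distrib_right)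
      also have "\<dots> \<le> (\<Sum>n\<in>G. ?a k n * ?b n l * (2 powr s * (?p (k - n) + ?p (n - l))))"
        by (intro sum_mono mult_left_mono poly_weight_add s_nonneg) simp
      also have "\<dots> = 2 powr s * ((\<Sum>n\<in>G. norm (A k n) * v (k - n) * ?b n l) +
          (\<Sum>n\<in>G. ?a k n * (norm (B n l) * v (n - l))))"
        by (simp add: sum_distrib_left sum.distrib[symmetric] algebra_simps)
      also have "\<dots> \<le> 2 powr s * ((\<Sum>n\<in>G. jnorm A * ?b n l) + (\<Sum>n\<in>G. ?a k n * jnorm B))"
        using G k l Bus_jaffard_le[OF A] Bus_jaffard_le[OF B]
        by (intro mult_left_mono add_mono sum_mono mult_right_mono) auto
      also have "\<dots> = 2 powr s * (jnorm A * (\<Sum>n\<in>G. ?b n l) + (\<Sum>n\<in>G. ?a k n) * jnorm B)"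
        by (simp add: sum_distrib_left sum_distrib_right)
      also have "\<dots> \<le> 2 powr s * (jnorm A * snorm B + snorm A * jnorm B)"
        using row_col_leD(2)[OF SB G l] row_col_leD(1)[OF SA G k]
        by (intro mult_left_mono add_mono mult_right_mono) auto
      finally show "(\<Sum>l\<in>{l}. norm (\<Sum>n\<in>G. A k n o\<^sub>L B n l) * v (k - l)) \<le>
          2 powr s * (jnorm A * snorm B + snorm A * jnorm B)" by simp
    qed (use sm k l in \<open>auto intro!: continuous_intros\<close>)
    then show ?thesis by (simp add: mat_mult_def)
  qed
  have op: "mat_mult X A B \<in> op_matrices X" by (rule mat_mult_closed[OF Bus_D[OF A] Bus_D[OF B]])
  show "mat_mult X A B \<in> carrier Bus"
    by (rule Bus_carrierI[OF op S _ J]) auto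
  have "anorm Bus (mat_mult X A B) \<le>
      2 powr s * (snorm A * snorm B) + 2 powr s * (jnorm A * snorm B + snorm A * jnorm B)"
    using anorm_le[OF op S _ J] by simp
  \<comment> \<open>The product of the two norms consists of these mixed terms, the Schur term with
    factor \<open>2 powr s\<close> twice, and a product of Jaffard norms. Hence
    \<open>1 \<le> 2 powr s\<close> and nonnegativity are enough.\<close>
  also have "\<dots> \<le> 2 powr s * (2 powr s * (snorm A * snorm B)) +
      2 powr s * (jnorm A * snorm B + snorm A * jnorm B) + jnorm A * jnorm B"
  proof -
    have "1 * (snorm A * snorm B) \<le> 2 powr s * (snorm A * snorm B)"
      using s_nonneg by (intro mult_right_mono) (auto simp: ge_one_powr_ge_zero)
    then have "2 powr s * (snorm A * snorm B) \<le> 2 powr s * (2 powr s * (snorm A * snorm B))"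
      by (intro mult_left_mono) auto
    moreover have "0 \<le> jnorm A * jnorm B" by simp
    ultimately show ?thesis by linarith
  qed
  also have "\<dots> = anorm Bus A * anorm Bus B"
    by (simp add: anorm_eq algebra_simps)
  finally show "anorm Bus (mat_mult X A B) \<le> anorm Bus A * anorm Bus B" .
qed

end

section \<open>Algebra axioms and completeness\<close>

context bus_weight
begin

lemma bus_abelian_group: "abelian_group (Bus :: ('d, 'h::chilbert_space) op_matrix star_calgebra)"
proof (rule abelian_groupI)
  fix A :: "('d, 'h) op_matrix"
  assume A: "A \<in> carrier Bus"
  show "\<exists>B\<in>carrier Bus. B \<oplus>\<^bsub>Bus\<^esub> A = \<zero>\<^bsub>Bus\<^esub>"
  proof (rule bexI[OF _ cscale_closed[OF A, of "-1"]])
    show "(\<lambda>k l. scaleC_blinfun (- 1) (A k l)) \<oplus>\<^bsub>Bus\<^esub> A = \<zero>\<^bsub>Bus\<^esub>"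
      by (auto simp: fun_eq_iff blinfun.add_left scaleC_blinfun.rep_eq scaleC_minus_left intro!: blinfun_eqI)
  qed
qed (auto intro: add_closed zero_closed simp: fun_eq_iff)

context
  fixes A :: "('d, 'h::chilbert_space) op_matrix"
  assumes A: "A \<in> carrier Bus"
begin

lemma bus_matrix_op_in_l2: "f \<in> l2_space X \<Longrightarrow> matrix_op X A f \<in> l2_space X"
  by (rule matrix_op_in_l2[OF Bus_D[OF A]])

lemma bus_row_apply_summable: "f \<in> l2_space X \<Longrightarrow> k \<in> X \<Longrightarrow> (\<lambda>l. A k l (f l)) summable_on X"
  by (rule row_apply_summable[OF Bus_D[OF A]])

lemma bus_matrix_op_mult:
  assumes B: "B \<in> carrier Bus" and f: "f \<in> l2_space X"
  shows "matrix_op X (mat_mult X A B) f = matrix_op X A (matrix_op X B f)"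
  by (rule matrix_op_mult[OF Bus_D[OF A] Bus_D[OF B] f])

lemma bus_matrix_op_plus:
  assumes B: "B \<in> carrier Bus" and f: "f \<in> l2_space X"
  shows "matrix_op X (\<lambda>k l. A k l + B k l) f = (\<lambda>k. matrix_op X A f k + matrix_op X B f k)"
proof
  fix k
  show "matrix_op X (\<lambda>k l. A k l + B k l) f k = matrix_op X A f k + matrix_op X B f k"
  proof (cases "k \<in> X")
    case True
    then show ?thesis
      using f row_apply_summable[OF Bus_D[OF A] f] row_apply_summable[OF Bus_D[OF B] f]
      by (simp add: matrix_op_def blinfun.add_left infsum_add)
  next
    case False
    then show ?thesis
      using f op_matricesD(2)[OF Bus_op_matrices[OF A]] op_matricesD(2)[OF Bus_op_matrices[OF B]]
      by (simp add: matrix_op_def)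
  qed
qed

lemma bus_matrix_op_cscale:
  assumes f: "f \<in> l2_space X"
  shows "matrix_op X (\<lambda>k l. scaleC_blinfun c (A k l)) f = (\<lambda>k. c *\<^sub>C matrix_op X A f k)"
proof
  fix k
  show "matrix_op X (\<lambda>k l. scaleC_blinfun c (A k l)) f k = c *\<^sub>C matrix_op X A f k"
  proof (cases "k \<in> X")
    case True
    then show ?thesis
      using f infsum_bounded_linear[OF bounded_linear_scaleC bus_row_apply_summable[OF f True], of c]
      by (simp add: matrix_op_def scaleC_blinfun.rep_eq)
  next
    case False
    then show ?thesis
      using f op_matricesD(2)[OF Bus_op_matrices[OF A]]
      by (simp add: matrix_op_def scaleC_blinfun.rep_eq)
  qed
qed

lemma bus_matrix_op_inject:
  assumes B: "B \<in> carrier Bus"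
    and "\<And>f. f \<in> l2_space X \<Longrightarrow> matrix_op X A f = matrix_op X B f"
  shows "A = B"
  by (rule matrix_op_inject[OF Bus_D[OF A] Bus_D[OF B] assms(2)])

end

lemma matrix_op_one:
  fixes f :: "real ^ 'd \<Rightarrow> 'h::chilbert_space"
  assumes f: "f \<in> l2_space X"
  shows "matrix_op X (mat_one X) f = f"
proof
  fix k
  show "matrix_op X (mat_one X) f k = f k"
  proof (cases "k \<in> X")
    case True
    have "(\<Sum>\<^sub>\<infinity>l\<in>X. (mat_one X k l :: 'h \<Rightarrow>\<^sub>L 'h) (f l)) = (\<Sum>\<^sub>\<infinity>l\<in>{k}. (mat_one X k l :: 'h \<Rightarrow>\<^sub>L 'h) (f l))"
      by (rule infsum_cong_neutral) (use True in \<open>auto simp: mat_one_def\<close>)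
    then show ?thesis using f True by (simp add: matrix_op_def mat_one_def)
  next
    case False
    then show ?thesis using f l2_spaceD(1)[OF f] by (simp add: matrix_op_def mat_one_def)
  qed
qed

text \<open>The laws of multiplication are checked after applying \<open>matrix_op\<close>, where
  products become compositions, and are brought back by injectivity. No triple series of matrix
  entries has to be rearranged.\<close>

lemma bus_ring: "ring (Bus :: ('d, 'h::chilbert_space) op_matrix star_calgebra)"
  (is "ring ?R")
proof (rule ringI)
  show "abelian_group ?R" by (rule bus_abelian_group)
  show "monoid ?R"
  proof (rule monoidI)
    fix A B C :: "('d, 'h) op_matrix"
    assume A: "A \<in> carrier ?R"
    show "\<one>\<^bsub>?R\<^esub> \<otimes>\<^bsub>?R\<^esub> A = A" "A \<otimes>\<^bsub>?R\<^esub> \<one>\<^bsub>?R\<^esub> = A"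
      using A one_closed
      by (auto simp: bus_matrix_op_mult matrix_op_one bus_matrix_op_in_l2
          intro!: bus_matrix_op_inject mat_mult_in_Bus)
    assume B: "B \<in> carrier ?R" and C: "C \<in> carrier ?R"
    show "A \<otimes>\<^bsub>?R\<^esub> B \<otimes>\<^bsub>?R\<^esub> C = A \<otimes>\<^bsub>?R\<^esub> (B \<otimes>\<^bsub>?R\<^esub> C)"
      using A B C
      by (auto simp: bus_matrix_op_mult bus_matrix_op_in_l2 mat_mult_in_Bus
          intro!: bus_matrix_op_inject mat_mult_in_Bus)
  qed (auto intro: mat_mult_in_Bus one_closed)
  fix A B C :: "('d, 'h) op_matrix"
  assume A: "A \<in> carrier ?R" and B: "B \<in> carrier ?R" and C: "C \<in> carrier ?R"
  note closed = A B C add_closed mat_mult_in_Bus bus_matrix_op_in_l2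
  show "(A \<oplus>\<^bsub>?R\<^esub> B) \<otimes>\<^bsub>?R\<^esub> C = A \<otimes>\<^bsub>?R\<^esub> C \<oplus>\<^bsub>?R\<^esub> B \<otimes>\<^bsub>?R\<^esub> C"
    by (auto simp: closed bus_matrix_op_mult bus_matrix_op_plus intro!: bus_matrix_op_inject)
  show "C \<otimes>\<^bsub>?R\<^esub> (A \<oplus>\<^bsub>?R\<^esub> B) = C \<otimes>\<^bsub>?R\<^esub> A \<oplus>\<^bsub>?R\<^esub> C \<otimes>\<^bsub>?R\<^esub> B"
    by (auto simp: closed bus_matrix_op_mult bus_matrix_op_plus matrix_op_add[OF Bus_D[OF C]]
        intro!: bus_matrix_op_inject)
qed

lemma bus_minus_eq:
  fixes A B :: "('d, 'h::chilbert_space) op_matrix"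
  assumes A: "A \<in> carrier Bus" and B: "B \<in> carrier Bus"
  shows "A \<ominus>\<^bsub>Bus\<^esub> B = (\<lambda>k l. A k l - B k l)"
proof -
  interpret ring "Bus :: ('d, 'h) op_matrix star_calgebra" by (rule bus_ring)
  have n: "(\<lambda>k l. scaleC_blinfun (-1) (B k l)) = (\<lambda>k l. - B k l)"
    by (auto simp: fun_eq_iff scaleC_blinfun.rep_eq scaleC_minus_left blinfun.minus_left intro!: blinfun_eqI)
  have "\<ominus>\<^bsub>Bus\<^esub> B = (\<lambda>k l. - B k l)"
    using cscale_closed[OF B, of "-1"] B unfolding n by (intro minus_equality) auto
  then show ?thesis by (simp add: a_minus_def)
qed

lemma bus_complete:
  fixes F :: "nat \<Rightarrow> ('d, 'h::chilbert_space) op_matrix"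
  assumes F: "\<And>n. F n \<in> carrier Bus"
    and cauchy: "\<forall>e>0. \<exists>N. \<forall>m\<ge>N. \<forall>n\<ge>N. anorm Bus (\<lambda>k l. F m k l - F n k l) < e"
  shows "\<exists>L\<in>carrier Bus.
    (\<lambda>n. anorm Bus (\<lambda>k l. F n k l - L k l)) \<longlonglongrightarrow> 0"
proof -
  let ?n = "anorm Bus :: ('d, 'h) op_matrix \<Rightarrow> real"
  interpret ring "Bus :: ('d, 'h) op_matrix star_calgebra" by (rule bus_ring)
  have diff: "(\<lambda>k l. A k l - B k l) \<in> carrier Bus"
    if "A \<in> carrier Bus" "B \<in> carrier Bus" for A B :: "('d, 'h) op_matrix"
    using minus_closed[OF that] by (simp add: bus_minus_eq that)
  have FF: "(\<lambda>k l. F m k l - F n k l) \<in> carrier Bus" for m n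
    by (rule diff[OF F F])
  have "Cauchy (\<lambda>n. F n k l)" for k l
  proof (rule metric_CauchyI)
    fix e :: real assume "e > 0"
    then obtain N where N: "\<And>m n. m \<ge> N \<Longrightarrow> n \<ge> N \<Longrightarrow> ?n (\<lambda>k l. F m k l - F n k l) < e"
      using cauchy by blast
    have "dist (F m k l) (F n k l) < e" if "m \<ge> N" "n \<ge> N" for m n
      using norm_entry_le_anorm[OF FF[of m n], of k l] N[OF that] by (simp add: dist_norm)
    then show "\<exists>N. \<forall>m\<ge>N. \<forall>n\<ge>N. dist (F m k l) (F n k l) < e" by blast
  qed
  then have "\<exists>y. (\<lambda>n. F n k l) \<longlonglongrightarrow> y" for k l
    using Cauchy_convergent_iff convergent_def by metis
  then obtain L where L: "\<And>k l. (\<lambda>n. F n k l) \<longlonglongrightarrow> L k l" by metis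
  have Lop: "L \<in> op_matrices X"
  proof (rule op_matricesI)
    show "L k l \<in> bounded_clinear_ops" for k l
      by (rule closed_sequentially[OF closed_bounded_clinear_ops _ L])
        (rule op_matricesD(1)[OF Bus_op_matrices[OF F]])
    show "L k l = 0" if "k \<notin> X \<or> l \<notin> X" for k l
      using LIMSEQ_unique[OF L[of k l]] op_matricesD(2)[OF Bus_op_matrices[OF F] that] by simp
  qed
  \<comment> \<open>The limit was taken entrywise, with no information on its norm. Letting
    \<open>m\<close> tend to infinity in the Cauchy estimate for F n - F m bounds F n - L, and at
    the same time shows that it lies in the carrier.\<close>
  have close: "\<exists>N. \<forall>n\<ge>N. (\<lambda>k l. F n k l - L k l) \<in> carrier Bus \<and>
      ?n (\<lambda>k l. F n k l - L k l) \<le> 2 * e" if "e > 0" for e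
  proof -
    obtain N where N: "\<And>m n. m \<ge> N \<Longrightarrow> n \<ge> N \<Longrightarrow> ?n (\<lambda>k l. F m k l - F n k l) < e"
      using cauchy \<open>e > 0\<close> by blast
    have "(\<lambda>k l. F n k l - L k l) \<in> carrier Bus \<and> ?n (\<lambda>k l. F n k l - L k l) \<le> 2 * e"
      if n: "n \<ge> N" for n
    proof -
      \<comment> \<open>Chosen so that the weighted Schur part contributes exactly \<open>e\<close>;
        together with the Jaffard part this gives \<open>2 * e\<close>.\<close>
      let ?e = "e / 2 powr s"
      have sj: "snorm (\<lambda>k l. F n k l - F m k l) \<le> ?e" "jnorm (\<lambda>k l. F n k l - F m k l) \<le> e" if "m \<ge> N" for m
      proof -
        have *: "2 powr s * snorm (\<lambda>k l. F n k l - F m k l) + jnorm (\<lambda>k l. F n k l - F m k l) < e"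
          using N[OF n that] by (simp add: anorm_eq)
        moreover have "0 \<le> 2 powr s * snorm (\<lambda>k l. F n k l - F m k l)" by simp
        ultimately show "jnorm (\<lambda>k l. F n k l - F m k l) \<le> e" by linarith
        have "2 powr s * snorm (\<lambda>k l. F n k l - F m k l) \<le> e"
          using * jnorm_nonneg[of "\<lambda>k l. F n k l - F m k l"] by linarith
        then show "snorm (\<lambda>k l. F n k l - F m k l) \<le> ?e"
          by (simp add: le_divide_eq mult.commute)
      qed
      have S: "row_col_le X (\<lambda>k l. norm (F n k l - L k l) * w (k - l)) ?e"
      proof (rule row_col_le_LIMSEQ)
        show "(\<lambda>m. norm (F n k l - F m k l) * w (k - l)) \<longlonglongrightarrow> norm (F n k l - L k l) * w (k - l)" for k l
          by (intro tendsto_intros L)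
        show "row_col_le X (\<lambda>k l. norm (F n k l - F m k l) * w (k - l)) ?e" if "m \<ge> N" for m
          by (rule row_col_le_mono[OF Bus_row_col_le[OF FF] _ sj(1)[OF that]]) simp
      qed
      have J: "norm (F n k l - L k l) * v (k - l) \<le> e" if kl: "k \<in> X" "l \<in> X" for k l
      proof (rule LIMSEQ_le_const2)
        show "(\<lambda>m. norm (F n k l - F m k l) * v (k - l)) \<longlonglongrightarrow> norm (F n k l - L k l) * v (k - l)"
          by (intro tendsto_intros L)
        show "\<exists>N. \<forall>m\<ge>N. norm (F n k l - F m k l) * v (k - l) \<le> e"
          using Bus_jaffard_le[OF FF kl] sj(2) order_trans by blast
      qed
      have op: "(\<lambda>k l. F n k l - L k l) \<in> op_matrices X"
      proof (rule op_matricesI)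
        fix k l
        have "L k l \<in> bounded_clinear_ops" "F n k l \<in> bounded_clinear_ops"
          using op_matricesD(1)[OF Lop] op_matricesD(1)[OF Bus_op_matrices[OF F]] by auto
        then show "F n k l - L k l \<in> bounded_clinear_ops"
          by (simp add: bounded_clinear_ops_def blinfun.diff_left scaleC_minus_right
              scaleC_add_right[of _ "F n k l _" "- L k l _", simplified])
      qed (simp add: op_matricesD(2)[OF Lop] op_matricesD(2)[OF Bus_op_matrices[OF F]])
      have "?n (\<lambda>k l. F n k l - L k l) \<le> 2 powr s * ?e + e"
        by (rule anorm_le[OF op S _ J]) (use \<open>e > 0\<close> in auto)
      moreover have "(\<lambda>k l. F n k l - L k l) \<in> carrier Bus"
        by (rule Bus_carrierI[OF op S _ J]) (use \<open>e > 0\<close> in auto)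
      ultimately show ?thesis by simp
    qed
    then show ?thesis by blast
  qed
  obtain n where n: "(\<lambda>k l. F n k l - L k l) \<in> carrier Bus"
    using close[of 1] by auto
  \<comment> \<open>\<open>L\<close> is the difference of \<open>F n\<close> and F n - L, both in
    the carrier.\<close>
  have "L \<in> carrier Bus"
    using diff[OF F[of n] n] by simp
  moreover have "(\<lambda>n. ?n (\<lambda>k l. F n k l - L k l)) \<longlonglongrightarrow> 0"
  proof (rule LIMSEQ_I)
    fix r :: real assume "r > 0"
    then obtain N where "\<forall>n\<ge>N. ?n (\<lambda>k l. F n k l - L k l) \<le> 2 * (r / 3)"
      using close[of "r / 3"] by auto
    moreover have "norm (?n A - 0) = ?n A" for A
      by (simp add: anorm_eq)
    ultimately have "\<forall>n\<ge>N. norm (?n (\<lambda>k l. F n k l - L k l) - 0) < r"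
      using \<open>r > 0\<close> by fastforce
    then show "\<exists>N. \<forall>n\<ge>N. norm (?n (\<lambda>k l. F n k l - L k l) - 0) < r" by blast
  qed
  ultimately show ?thesis by blast
qed

lemma bus_unital_banach_star_algebra:
  "unital_banach_star_algebra (Bus :: ('d, 'h::chilbert_space) op_matrix star_calgebra)"
  (is "unital_banach_star_algebra ?R")
proof -
  interpret ring ?R by (rule bus_ring)
  have sc: "scaleC_blinfun c (S + T) = scaleC_blinfun c S + scaleC_blinfun c T"
    "scaleC_blinfun (b + c) T = scaleC_blinfun b T + scaleC_blinfun c T"
    "scaleC_blinfun b (scaleC_blinfun c T) = scaleC_blinfun (b * c) T"
    "scaleC_blinfun 1 T = T" for b c and S T :: "'h \<Rightarrow>\<^sub>L 'h"
    by (auto intro!: blinfun_eqI simp: scaleC_blinfun.rep_eq blinfun.add_left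
        scaleC_add_right scaleC_add_left scaleC_scaleC)
  have anorm_cscale: "anorm ?R (c \<odot>\<^bsub>?R\<^esub> A) = cmod c * anorm ?R A" if A: "A \<in> carrier ?R" for A c
  proof (cases "c = 0")
    case True
    have "0 \<le> anorm ?R (c \<odot>\<^bsub>?R\<^esub> A)" by (simp add: anorm_eq)
    then show ?thesis using anorm_cscale_le[OF A, of c] True by simp
  next
    case False
    let ?cA = "\<lambda>k l. scaleC_blinfun c (A k l)"
    \<comment> \<open>The inequality already known, applied with the inverse scalar, gives the
      reverse estimate.\<close>
    have "(\<lambda>k l. scaleC_blinfun (inverse c) (?cA k l)) = A"
      using False by (simp add: sc)
    then have "anorm ?R A \<le> inverse (cmod c) * anorm ?R ?cA"
      using anorm_cscale_le[OF cscale_closed[OF A], of "inverse c" c]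
      unfolding norm_inverse by metis
    then have "cmod c * anorm ?R A \<le> anorm ?R ?cA"
      using False by (simp add: field_simps)
    then show ?thesis using anorm_cscale_le[OF A, of c] by simp
  qed
  have invol_invol: "mat_adj (mat_adj A) = A" if "A \<in> carrier ?R" for A :: "('d, 'h) op_matrix"
    using op_matricesD(1)[OF Bus_op_matrices[OF that]]
    by (simp add: mat_adj_def adj_adj_blinfun)
  have adj_add: "mat_adj (\<lambda>k l. A k l + B k l) = (\<lambda>k l. mat_adj A k l + mat_adj B k l)"
    if "A \<in> carrier ?R" "B \<in> carrier ?R" for A B :: "('d, 'h) op_matrix"
    using op_matricesD(1)[OF Bus_op_matrices[OF that(1)]] op_matricesD(1)[OF Bus_op_matrices[OF that(2)]]
    by (simp add: mat_adj_def adj_blinfun_add)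
  have adj_scale: "mat_adj (\<lambda>k l. scaleC_blinfun c (A k l)) = (\<lambda>k l. scaleC_blinfun (cnj c) (mat_adj A k l))"
    if "A \<in> carrier ?R" for A :: "('d, 'h) op_matrix" and c
    using op_matricesD(1)[OF Bus_op_matrices[OF that]] by (simp add: mat_adj_def adj_blinfun_scaleC)
  have nn: "0 \<le> anorm ?R A" for A :: "('d, 'h) op_matrix"
    by (simp add: anorm_eq)
  show ?thesis
  proof (unfold_locales, goal_cases)
    \<comment> \<open>The numbered cases are the axioms in order: 6 and 7 move scalars through
      products, 9 is definiteness of the norm, 13 completeness, 19 isometry of the
      involution.\<close>
    case (6 A B c)
    then show ?case
      by (auto simp: bus_matrix_op_mult bus_matrix_op_cscale cscale_closed mat_mult_in_Bus
          bus_matrix_op_in_l2 intro!: bus_matrix_op_inject)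
  next
    case (7 A B c)
    then show ?case
      by (auto simp: bus_matrix_op_mult bus_matrix_op_cscale cscale_closed mat_mult_in_Bus
          bus_matrix_op_in_l2 matrix_op_scaleC[OF Bus_D] intro!: bus_matrix_op_inject)
  next
    case (9 A)
    show ?case
    proof
      assume "anorm ?R A = 0"
      then show "A = \<zero>\<^bsub>?R\<^esub>" using norm_entry_le_anorm[OF 9] by (simp add: fun_eq_iff)
    next
      assume "A = \<zero>\<^bsub>?R\<^esub>"
      then have "A = (\<lambda>k l. scaleC_blinfun 0 (0 :: 'h \<Rightarrow>\<^sub>L 'h))"
        by (auto simp: fun_eq_iff scaleC_blinfun.rep_eq intro!: blinfun_eqI)
      then show "anorm ?R A = 0"
        using anorm_cscale[OF zero_closed, of 0] by simp
    qed
  next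
    case (13 F)
    then show ?case using bus_complete[of F] by (simp add: bus_minus_eq cong: bex_cong)
  next
    case (19 A)
    have "anorm ?R A \<le> anorm ?R (mat_adj A)"
      using anorm_mat_adj_le[OF mat_adj_in_Bus[OF 19]] invol_invol[OF 19] by simp
    then show ?case using anorm_mat_adj_le[OF 19] by simp
  qed (use anorm_cscale invol_invol adj_add adj_scale in
      \<open>auto simp: cscale_closed anorm_add anorm_mult_le mat_adj_in_Bus sc nn
        mat_adj_mult[OF Bus_D Bus_D]\<close>)
qed

end

section \<open>A growth lemma for submultiplicative sequences\<close>

text \<open>
  The exponential growth rates \<open>g\<close> of \<open>b\<close> form an up-set. Taking \<open>L = (g/q) powr (m/(p + \<delta>))\<close> in
  the hypothesis balances its two terms and improves a rate \<open>g > q\<close> to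
  \<open>q powr \<theta> * g powr (1 - \<theta>)\<close> with \<open>\<theta> = \<delta>/(p + \<delta>)\<close>, so the infimum of the rates is at most \<open>q\<close>.
\<close>

lemma submultiplicative_growth:
  fixes b :: "nat \<Rightarrow> real" and C p \<delta> q g :: real
  assumes b_nonneg: "\<And>n. 0 \<le> b n" and submult: "\<And>m n. b (m + n) \<le> b m * b n"
    and pos: "0 < C" "0 < p" "0 < \<delta>" "0 < q"
    and main: "\<And>m L. 1 \<le> L \<Longrightarrow>
      \<exists>K\<ge>0. \<forall>n. b (m * n) \<le> K * (C * (L powr p * q ^ m + L powr (- \<delta>) * b m)) ^ n"
    and "q < g"
  shows "\<exists>K\<ge>0. \<forall>n. b n \<le> K * g ^ n"
proof -
  define G where "G = {g. 0 < g \<and> (\<exists>K\<ge>0. \<forall>n. b n \<le> K * g ^ n)}"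
  define \<theta> where "\<theta> = \<delta> / (p + \<delta>)"
  have \<theta>: "0 < \<theta>" "1 - \<theta> = p / (p + \<delta>)" "0 < 1 - \<theta>"
    using pos by (auto simp: \<theta>_def field_simps)
  have up: "h \<in> G" if g: "g \<in> G" and "g \<le> h" for g h
  proof -
    obtain K where K: "K \<ge> 0" "\<And>n. b n \<le> K * g ^ n" using g by (auto simp: G_def)
    have "b n \<le> K * h ^ n" for n
      using K(2)[of n] mult_left_mono[OF power_mono[OF \<open>g \<le> h\<close>] K(1), of n] g
      by (auto simp: G_def)
    then show ?thesis using K(1) g \<open>g \<le> h\<close> by (auto simp: G_def)
  qed
  \<comment> \<open>Submultiplicativity gives geometric growth, hence at least one rate; adding 1
    keeps this rate positive even if \<open>b 1 = 0\<close>.\<close>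
  have "b n \<le> b 0 * (b 1 + 1) ^ n" for n
  proof (induction n)
    case (Suc n)
    have "b (Suc n) \<le> b n * b 1" using submult[of n 1] by simp
    also have "\<dots> \<le> (b 0 * (b 1 + 1) ^ n) * (b 1 + 1)"
      using Suc b_nonneg by (intro mult_mono) auto
    finally show ?case by (simp add: mult_ac)
  qed simp
  then have "b 1 + 1 \<in> G" using b_nonneg[of 0] b_nonneg[of 1] by (auto simp: G_def)
  then have ne: "G \<noteq> {}" by blast
  have improve: "g2 \<in> G" if g: "g \<in> G" "q < g" and g2: "q powr \<theta> * g powr (1 - \<theta>) < g2" for g g2
  proof -
    obtain K where K: "K \<ge> 0" "\<And>n. b n \<le> K * g ^ n" using g by (auto simp: G_def)
    define g1 where "g1 = q powr \<theta> * g powr (1 - \<theta>)"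
    define l where "l = (g / q) powr (1 / (p + \<delta>))"
    have "0 < g1" using pos g by (simp add: g1_def)
    have l: "1 \<le> l" using pos g by (auto simp: l_def intro!: ge_one_powr_ge_zero)
    have lp: "l powr p * q = g1"
    proof -
      have "l powr p * q = (g / q) powr (1 - \<theta>) * q"
        by (simp add: l_def powr_powr \<theta>(2))
      also have "\<dots> = g powr (1 - \<theta>) * (q powr 1 / q powr (1 - \<theta>))"
        using pos g by (simp add: powr_divide)
      also have "q powr 1 / q powr (1 - \<theta>) = q powr \<theta>"
        unfolding powr_diff[symmetric] by simp
      finally show ?thesis by (simp add: g1_def mult.commute)
    qed
    have ld: "l powr (- \<delta>) * g = g1"
    proof -
      have "l powr (- \<delta>) * g = (g / q) powr (- \<theta>) * g"
        by (simp add: l_def powr_powr \<theta>_def)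
      also have "\<dots> = (g powr 1 / g powr \<theta>) * q powr \<theta>"
        using pos g by (simp add: powr_divide powr_minus field_simps)
      also have "g powr 1 / g powr \<theta> = g powr (1 - \<theta>)"
        unfolding powr_diff[symmetric] by simp
      finally show ?thesis by (simp add: g1_def mult.commute)
    qed
    define C' where "C' = C * (1 + K)"
    have "1 < g2 / g1" using g2 \<open>0 < g1\<close> by (simp add: g1_def)
    \<comment> \<open>Since \<open>g2\<close> is strictly above the balanced rate \<open>g1\<close>,
      a large \<open>m\<close> absorbs the constant \<open>C'\<close>. Passing to
      \<open>Suc m0\<close> makes \<open>m\<close> positive, so that remainders modulo
      \<open>m\<close> are below \<open>m\<close>.\<close>
    then obtain m0 where m0: "C' < (g2 / g1) ^ m0" using real_arch_pow by blast
    define m where "m = Suc m0"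
    have "(g2 / g1) ^ m0 \<le> (g2 / g1) ^ m"
      using \<open>1 < g2 / g1\<close> by (intro power_increasing) (auto simp: m_def)
    then have "C' \<le> (g2 / g1) ^ m" using m0 by simp
    then have Cm: "C' * g1 ^ m \<le> g2 ^ m"
      using \<open>0 < g1\<close> by (simp add: power_divide le_divide_eq)
    have "0 < g2" using g2 \<open>0 < g1\<close> by (simp add: g1_def)
    have lm: "(l ^ m) powr a = (l powr a) ^ m" for a
      using l by (simp add: powr_powr powr_realpow[symmetric] mult.commute)
    obtain K' where K': "K' \<ge> 0"
      "\<And>n. b (m * n) \<le> K' * (C * ((l ^ m) powr p * q ^ m + (l ^ m) powr (- \<delta>) * b m)) ^ n"
      using main[of "l ^ m" m] l by auto
    have base: "C * ((l ^ m) powr p * q ^ m + (l ^ m) powr (- \<delta>) * b m) \<le> g2 ^ m"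
    proof -
      have "(l ^ m) powr (- \<delta>) * b m \<le> (l powr (- \<delta>)) ^ m * (K * g ^ m)"
        unfolding lm by (intro mult_left_mono K) auto
      also have "\<dots> = K * g1 ^ m" by (simp add: ld[symmetric] power_mult_distrib)
      finally have "C * ((l ^ m) powr p * q ^ m + (l ^ m) powr (- \<delta>) * b m) \<le> C * (g1 ^ m + K * g1 ^ m)"
        using pos by (intro mult_left_mono add_mono) (auto simp: lm lp[symmetric] power_mult_distrib)
      also have "\<dots> = C' * g1 ^ m" by (simp add: C'_def algebra_simps)
      finally show ?thesis using Cm by simp
    qed
    have base0: "0 \<le> C * ((l ^ m) powr p * q ^ m + (l ^ m) powr (- \<delta>) * b m)"
      using pos b_nonneg[of m] by simp
    have bm: "b (m * n) \<le> K' * g2 ^ (m * n)" for n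
      using K'(2)[of n] mult_left_mono[OF power_mono[OF base base0] K'(1), of n]
      by (simp add: power_mult)
    \<comment> \<open>One constant for all remainders: it extends the estimate from multiples of
      \<open>m\<close> to every index.\<close>
    define D where "D = (\<Sum>i<m. b i / g2 ^ i)"
    have "b N \<le> K' * D * g2 ^ N" for N
    proof -
      define i where "i = N mod m"
      have N: "N = m * (N div m) + i" by (simp add: i_def)
      have "i < m" by (simp add: i_def m_def)
      then have "b i / g2 ^ i \<le> D"
        unfolding D_def using b_nonneg \<open>0 < g2\<close>
        by (intro member_le_sum) auto
      then have bi: "b i \<le> D * g2 ^ i" using \<open>0 < g2\<close> by (simp add: divide_le_eq)
      have "b N \<le> b (m * (N div m)) * b i" using submult[of "m * (N div m)" i] N by simp
      also have "\<dots> \<le> (K' * g2 ^ (m * (N div m))) * (D * g2 ^ i)"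
        using bm bi b_nonneg \<open>0 < g2\<close> K'(1) by (intro mult_mono) auto
      also have "\<dots> = K' * D * g2 ^ N"
        using arg_cong[OF N, of "power g2"] by (simp add: power_add)
      finally show ?thesis .
    qed
    moreover have "0 \<le> K' * D"
      using K'(1) b_nonneg \<open>0 < g2\<close> by (auto simp: D_def intro!: mult_nonneg_nonneg sum_nonneg)
    ultimately show ?thesis using \<open>0 < g2\<close> by (auto simp: G_def)
  qed
  have bdd: "bdd_below G" by (rule bdd_belowI[where m = 0]) (auto simp: G_def)
  define r where "r = Inf G"
  have r_le: "r \<le> g" if "g \<in> G" for g unfolding r_def by (rule cInf_lower[OF that bdd])
  have near: "\<exists>g\<in>G. g < h" if "r < h" for h
    using cInf_lessD[OF ne that[unfolded r_def]] by blast
  have "r \<le> q"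
  proof (rule ccontr)
    assume "\<not> r \<le> q"
    then have rq: "q < r" by simp
    \<comment> \<open>\<open>h\<close> is the rate whose improvement is exactly \<open>r\<close>. A
      rate below \<open>h\<close> exists because \<open>r < h\<close>, and it improves to something
      below the infimum.\<close>
    define h where "h = r * (r / q) powr (\<theta> / (1 - \<theta>))"
    have "1 < (r / q) powr (\<theta> / (1 - \<theta>))"
      using rq pos \<theta> by (intro gr_one_powr) auto
    then have "r < h" using rq pos by (simp add: h_def)
    then obtain g where g: "g \<in> G" "g < h" using near by blast
    have "q < g" using r_le[OF g(1)] rq by simp
    have "q powr \<theta> * g powr (1 - \<theta>) < q powr \<theta> * h powr (1 - \<theta>)"
      using g \<open>q < g\<close> \<theta> pos by (intro mult_strict_left_mono powr_less_mono2) auto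
    also have "h powr (1 - \<theta>) = r powr (1 - \<theta>) * (r / q) powr \<theta>"
      using rq pos \<theta> by (simp add: h_def powr_mult powr_powr)
    also have "q powr \<theta> * (r powr (1 - \<theta>) * (r / q) powr \<theta>) = r powr (1 - \<theta>) * r powr \<theta>"
      using rq pos by (simp add: powr_divide)
    also have "\<dots> = r" using rq pos by (simp add: powr_add[symmetric])
    finally obtain g2 where "q powr \<theta> * g powr (1 - \<theta>) < g2" "g2 < r" using dense by blast
    then show False using improve[OF g(1) \<open>q < g\<close>] r_le by force
  qed
  then obtain g' where "g' \<in> G" "g' < g" using near[of g] \<open>q < g\<close> by auto
  then have "g \<in> G" using up by force
  then show ?thesis by (auto simp: G_def)
qed

section \<open>Neumann series\<close>

text \<open>Summability of the norms of the powers is assumed instead of norm below 1: later only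
  the growth rate of the powers is known, and single powers may be large.\<close>

lemma (in unital_banach_star_algebra) one_minus_in_Units:
  assumes x: "x \<in> carrier R" and sum: "summable (\<lambda>n. anorm R (x [^] (n::nat)))"
  shows "\<one> \<ominus> x \<in> Units R"
proof -
  \<comment> \<open>Partial sums of the Neumann series, defined by recursion so that the tail
    estimate and the telescoping identities are plain inductions. \<open>S n\<close> stops at the
    power n - 1.\<close>
  define S where "S = rec_nat \<zero> (\<lambda>n y. y \<oplus> x [^] (n::nat))"
  have S0: "S 0 = \<zero>" and SS: "S (Suc n) = S n \<oplus> x [^] n" for n
    by (simp_all add: S_def)
  have pw: "x [^] n \<in> carrier R" for n :: nat using x by simp
  have Sc: "S n \<in> carrier R" for n by (induction n) (simp_all add: S0 SS pw)
  have minus_trans: "a \<oplus> p \<ominus> c = (a \<ominus> c) \<oplus> p"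
    if "a \<in> carrier R" "p \<in> carrier R" "c \<in> carrier R" for a p c
    using that by (simp add: a_minus_def a_ac)
  have an_minus: "anorm R (a \<ominus> c) = anorm R (c \<ominus> a)" if "a \<in> carrier R" "c \<in> carrier R" for a c
  proof -
    have "anorm R ((- 1) \<odot> (c \<ominus> a)) = anorm R (c \<ominus> a)"
      using that by (simp add: anorm_cscale)
    moreover have "(- 1) \<odot> (c \<ominus> a) = a \<ominus> c"
    proof -
      have "(- 1) \<odot> y \<oplus> y = \<zero>" if y: "y \<in> carrier R" for y
      proof -
        have "0 \<odot> y \<oplus> 0 \<odot> y = 0 \<odot> y"
          using cscale_add_left[OF y, of 0 0] by simp
        then have "0 \<odot> y = \<zero>" using y cscale_closed[OF y, of 0] by (simp add: add.l_cancel_one)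
        then show ?thesis using cscale_add_left[OF y, of "-1" 1] cscale_one[OF y] by simp
      qed
      then have "\<ominus> (c \<ominus> a) = (- 1) \<odot> (c \<ominus> a)"
        using that by (intro minus_equality cscale_closed) auto
      then show ?thesis using that by (simp add: a_minus_def minus_add a_comm)
    qed
    ultimately show ?thesis by simp
  qed
  have tail: "anorm R (S (m + j) \<ominus> S m) \<le> (\<Sum>i=m..<m+j. anorm R (x [^] i))" for m j
  proof (induction j)
    case 0
    then show ?case using Sc[of m] anorm_eq_0_iff[of \<zero>] by (simp add: a_minus_def r_neg)
  next
    case (Suc j)
    have "S (m + Suc j) \<ominus> S m = (S (m + j) \<ominus> S m) \<oplus> x [^] (m + j)"
      using minus_trans[OF Sc pw Sc] by (simp add: SS)
    also have "anorm R \<dots> \<le> anorm R (S (m + j) \<ominus> S m) + anorm R (x [^] (m + j))"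
      using Sc pw by (intro anorm_triangle) auto
    finally show ?case using Suc by simp
  qed
  have cauchy: "\<forall>e>0. \<exists>N. \<forall>m\<ge>N. \<forall>n\<ge>N. anorm R (S m \<ominus> S n) < e"
  proof (intro allI impI)
    fix e :: real assume "e > 0"
    then obtain N where N: "\<And>m n. m \<ge> N \<Longrightarrow> norm (\<Sum>i=m..<n. anorm R (x [^] (i::nat))) < e"
      using sum unfolding summable_Cauchy by blast
    have lt: "anorm R (S n \<ominus> S m) < e" if "m \<ge> N" "m \<le> n" for m n
      using tail[of m "n - m"] N[OF that(1), of n] that(2)
      by (simp add: abs_less_iff)
    have "anorm R (S m \<ominus> S n) < e" if "m \<ge> N" "n \<ge> N" for m n
      using lt[of m n] lt[of n m] that an_minus[OF Sc Sc, of m n] by (cases "m \<le> n") auto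
    then show "\<exists>N. \<forall>m\<ge>N. \<forall>n\<ge>N. anorm R (S m \<ominus> S n) < e" by blast
  qed
  obtain y where y: "y \<in> carrier R" and lim: "(\<lambda>n. anorm R (S n \<ominus> y)) \<longlonglongrightarrow> 0"
    using anorm_complete[OF Sc cauchy] by blast
  let ?a = "\<one> \<ominus> x"
  have a: "?a \<in> carrier R" using x by simp
  have minus_distr: "b \<otimes> (c \<ominus> d) = b \<otimes> c \<ominus> b \<otimes> d" "(c \<ominus> d) \<otimes> b = c \<otimes> b \<ominus> d \<otimes> b"
    if "b \<in> carrier R" "c \<in> carrier R" "d \<in> carrier R" for b c d
    using that by (simp_all add: a_minus_def r_distr l_distr r_minus l_minus)
  have tele: "p \<ominus> q \<oplus> (q \<ominus> t) = p \<ominus> t" if "p \<in> carrier R" "q \<in> carrier R" "t \<in> carrier R" for p q t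
    using that by (simp add: a_minus_def a_assoc r_neg1)
  have pw_comm: "x \<otimes> x [^] n = x [^] Suc n" for n :: nat
    using x nat_pow_Suc2 by simp
  have aS: "?a \<otimes> S n = \<one> \<ominus> x [^] n" "S n \<otimes> ?a = \<one> \<ominus> x [^] n" for n
  proof (induction n)
    case 0
    show "?a \<otimes> S 0 = \<one> \<ominus> x [^] (0::nat)" "S 0 \<otimes> ?a = \<one> \<ominus> x [^] (0::nat)"
      using a by (simp_all add: S0 a_minus_def r_neg)
  next
    case (Suc n)
    have "?a \<otimes> x [^] n = x [^] n \<ominus> x [^] Suc n" "x [^] n \<otimes> ?a = x [^] n \<ominus> x [^] Suc n"
      using x pw[of n] pw_comm[of n] by (simp_all add: minus_distr)
    moreover have "?a \<otimes> S (Suc n) = ?a \<otimes> S n \<oplus> ?a \<otimes> x [^] n" "S (Suc n) \<otimes> ?a = S n \<otimes> ?a \<oplus> x [^] n \<otimes> ?a"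
      unfolding SS using a Sc[of n] pw[of n] by (simp_all add: r_distr l_distr)
    ultimately show "?a \<otimes> S (Suc n) = \<one> \<ominus> x [^] Suc n" "S (Suc n) \<otimes> ?a = \<one> \<ominus> x [^] Suc n"
      unfolding Suc using tele[OF one_closed pw pw, of n "Suc n"] by simp_all
  qed
  have pw0: "(\<lambda>n. anorm R (x [^] n)) \<longlonglongrightarrow> 0" using sum by (rule summable_LIMSEQ_zero)
  \<comment> \<open>Serves both products of the limit \<open>y\<close> with 1 - x: each is
    approximated by the corresponding product with \<open>S n\<close>, which is 1 - x^n and tends to
    1.\<close>
  have eq_one: "z = \<one>" if z: "z \<in> carrier R"
    and le: "\<And>n. anorm R (z \<ominus> (\<one> \<ominus> x [^] n)) \<le> anorm R ?a * anorm R (S n \<ominus> y)" for z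
  proof -
    have "anorm R (z \<ominus> \<one>) \<le> anorm R ?a * anorm R (S n \<ominus> y) + anorm R (x [^] n)" for n
    proof -
      have "z \<ominus> \<one> = (z \<ominus> (\<one> \<ominus> x [^] n)) \<oplus> ((\<one> \<ominus> x [^] n) \<ominus> \<one>)"
        using z pw[of n] by (intro tele[symmetric]) auto
      then have "anorm R (z \<ominus> \<one>) \<le> anorm R (z \<ominus> (\<one> \<ominus> x [^] n)) + anorm R ((\<one> \<ominus> x [^] n) \<ominus> \<one>)"
        using z pw[of n] by (metis anorm_triangle minus_closed one_closed)
      moreover have "anorm R ((\<one> \<ominus> x [^] n) \<ominus> \<one>) = anorm R (x [^] n)"
      proof -
        have "\<one> \<ominus> (\<one> \<ominus> x [^] n) = x [^] n"
          using pw[of n] by (simp add: a_minus_def minus_add r_neg2)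
        then show ?thesis using an_minus[of "\<one> \<ominus> x [^] n" \<one>] pw[of n] by simp
      qed
      ultimately show ?thesis using le[of n] by linarith
    qed
    moreover have "(\<lambda>n. anorm R ?a * anorm R (S n \<ominus> y) + anorm R (x [^] n)) \<longlonglongrightarrow> anorm R ?a * 0 + 0"
      by (intro tendsto_intros lim pw0)
    ultimately have "anorm R (z \<ominus> \<one>) \<le> anorm R ?a * 0 + 0"
      by (intro LIMSEQ_le_const) auto
    then have "anorm R (z \<ominus> \<one>) = 0" using anorm_nonneg[of "z \<ominus> \<one>"] z by simp
    then have "z \<ominus> \<one> = \<zero>" using anorm_eq_0_iff[of "z \<ominus> \<one>"] z by simp
    then show ?thesis using z minus_equality[of z "\<ominus> \<one>"] by (simp add: a_minus_def)
  qed
  have "?a \<otimes> y = \<one>"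
  proof (rule eq_one)
    fix n
    have "?a \<otimes> y \<ominus> (\<one> \<ominus> x [^] n) = ?a \<otimes> (y \<ominus> S n)"
      using a y Sc[of n] by (simp add: minus_distr aS)
    then show "anorm R (?a \<otimes> y \<ominus> (\<one> \<ominus> x [^] n)) \<le> anorm R ?a * anorm R (S n \<ominus> y)"
      using anorm_mult[OF a, of "y \<ominus> S n"] y Sc[of n] an_minus[of y "S n"] by simp
  qed (use a y in simp)
  moreover have "y \<otimes> ?a = \<one>"
  proof (rule eq_one)
    fix n
    have "y \<otimes> ?a \<ominus> (\<one> \<ominus> x [^] n) = (y \<ominus> S n) \<otimes> ?a"
      using a y Sc[of n] minus_distr(2)[of ?a y "S n"] aS(2)[of n] by simp
    then show "anorm R (y \<otimes> ?a \<ominus> (\<one> \<ominus> x [^] n)) \<le> anorm R ?a * anorm R (S n \<ominus> y)"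
      using anorm_mult[of "y \<ominus> S n" ?a] a y Sc[of n] an_minus[of y "S n"] by (simp add: mult.commute)
  qed (use a y in simp)
  ultimately show ?thesis using a y by (auto simp: Units_def)
qed

section \<open>Shifted weights\<close>

text \<open>Both \<open>y\<close> and x + h are convex combinations of the outer points
  \<open>x\<close> and y + h, with weights \<open>t\<close> and 1 - t interchanged. Adding the two
  concavity inequalities gives the claim.\<close>

lemma concave_increment_mono:
  fixes \<rho> :: "real \<Rightarrow> real"
  assumes \<rho>: "concave_on {0..} \<rho>" and "0 \<le> x" "x \<le> y" "0 \<le> h"
  shows "\<rho> (y + h) - \<rho> y \<le> \<rho> (x + h) - \<rho> x"
proof (cases "y + h = x")
  case False
  define t where "t = h / (y + h - x)"
  have pos: "0 < y + h - x" using assms False by simp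
  have t: "0 \<le> t" "t \<le> 1" using assms pos by (auto simp: t_def divide_le_eq)
  have th: "t * (y + h - x) = h" using pos by (simp add: t_def)
  have "(1 - t) * \<rho> x + t * \<rho> (y + h) \<le> \<rho> ((1 - t) * x + t * (y + h))"
    using concave_onD[OF \<rho> t, of x "y + h"] assms by simp
  moreover have "(1 - t) * x + t * (y + h) = x + h" using th by (simp add: algebra_simps)
  moreover have "t * \<rho> x + (1 - t) * \<rho> (y + h) \<le> \<rho> (t * x + (1 - t) * (y + h))"
    using concave_onD[OF \<rho>, of "1 - t" x "y + h"] assms t by simp
  moreover have "t * x + (1 - t) * (y + h) = y" using th by (simp add: algebra_simps)
  ultimately show ?thesis by (simp add: algebra_simps)
qed (use assms in auto)

text \<open>Once a concave function decreases over a step \<open>h\<close>, it decreases by at least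
  the same amount over every later step, and would eventually become negative.\<close>

lemma concave_nonneg_mono:
  fixes \<rho> :: "real \<Rightarrow> real"
  assumes \<rho>: "concave_on {0..} \<rho>" and nn: "\<And>t. 0 \<le> t \<Longrightarrow> 0 \<le> \<rho> t" and xy: "0 \<le> x" "x \<le> y"
  shows "\<rho> x \<le> \<rho> y"
proof (rule ccontr)
  define h d where "h = y - x" and "d = \<rho> x - \<rho> y"
  assume "\<not> \<rho> x \<le> \<rho> y"
  then have "0 < d" by (simp add: d_def)
  have h: "0 \<le> h" using xy by (simp add: h_def)
  have "\<rho> (x + real n * h) \<le> \<rho> x - real n * d" for n
  proof (induction n)
    case (Suc n)
    have "\<rho> (x + real n * h + h) - \<rho> (x + real n * h) \<le> \<rho> (x + h) - \<rho> x"
      using h xy by (intro concave_increment_mono[OF \<rho>]) auto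
    also have "\<dots> = - d" by (simp add: h_def d_def)
    finally show ?case using Suc by (simp add: algebra_simps)
  qed simp
  moreover have "0 \<le> \<rho> (x + real n * h)" for n using h xy by (intro nn) auto
  ultimately have "real n * d \<le> \<rho> x" for n by (metis diff_ge_0_iff_ge order_trans)
  moreover obtain n :: nat where "\<rho> x < real n * d" using ex_less_of_nat_mult[OF \<open>0 < d\<close>] by blast
  ultimately show False by (meson not_le)
qed

text \<open>Subtracting \<open>\<rho> a\<close> normalises the weight at the origin.
  Submultiplicativity holds because the increment of \<rho> over \<open>N y\<close> is largest when
  it starts at \<open>a\<close>.\<close>

lemma bus_weight_exp_concave:
  assumes N: "is_norm N" and \<rho>: "concave_on {0..} \<rho>" and nn: "\<And>t. 0 \<le> t \<Longrightarrow> 0 \<le> \<rho> t"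
    and "0 \<le> a" and "0 \<le> s"
  shows "bus_weight (\<lambda>x. exp (\<rho> (a + N x) - \<rho> a)) s"
proof
  note inc = concave_increment_mono[OF \<rho>] and mono = concave_nonneg_mono[OF \<rho> nn]
  have N0: "0 \<le> N x" and Na: "N (x + y) \<le> N x + N y" for x y
    using N by (auto simp: is_norm_def)
  show "1 \<le> exp (\<rho> (a + N x) - \<rho> a)" for x
    using mono[of a "a + N x"] \<open>0 \<le> a\<close> N0[of x] by simp
  have "N 0 = 0" using N unfolding is_norm_def by blast
  then show "exp (\<rho> (a + N 0) - \<rho> a) = 1" by simp
  have "N ((- 1) *\<^sub>R x) = \<bar>- 1\<bar> * N x" for x using N unfolding is_norm_def by blast
  then show "exp (\<rho> (a + N (- x)) - \<rho> a) = exp (\<rho> (a + N x) - \<rho> a)" for x by simp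
  show "exp (\<rho> (a + N (x + y)) - \<rho> a) \<le> exp (\<rho> (a + N x) - \<rho> a) * exp (\<rho> (a + N y) - \<rho> a)" for x y
  proof -
    have "\<rho> (a + N (x + y)) \<le> \<rho> (a + N x + N y)"
      using \<open>0 \<le> a\<close> Na[of x y] N0[of "x + y"] by (intro mono) auto
    moreover have "\<rho> (a + N x + N y) - \<rho> (a + N x) \<le> \<rho> (a + N y) - \<rho> a"
      using \<open>0 \<le> a\<close> N0[of x] N0[of y] by (intro inc) auto
    ultimately show ?thesis by (simp flip: exp_add)
  qed
qed (rule \<open>0 \<le> s\<close>)

text \<open>
  For \<open>u = exp (\<rho> \<circ> N)\<close> the weight \<open>w = exp (\<rho> (a + N x) - \<rho> a)\<close> is equivalent to \<open>u\<close>; with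
  \<open>\<rho> \<tau> = \<sigma>\<close> concavity gives \<open>\<rho> (a + t) - \<rho> a \<le> \<rho> t - \<sigma> + \<tau> \<rho> a / a\<close> for \<open>t \<ge> \<tau>\<close>, and
  \<open>\<rho> a / a\<close> becomes small because \<open>u\<close> has subexponential growth.
\<close>

lemma admissible_weight_shift:
  fixes u :: "real ^ 'd \<Rightarrow> real"
  assumes adm: "admissible_weight u" and "0 < \<delta>" and ge: "\<And>x. poly_weight \<delta> x \<le> u x"
    and "0 \<le> \<sigma>" and "0 \<le> s"
  obtains w K where "bus_weight w s" "0 < K" "\<And>x. w x \<le> u x" "\<And>x. u x \<le> K * w x"
    "\<And>x. w x \<le> 2 \<and> u x \<le> exp \<sigma> \<or> w x \<le> 2 * exp (- \<sigma>) * u x"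
proof -
  obtain N \<rho> where N: "is_norm N" and cont: "continuous_on {0..} \<rho>" and \<rho>: "concave_on {0..} \<rho>"
    and nn: "\<And>t. 0 \<le> t \<Longrightarrow> 0 \<le> \<rho> t" and "\<rho> 0 = 0" and u: "\<And>x. u x = exp (\<rho> (N x))"
    and grs: "\<And>z. (\<lambda>n::nat. u (real n *\<^sub>R z) powr (1 / real n)) \<longlonglongrightarrow> 1"
    using adm unfolding admissible_weight_def by blast
  note inc = concave_increment_mono[OF \<rho>] and mono = concave_nonneg_mono[OF \<rho> nn]
  have N0: "0 \<le> N x" "N 0 = 0" and Ns: "N (c *\<^sub>R x) = \<bar>c\<bar> * N x" and Npos: "N x = 0 \<longleftrightarrow> x = 0" for c x
    using N by (auto simp: is_norm_def)
  \<comment> \<open>Any nonzero vector would do; normalised in \<open>N\<close>, it gives a ray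
    along which \<open>u\<close> takes the values \<open>exp (\<rho> t)\<close>.\<close>
  define e :: "real ^ 'd" where "e = (\<chi> i. 1)"
  have "e \<noteq> 0" by (simp add: e_def vec_eq_iff)
  define z where "z = (1 / N e) *\<^sub>R e"
  have Nz: "N z = 1" using \<open>e \<noteq> 0\<close> Npos[of e] N0(1)[of e] by (simp add: z_def Ns)
  then have "z \<noteq> 0" using N0(2) by auto
  \<comment> \<open>Along this ray the subexponential growth condition reads:
    \<open>\<rho> n / n\<close> tends to 0.\<close>
  have "(\<lambda>n::nat. ln (u (real n *\<^sub>R z) powr (1 / real n))) \<longlonglongrightarrow> ln 1"
    by (intro tendsto_ln grs) simp
  then have lim: "(\<lambda>n::nat. \<rho> (real n) / real n) \<longlonglongrightarrow> 0"
    by (simp add: u Ns Nz ln_powr)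
  \<comment> \<open>At \<open>r *\<^sub>R z\<close>, whose Euclidean norm is exp
    (\<sigma>/\<delta>), the lower bound on \<open>u\<close> forces \<rho> to have reached \<sigma>.
    The intermediate value theorem then gives \<tau>.\<close>
  define r where "r = exp (\<sigma> / \<delta>) / norm z"
  have r: "0 \<le> r" by (simp add: r_def)
  have "exp \<sigma> = exp (\<sigma> / \<delta>) powr \<delta>" using \<open>0 < \<delta>\<close> by (simp add: powr_def)
  also have "\<dots> \<le> poly_weight \<delta> (r *\<^sub>R z)"
    unfolding poly_weight_def using \<open>0 < \<delta>\<close> \<open>z \<noteq> 0\<close> r by (intro powr_mono2) (auto simp: r_def)
  also have "\<dots> \<le> exp (\<rho> r)" using ge[of "r *\<^sub>R z"] r by (simp add: u Ns Nz)
  finally have "\<sigma> \<le> \<rho> r" by simp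
  then obtain \<tau> where \<tau>: "0 \<le> \<tau>" "\<rho> \<tau> = \<sigma>"
    using IVT'[of \<rho> 0 \<sigma> r] \<open>0 \<le> \<sigma>\<close> \<open>\<rho> 0 = 0\<close> r continuous_on_subset[OF cont] by auto
  \<comment> \<open>The shift \<open>a\<close> will be an integer so large that \<rho> gains at most
    \<open>ln 2\<close> from \<open>a\<close> to a + \<tau>. This \<open>ln 2\<close> is the factor
    2 in the conclusion.\<close>
  have "(\<lambda>n::nat. \<tau> * (\<rho> (real n) / real n)) \<longlonglongrightarrow> \<tau> * 0" by (intro tendsto_intros lim)
  then have "\<forall>\<^sub>F n in sequentially. \<tau> * (\<rho> (real n) / real n) < ln 2"
    by (rule order_tendstoD) simp
  then have "\<forall>\<^sub>F n in sequentially. 0 < n \<and> \<tau> * (\<rho> (real n) / real n) < ln 2"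
    using eventually_gt_at_top by (rule eventually_conj[rotated])
  then obtain n :: nat where n: "0 < n" "\<tau> * (\<rho> (real n) / real n) < ln 2"
    using eventually_happens'[OF sequentially_bot] by blast
  define a where "a = real n"
  have a: "0 < a" using n by (simp add: a_def)
  \<comment> \<open>A concave function vanishing at 0 has nonincreasing slope \<rho> t / t, so the
    gain over \<tau> is at most \<tau> times the slope at \<open>a\<close>.\<close>
  have step: "\<rho> (a + \<tau>) - \<rho> a \<le> ln 2"
  proof -
    define t where "t = a / (a + \<tau>)"
    have t: "0 \<le> t" "t \<le> 1" "t * (a + \<tau>) = a" using a \<tau>(1) by (auto simp: t_def)
    have "t * \<rho> (a + \<tau>) \<le> \<rho> a"
      using concave_onD[OF \<rho> t(1,2), of 0 "a + \<tau>"] a \<tau>(1) \<open>\<rho> 0 = 0\<close> t(3) by simp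
    then have "a * \<rho> (a + \<tau>) \<le> (a + \<tau>) * \<rho> a"
      using a \<tau>(1) by (simp add: t_def divide_le_eq mult.commute)
    then have "\<rho> (a + \<tau>) - \<rho> a \<le> \<tau> * (\<rho> a / a)" using a by (simp add: field_simps)
    then show ?thesis using n(2) by (simp add: a_def)
  qed
  define w where "w x = exp (\<rho> (a + N x) - \<rho> a)" for x
  show ?thesis
  proof (rule that[of w "exp (\<rho> a)"])
    show "bus_weight w s"
      unfolding w_def by (rule bus_weight_exp_concave[OF N \<rho> nn less_imp_le[OF a] \<open>0 \<le> s\<close>])
    show "w x \<le> u x" for x
      using inc[of 0 a "N x"] a N0(1)[of x] \<open>\<rho> 0 = 0\<close> by (simp add: w_def u)
    show "u x \<le> exp (\<rho> a) * w x" for x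
      using mono[of "N x" "a + N x"] a N0(1)[of x] by (simp add: w_def u flip: exp_add)
    show "w x \<le> 2 \<and> u x \<le> exp \<sigma> \<or> w x \<le> 2 * exp (- \<sigma>) * u x" for x
    proof (cases "N x < \<tau>")
      case True
      have "\<rho> (N x) \<le> \<sigma>" using mono[of "N x" \<tau>] True N0(1)[of x] \<tau> by simp
      moreover have "\<rho> (a + N x) \<le> \<rho> (a + \<tau>)" using a True N0(1)[of x] by (intro mono) auto
      then have "w x \<le> exp (ln 2)" unfolding w_def exp_le_cancel_iff using step by linarith
      ultimately show ?thesis by (simp add: u)
    next
      case False
      \<comment> \<open>Beyond \<tau> the increments of the shifted function are dominated by those
        of \<rho> itself; the missing initial rise of \<rho> up to \<tau> produces the factor exp (-
        \<sigma>).\<close>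
      then have "\<rho> (a + \<tau> + (N x - \<tau>)) - \<rho> (a + \<tau>) \<le> \<rho> (\<tau> + (N x - \<tau>)) - \<rho> \<tau>"
        using a \<tau> by (intro inc) auto
      then have "\<rho> (a + N x) - \<rho> a \<le> ln 2 + - \<sigma> + \<rho> (N x)" using step \<tau> by simp
      then have "w x \<le> exp (ln 2 + - \<sigma> + \<rho> (N x))" by (simp add: w_def)
      also have "\<dots> = 2 * exp (- \<sigma>) * u x" unfolding exp_add u by simp
      finally show ?thesis by simp
    qed
  qed simp
qed

lemma admissible_weight_bus_weight:
  fixes u :: "real ^ 'd \<Rightarrow> real"
  assumes adm: "admissible_weight u" and "0 \<le> s"
  shows "bus_weight u s"
proof -
  obtain N \<rho> where N: "is_norm N" and \<rho>: "concave_on {0..} \<rho>"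
    and nn: "\<And>t. 0 \<le> t \<Longrightarrow> 0 \<le> \<rho> t" and "\<rho> 0 = 0" and u: "\<And>x. u x = exp (\<rho> (N x))"
    using adm unfolding admissible_weight_def by blast
  have "u = (\<lambda>x. exp (\<rho> (0 + N x) - \<rho> 0))" by (simp add: fun_eq_iff u \<open>\<rho> 0 = 0\<close>)
  then show ?thesis using bus_weight_exp_concave[OF N \<rho> nn order_refl \<open>0 \<le> s\<close>] by simp
qed

section \<open>Counting points of a relatively separated set\<close>

text \<open>A Euclidean ball of radius \<open>r\<close> is covered by the unit cubes with integer corners in \<open>[-\<lceil>r\<rceil>, \<lceil>r\<rceil>]\<^sup>d\<close>.\<close>

lemma relatively_separated_card_le:
  fixes X :: "(real ^ 'd) set"
  assumes "relatively_separated X"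
  obtains M :: real where "0 < M"
    "\<And>k r F. 0 \<le> r \<Longrightarrow> finite F \<Longrightarrow> F \<subseteq> X \<Longrightarrow> (\<And>l. l \<in> F \<Longrightarrow> norm (l - k) \<le> r) \<Longrightarrow>
      real (card F) \<le> M * (1 + r) ^ CARD('d)"
proof -
  obtain N where N: "\<And>x. finite (X \<inter> (+) x ` cbox 0 1) \<and> card (X \<inter> (+) x ` cbox 0 1) \<le> N"
    using assms unfolding relatively_separated_def by blast
  show ?thesis
  \<comment> \<open>There are 2 m + 1 integers in [-m, m], and m <= r + 1 makes this at most 5 (1 +
    r). The 1 added to \<open>N\<close> keeps the constant positive when \<open>X\<close> is
    empty.\<close>
  proof (rule that[of "real (N + 1) * 5 ^ CARD('d)"])
    fix k :: "real ^ 'd" and r :: real and F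
    assume r: "0 \<le> r" and F: "finite F" "F \<subseteq> X" "\<And>l. l \<in> F \<Longrightarrow> norm (l - k) \<le> r"
    define m where "m = \<lceil>r\<rceil>"
    have m: "0 \<le> m" "r \<le> of_int m" "of_int m \<le> r + 1" using r by (auto simp: m_def)
    define P where "P = (UNIV :: 'd set) \<rightarrow>\<^sub>E {-m..m}"
    define c where "c = (\<lambda>f :: 'd \<Rightarrow> int. (k + (\<chi> i. real_of_int (f i)) :: real ^ 'd))"
    have fP: "finite P" by (simp add: P_def finite_PiE)
    have "F \<subseteq> (\<Union>f\<in>P. X \<inter> (+) (c f) ` cbox 0 1)"
    proof
      fix l assume l: "l \<in> F"
      define f where "f = (\<lambda>i. \<lfloor>(l - k) $ i\<rfloor>)"
      have "f \<in> P"
      proof -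
        have "- m \<le> f i \<and> f i \<le> m" for i
        proof -
          have "\<bar>(l - k) $ i\<bar> \<le> of_int m"
            using component_le_norm_cart[of "l - k" i] F(3)[OF l] m by linarith
          then show ?thesis unfolding f_def by (auto simp: le_floor_iff floor_le_iff abs_le_iff)
        qed
        then show ?thesis by (auto simp: P_def)
      qed
      moreover have "l \<in> (+) (c f) ` cbox 0 1"
      proof (rule image_eqI)
        show "l = c f + (l - c f)" by simp
        show "l - c f \<in> cbox 0 1"
        proof -
          have "0 \<le> (l - c f) $ i \<and> (l - c f) $ i \<le> 1" for i
            using of_int_floor_le[of "(l - k) $ i"] real_of_int_floor_add_one_ge[of "(l - k) $ i"]
            unfolding c_def f_def by (auto simp: algebra_simps)
          then show ?thesis by (simp add: mem_box_cart)
        qed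
      qed
      ultimately show "l \<in> (\<Union>f\<in>P. X \<inter> (+) (c f) ` cbox 0 1)" using l F(2) by auto
    qed
    then have "card F \<le> card (\<Union>f\<in>P. X \<inter> (+) (c f) ` cbox 0 1)"
      using N fP by (intro card_mono finite_UN_I) blast+
    also have "\<dots> \<le> (\<Sum>f\<in>P. card (X \<inter> (+) (c f) ` cbox 0 1))" by (rule card_UN_le[OF fP])
    also have "\<dots> \<le> card P * N" using N sum_bounded_above[of P _ N] by auto
    also have "card P = nat (2 * m + 1) ^ CARD('d)" by (simp add: P_def card_PiE algebra_simps)
    finally have "real (card F) \<le> real (nat (2 * m + 1) ^ CARD('d) * N)" by (simp only: of_nat_le_iff)
    also have "\<dots> = (2 * of_int m + 1) ^ CARD('d) * real N" using m by simp
    also have "\<dots> \<le> (5 * (1 + r)) ^ CARD('d) * real (N + 1)"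
      using m r by (intro mult_mono power_mono) auto
    finally show "real (card F) \<le> real (N + 1) * 5 ^ CARD('d) * (1 + r) ^ CARD('d)"
      by (simp only: power_mult_distrib mult_ac)
  qed simp
qed

section \<open>The operator algebra on \<open>\<ell>\<^sup>2\<close>\<close>

lemma l2_op_algebra_simps [simp]:
  "carrier (l2_op_algebra X) = l2_bounded_ops X"
  "mult (l2_op_algebra X) = compose (l2_space X)"
  "one (l2_op_algebra X) = (\<lambda>f\<in>l2_space X. f)"
  "zero (l2_op_algebra X) = (\<lambda>f\<in>l2_space X. \<lambda>k. 0)"
  "add (l2_op_algebra X) = (\<lambda>S T. \<lambda>f\<in>l2_space X. \<lambda>k. S f k + T f k)"
  "cscale (l2_op_algebra X) = (\<lambda>c T. \<lambda>f\<in>l2_space X. \<lambda>k. c *\<^sub>C T f k)"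
  by (simp_all add: l2_op_algebra_def)

lemma l2_bounded_opsD:
  assumes "T \<in> l2_bounded_ops X"
  shows "f \<in> l2_space X \<Longrightarrow> T f \<in> l2_space X"
    and "f \<in> l2_space X \<Longrightarrow> g \<in> l2_space X \<Longrightarrow> T (\<lambda>k. f k + g k) = (\<lambda>k. T f k + T g k)"
    and "f \<in> l2_space X \<Longrightarrow> T (\<lambda>k. c *\<^sub>C f k) = (\<lambda>k. c *\<^sub>C T f k)"
    and "T \<in> extensional (l2_space X)"
  using assms by (auto simp: l2_bounded_ops_def PiE_def)

lemma l2_bounded_ops_bound:
  assumes "T \<in> l2_bounded_ops X"
  shows "\<exists>C>0. \<forall>f\<in>l2_space X. l2_norm X (T f) \<le> C * l2_norm X f"
proof -
  obtain C where C: "\<forall>f\<in>l2_space X. l2_norm X (T f) \<le> C * l2_norm X f"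
    using assms by (auto simp: l2_bounded_ops_def)
  have "l2_norm X (T f) \<le> max C 1 * l2_norm X f" if "f \<in> l2_space X" for f
    using C that mult_right_mono[of C "max C 1" "l2_norm X f"] by force
  then show ?thesis by (intro exI[of _ "max C 1"]) auto
qed

lemma l2_bounded_opsI:
  assumes "\<And>f. f \<in> l2_space X \<Longrightarrow> T f \<in> l2_space X"
    and "\<And>f g. f \<in> l2_space X \<Longrightarrow> g \<in> l2_space X \<Longrightarrow> T (\<lambda>k. f k + g k) = (\<lambda>k. T f k + T g k)"
    and "\<And>c f. f \<in> l2_space X \<Longrightarrow> T (\<lambda>k. c *\<^sub>C f k) = (\<lambda>k. c *\<^sub>C T f k)"
    and "\<And>f. f \<notin> l2_space X \<Longrightarrow> T f = undefined"
    and "\<And>f. f \<in> l2_space X \<Longrightarrow> l2_norm X (T f) \<le> C * l2_norm X f"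
  shows "T \<in> l2_bounded_ops X"
  using assms unfolding l2_bounded_ops_def by (auto simp: PiE_def extensional_def intro!: exI[of _ C])

lemma l2_bounded_ops_ext:
  assumes "S \<in> l2_bounded_ops X" "T \<in> l2_bounded_ops X" "\<And>f. f \<in> l2_space X \<Longrightarrow> S f = T f"
  shows "S = T"
  using l2_bounded_opsD(4)[OF assms(1)] l2_bounded_opsD(4)[OF assms(2)] assms(3)
  by (rule extensionalityI)

lemma l2_op_add_closed:
  assumes S: "S \<in> l2_bounded_ops X" and T: "T \<in> l2_bounded_ops X"
  shows "(\<lambda>f\<in>l2_space X. \<lambda>k. S f k + T f k) \<in> l2_bounded_ops X"
proof -
  obtain C where C: "\<And>f. f \<in> l2_space X \<Longrightarrow> l2_norm X (S f) \<le> C * l2_norm X f"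
    using l2_bounded_ops_bound[OF S] by blast
  obtain D where D: "\<And>f. f \<in> l2_space X \<Longrightarrow> l2_norm X (T f) \<le> D * l2_norm X f"
    using l2_bounded_ops_bound[OF T] by blast
  note ST = l2_bounded_opsD[OF S] l2_bounded_opsD[OF T]
  show ?thesis
  proof (rule l2_bounded_opsI[where C = "C + D"])
    fix f :: "'a \<Rightarrow> 'b" assume f: "f \<in> l2_space X"
    show "l2_norm X ((\<lambda>f\<in>l2_space X. \<lambda>k. S f k + T f k) f) \<le> (C + D) * l2_norm X f"
      using l2_norm_triangle[OF ST(1)[OF f] ST(5)[OF f]] C[OF f] D[OF f] f
      by (simp add: distrib_right)
  qed (simp_all add: ST l2_space_add l2_space_scaleC scaleC_add_right add_ac)
qed

lemma l2_op_scale_closed: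
  assumes T: "T \<in> l2_bounded_ops X"
  shows "(\<lambda>f\<in>l2_space X. \<lambda>k. c *\<^sub>C T f k) \<in> l2_bounded_ops X"
proof -
  obtain C where C: "\<And>f. f \<in> l2_space X \<Longrightarrow> l2_norm X (T f) \<le> C * l2_norm X f"
    using l2_bounded_ops_bound[OF T] by blast
  note T' = l2_bounded_opsD[OF T]
  show ?thesis
  proof (rule l2_bounded_opsI[where C = "cmod c * C"])
    fix f :: "'a \<Rightarrow> 'b" assume f: "f \<in> l2_space X"
    show "l2_norm X ((\<lambda>f\<in>l2_space X. \<lambda>k. c *\<^sub>C T f k) f) \<le> cmod c * C * l2_norm X f"
      using mult_left_mono[OF C[OF f], of "cmod c"] f by (simp add: l2_norm_scaleC mult.assoc)
  qed (simp_all add: T' l2_space_add l2_space_scaleC scaleC_add_right scaleC_scaleC mult.commute)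
qed

lemma l2_op_compose_closed:
  assumes S: "S \<in> l2_bounded_ops X" and T: "T \<in> l2_bounded_ops X"
  shows "compose (l2_space X) S T \<in> l2_bounded_ops X"
proof -
  obtain C where "0 < C" and C: "\<And>f. f \<in> l2_space X \<Longrightarrow> l2_norm X (S f) \<le> C * l2_norm X f"
    using l2_bounded_ops_bound[OF S] by blast
  obtain D where D: "\<And>f. f \<in> l2_space X \<Longrightarrow> l2_norm X (T f) \<le> D * l2_norm X f"
    using l2_bounded_ops_bound[OF T] by blast
  note ST = l2_bounded_opsD[OF S] l2_bounded_opsD[OF T]
  show ?thesis
  proof (rule l2_bounded_opsI[where C = "C * D"])
    fix f :: "'a \<Rightarrow> 'b" assume f: "f \<in> l2_space X"
    show "l2_norm X (compose (l2_space X) S T f) \<le> C * D * l2_norm X f"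
      using order_trans[OF C[OF ST(5)[OF f]] mult_left_mono[OF D[OF f], of C]] f \<open>0 < C\<close>
      by (simp add: compose_def mult.assoc)
  qed (simp_all add: ST l2_space_add l2_space_scaleC compose_def)
qed

lemma l2_op_one_closed: "(\<lambda>f\<in>l2_space X. f) \<in> l2_bounded_ops X"
  by (rule l2_bounded_opsI[where C = 1]) (simp_all add: l2_space_add l2_space_scaleC)

lemma l2_op_zero_closed: "(\<lambda>f\<in>l2_space X. \<lambda>k. 0) \<in> l2_bounded_ops X"
  by (rule l2_bounded_opsI[where C = 0]) (simp_all add: l2_space_add l2_space_scaleC l2_norm_def)

lemma l2_op_ring: "ring (l2_op_algebra X :: (('i \<Rightarrow> 'h::chilbert_space) \<Rightarrow> ('i \<Rightarrow> 'h)) calgebra)"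
  (is "ring ?L")
proof (rule ringI)
  show "abelian_group ?L"
  proof (rule abelian_groupI)
    fix T assume T: "T \<in> carrier ?L"
    show "\<exists>S\<in>carrier ?L. S \<oplus>\<^bsub>?L\<^esub> T = \<zero>\<^bsub>?L\<^esub>"
      by (rule bexI[of _ "\<lambda>f\<in>l2_space X. \<lambda>k. (-1) *\<^sub>C T f k"])
        (use T l2_op_scale_closed[of T X "-1"] in \<open>auto simp: fun_eq_iff scaleC_minus_left\<close>)
    show "\<zero>\<^bsub>?L\<^esub> \<oplus>\<^bsub>?L\<^esub> T = T"
      using T l2_bounded_opsD(4)[of T X] by (auto simp: fun_eq_iff extensional_def)
  qed (auto simp: l2_op_add_closed l2_op_zero_closed add_ac fun_eq_iff)
  show "monoid ?L"
  proof (rule monoidI)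
    fix R S T assume RST: "R \<in> carrier ?L" "S \<in> carrier ?L" "T \<in> carrier ?L"
    show "R \<otimes>\<^bsub>?L\<^esub> S \<otimes>\<^bsub>?L\<^esub> T = R \<otimes>\<^bsub>?L\<^esub> (S \<otimes>\<^bsub>?L\<^esub> T)"
      using RST l2_bounded_opsD(1)[of T X] by (auto simp: fun_eq_iff compose_def restrict_def)
  next
    fix T assume T: "T \<in> carrier ?L"
    show "\<one>\<^bsub>?L\<^esub> \<otimes>\<^bsub>?L\<^esub> T = T" "T \<otimes>\<^bsub>?L\<^esub> \<one>\<^bsub>?L\<^esub> = T"
      using T l2_bounded_opsD(1,4)[of T X] by (auto simp: fun_eq_iff compose_def restrict_def extensional_def)
  qed (auto simp: l2_op_compose_closed l2_op_one_closed)
  fix R S T assume RST: "R \<in> carrier ?L" "S \<in> carrier ?L" "T \<in> carrier ?L"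
  show "(R \<oplus>\<^bsub>?L\<^esub> S) \<otimes>\<^bsub>?L\<^esub> T = R \<otimes>\<^bsub>?L\<^esub> T \<oplus>\<^bsub>?L\<^esub> S \<otimes>\<^bsub>?L\<^esub> T"
    using RST l2_bounded_opsD(1)[of T X] by (auto simp: fun_eq_iff compose_def restrict_def)
  show "T \<otimes>\<^bsub>?L\<^esub> (R \<oplus>\<^bsub>?L\<^esub> S) = T \<otimes>\<^bsub>?L\<^esub> R \<oplus>\<^bsub>?L\<^esub> T \<otimes>\<^bsub>?L\<^esub> S"
    using RST l2_bounded_opsD(2)[of T X] l2_bounded_opsD(1)[of R X] l2_bounded_opsD(1)[of S X]
    by (auto simp: fun_eq_iff compose_def restrict_def)
qed

lemma l2_op_minus_eq:
  fixes S T :: "('i \<Rightarrow> 'h::chilbert_space) \<Rightarrow> ('i \<Rightarrow> 'h)"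
  assumes S: "S \<in> l2_bounded_ops X" and T: "T \<in> l2_bounded_ops X" and f: "f \<in> l2_space X"
  shows "(S \<ominus>\<^bsub>l2_op_algebra X\<^esub> T) f = (\<lambda>k. S f k - T f k)"
proof -
  interpret ring "l2_op_algebra X :: (('i \<Rightarrow> 'h) \<Rightarrow> ('i \<Rightarrow> 'h)) calgebra" by (rule l2_op_ring)
  have "\<ominus>\<^bsub>l2_op_algebra X\<^esub> T = (\<lambda>f\<in>l2_space X. \<lambda>k. (-1) *\<^sub>C T f k)"
    using T l2_op_scale_closed[OF T, of "-1"]
    by (intro minus_equality) (auto simp: fun_eq_iff scaleC_minus_left)
  then show ?thesis using f by (simp add: a_minus_def scaleC_minus_left)
qed

text \<open>A bound \<open>C\<close> for the left inverse becomes the lower bound 1 / C. This turns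
  statements about invertibility on \<open>l2_space\<close> into norm inequalities.\<close>

lemma l2_op_Units_bounded_below:
  assumes "T \<in> Units (l2_op_algebra X)"
  shows "\<exists>c>0. \<forall>f\<in>l2_space X. c * l2_norm X f \<le> l2_norm X (T f)"
proof -
  from assms obtain S where S: "S \<in> l2_bounded_ops X" and T: "T \<in> l2_bounded_ops X"
    and ST: "compose (l2_space X) S T = (\<lambda>f\<in>l2_space X. f)"
    by (auto simp: Units_def)
  obtain C where C: "0 < C" "\<And>f. f \<in> l2_space X \<Longrightarrow> l2_norm X (S f) \<le> C * l2_norm X f"
    using l2_bounded_ops_bound[OF S] by blast
  have "1 / C * l2_norm X f \<le> l2_norm X (T f)" if f: "f \<in> l2_space X" for f
  proof -
    have "S (T f) = f" using fun_cong[OF ST, of f] f by (simp add: compose_def)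
    then show ?thesis
      using C(2)[OF l2_bounded_opsD(1)[OF T f]] C(1) by (simp add: divide_le_eq mult.commute)
  qed
  then show ?thesis using C(1) by (intro exI[of _ "1 / C"]) simp
qed

text \<open>
  If \<open>\<lambda> = \<parallel>T\<parallel>\<close> exceeded the spectral radius, then \<open>T\<^sup>2 - \<lambda>\<^sup>2 = (T - \<lambda>)(T + \<lambda>)\<close> would be bounded below,
  whereas \<open>\<parallel>T\<^sup>2 f - \<lambda>\<^sup>2 f\<parallel>\<^sup>2 \<le> \<lambda>\<^sup>2 (\<lambda>\<^sup>2 \<parallel>f\<parallel>\<^sup>2 - \<parallel>T f\<parallel>\<^sup>2)\<close>.
\<close>

lemma selfadjoint_norm_le_spectral_bound:
  fixes T :: "('i \<Rightarrow> 'h::chilbert_space) \<Rightarrow> ('i \<Rightarrow> 'h)"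
  assumes T: "T \<in> l2_bounded_ops X"
    and sym: "\<And>f g. f \<in> l2_space X \<Longrightarrow> g \<in> l2_space X \<Longrightarrow> l2_inner X (T f) g = l2_inner X f (T g)"
    and r: "0 \<le> r" "\<And>z. z \<in> alg_spectrum (l2_op_algebra X) T \<Longrightarrow> cmod z \<le> r"
    and f: "f \<in> l2_space X"
  shows "l2_norm X (T f) \<le> r * l2_norm X f"
proof -
  let ?n = "l2_norm X :: ('i \<Rightarrow> 'h) \<Rightarrow> real"
  \<comment> \<open>The operator norm is taken as the infimum of all admissible bounds, and is
    itself one of them.\<close>
  define Q where "Q = {q. 0 \<le> q \<and> (\<forall>f\<in>l2_space X. ?n (T f) \<le> q * ?n f)}"
  define l where "l = Inf Q"
  obtain C where "0 < C" "\<And>f. f \<in> l2_space X \<Longrightarrow> ?n (T f) \<le> C * ?n f"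
    using l2_bounded_ops_bound[OF T] by blast
  then have ne: "C \<in> Q" by (auto simp: Q_def)
  have bdd: "bdd_below Q" by (rule bdd_belowI[where m = 0]) (auto simp: Q_def)
  have l_le: "l \<le> q" if "q \<in> Q" for q unfolding l_def by (rule cInf_lower[OF that bdd])
  have l0: "0 \<le> l" unfolding l_def using ne by (intro cInf_greatest) (auto simp: Q_def)
  have l: "?n (T f) \<le> l * ?n f" if f: "f \<in> l2_space X" for f
  proof (cases "?n f = 0")
    case True
    then show ?thesis using ne f by (force simp: Q_def)
  next
    case False
    then have "0 < ?n f" by (simp add: order_less_le)
    moreover have "?n (T f) / ?n f \<le> l"
      unfolding l_def using ne f \<open>0 < ?n f\<close>
      by (intro cInf_greatest) (auto simp: Q_def divide_le_eq)
    ultimately show ?thesis by (simp add: divide_le_eq)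
  qed
  have "l \<le> r"
  proof (rule ccontr)
    assume "\<not> l \<le> r"
    then have lr: "r < l" by simp
    \<comment> \<open>On the circle of radius \<open>l\<close>, outside the disc containing the
      spectrum, the resolvent exists. It is needed at the two points l and - l only.\<close>
    have below: "\<exists>c>0. \<forall>f\<in>l2_space X. c * ?n f \<le> ?n (\<lambda>k. z *\<^sub>C f k - T f k)" if "cmod z = l" for z
    proof -
      let ?U = "(z \<odot>\<^bsub>l2_op_algebra X\<^esub> \<one>\<^bsub>l2_op_algebra X\<^esub>) \<ominus>\<^bsub>l2_op_algebra X\<^esub> T"
      have "z \<notin> alg_spectrum (l2_op_algebra X) T" using r(2)[of z] that lr by auto
      then have "?U \<in> Units (l2_op_algebra X)" by (simp add: alg_spectrum_def)
      then obtain c where c: "0 < c" "\<And>f. f \<in> l2_space X \<Longrightarrow> c * ?n f \<le> ?n (?U f)"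
        using l2_op_Units_bounded_below by blast
      have "?U f = (\<lambda>k. z *\<^sub>C f k - T f k)" if "f \<in> l2_space X" for f
        using l2_op_minus_eq[OF l2_op_scale_closed[OF l2_op_one_closed, of z] T that] that
        by (simp cong: restrict_cong)
      then show ?thesis using c by (intro exI[of _ c]) simp
    qed
    obtain c1 where c1: "0 < c1" "\<And>f. f \<in> l2_space X \<Longrightarrow> c1 * ?n f \<le> ?n (\<lambda>k. of_real l *\<^sub>C f k - T f k)"
      using below[of "of_real l"] l0 by auto
    obtain c2 where c2: "0 < c2" "\<And>f. f \<in> l2_space X \<Longrightarrow> c2 * ?n f \<le> ?n (\<lambda>k. (- of_real l) *\<^sub>C f k - T f k)"
      using below[of "- of_real l"] l0 by auto
    define c where "c = c1 * c2"
    have c0: "0 < c" using c1 c2 by (simp add: c_def)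
    have lpos: "0 < l" using lr r(1) by simp
    \<comment> \<open>\<open>sqrt m\<close> will be an admissible bound smaller than
      \<open>l\<close>. The maximum with 0 keeps the radicand nonnegative.\<close>
    define m where "m = max 0 (l\<^sup>2 - c\<^sup>2 / l\<^sup>2)"
    have "?n (T f) \<le> sqrt m * ?n f" if f: "f \<in> l2_space X" for f
    proof -
      let ?g = "\<lambda>k. (- of_real l) *\<^sub>C f k - T f k"
      let ?lf = "\<lambda>k. (of_real (l\<^sup>2)) *\<^sub>C f k"
      note Tf = l2_bounded_opsD(1)[OF T f] and lf = l2_space_scaleC[OF f, of "of_real (l\<^sup>2)"]
      note TTf = l2_bounded_opsD(1)[OF T Tf]
      have g: "?g \<in> l2_space X" by (intro l2_space_diff l2_space_scaleC f Tf)
      have Tg: "T ?g = (\<lambda>k. (- of_real l) *\<^sub>C T f k - T (T f) k)"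
      proof -
        have "?g = (\<lambda>k. (- of_real l) *\<^sub>C f k + (-1) *\<^sub>C T f k)" by (simp add: scaleC_minus_left)
        then have "T ?g = (\<lambda>k. T (\<lambda>k. (- of_real l) *\<^sub>C f k) k + T (\<lambda>k. (-1) *\<^sub>C T f k) k)"
          using l2_bounded_opsD(2)[OF T l2_space_scaleC[OF f] l2_space_scaleC[OF Tf], of "- of_real l" "-1"]
          by (simp only:)
        then show ?thesis
          unfolding l2_bounded_opsD(3)[OF T f] l2_bounded_opsD(3)[OF T Tf]
          by (simp add: scaleC_minus_left)
      qed
      have ll: "(complex_of_real l * of_real l) *\<^sub>C x = (l * l) *\<^sub>R x" for x :: 'h
        by (simp flip: scaleC_of_real)
      \<comment> \<open>Factorisation of T^2 - l^2 as (l - T)(- l - T), so the two lower bounds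
        multiply.\<close>
      have "(\<lambda>k. of_real l *\<^sub>C ?g k - T ?g k) = (\<lambda>k. T (T f) k - ?lf k)"
        unfolding Tg
        by (simp add: fun_eq_iff scaleC_minus_left scaleC_minus_right scaleC_of_real scaleR_diff_right
            power2_eq_square ll)
      then have "c * ?n f \<le> ?n (\<lambda>k. T (T f) k - ?lf k)"
        using order_trans[OF mult_left_mono[OF c2(2)[OF f], of c1] c1(2)[OF g]] c1(1)
        by (simp add: c_def mult.assoc)
      then have "c\<^sup>2 * (?n f)\<^sup>2 \<le> (?n (\<lambda>k. T (T f) k - ?lf k))\<^sup>2"
        using c0 power_mono[of "c * ?n f" _ 2] by (simp add: power_mult_distrib)
      also have "\<dots> = (?n (T (T f)))\<^sup>2 - 2 * Re (l2_inner X (T (T f)) ?lf) + (?n ?lf)\<^sup>2"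
        by (rule l2_norm_diff_sq[OF TTf lf])
      also have "l2_inner X (T (T f)) ?lf = of_real (l\<^sup>2 * (?n (T f))\<^sup>2)"
        by (simp only: l2_inner_scaleC_right sym[OF Tf f] l2_inner_self[OF Tf]
              complex_cnj_complex_of_real of_real_mult)
      also have "?n ?lf = l\<^sup>2 * ?n f" by (simp add: l2_norm_scaleC norm_power)
      also have "(?n (T (T f)))\<^sup>2 \<le> (l * ?n (T f))\<^sup>2" by (intro power_mono l Tf) simp
      finally have "c\<^sup>2 * (?n f)\<^sup>2 \<le> l\<^sup>2 * (l\<^sup>2 * (?n f)\<^sup>2 - (?n (T f))\<^sup>2)"
        by (simp add: power_mult_distrib algebra_simps power2_eq_square)
      then have "c\<^sup>2 / l\<^sup>2 * (?n f)\<^sup>2 \<le> l\<^sup>2 * (?n f)\<^sup>2 - (?n (T f))\<^sup>2"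
        using lpos by (simp add: divide_le_eq mult.commute)
      then have "(?n (T f))\<^sup>2 \<le> (l\<^sup>2 - c\<^sup>2 / l\<^sup>2) * (?n f)\<^sup>2"
        by (simp add: left_diff_distrib)
      also have "\<dots> \<le> m * (?n f)\<^sup>2" by (intro mult_right_mono) (auto simp: m_def)
      also have "\<dots> = (sqrt m * ?n f)\<^sup>2" by (simp add: power_mult_distrib m_def)
      finally show ?thesis by (rule power2_le_imp_le) (simp add: m_def)
    qed
    then have "sqrt m \<in> Q" by (auto simp: Q_def m_def)
    then have "l \<le> sqrt m" by (rule l_le)
    moreover have "m < l\<^sup>2" using lpos c0 by (simp add: m_def)
    then have "sqrt m < l" using lpos real_sqrt_less_mono[of m "l\<^sup>2"] by simp
    ultimately show False by simp
  qed
  then show ?thesis using l[OF f] mult_right_mono[of l r "?n f"] by simp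
qed

section \<open>Spectral radius in \<open>\<B>\<^bsub>u,s\<^esub>\<close>\<close>

context bus_weight
begin

section \<open>The embedding into the bounded operators\<close>

lemma matrix_op_closed:
  assumes A: "A \<in> carrier Bus"
  shows "matrix_op X A \<in> l2_bounded_ops X"
proof (rule l2_bounded_opsI[where C = "snorm A"])
  show "matrix_op X A f = undefined" if "f \<notin> l2_space X" for f
    using that by (simp add: matrix_op_def)
qed (simp_all add: matrix_op_in_l2[OF Bus_D[OF A]] matrix_op_add[OF Bus_D[OF A]]
    matrix_op_scaleC[OF Bus_D[OF A]] matrix_op_norm_le[OF Bus_D[OF A]])

lemma matrix_op_hom:
  "matrix_op X \<in> ring_hom (Bus :: ('d, 'h::chilbert_space) op_matrix star_calgebra)
    (l2_op_algebra X)"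
proof (rule ring_hom_memI)
  fix A B :: "('d, 'h) op_matrix"
  assume A: "A \<in> carrier Bus"
  show "matrix_op X A \<in> carrier (l2_op_algebra X)" using matrix_op_closed[OF A] by simp
  assume B: "B \<in> carrier Bus"
  have "matrix_op X (mat_mult X A B) = compose (l2_space X) (matrix_op X A) (matrix_op X B)"
    by (rule l2_bounded_ops_ext[where X = X])
      (use A B in \<open>auto simp: matrix_op_closed mat_mult_in_Bus l2_op_compose_closed
        bus_matrix_op_mult compose_eq\<close>)
  then show "matrix_op X (A \<otimes>\<^bsub>Bus\<^esub> B) = matrix_op X A \<otimes>\<^bsub>l2_op_algebra X\<^esub> matrix_op X B"
    by simp
  have "matrix_op X (\<lambda>k l. A k l + B k l) = (\<lambda>f\<in>l2_space X. \<lambda>k. matrix_op X A f k + matrix_op X B f k)"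
    by (rule l2_bounded_ops_ext[where X = X])
      (use A B in \<open>auto simp: matrix_op_closed add_closed l2_op_add_closed bus_matrix_op_plus\<close>)
  then show "matrix_op X (A \<oplus>\<^bsub>Bus\<^esub> B) = matrix_op X A \<oplus>\<^bsub>l2_op_algebra X\<^esub> matrix_op X B"
    by simp
next
  have "matrix_op X (mat_one X :: ('d, 'h) op_matrix) = (\<lambda>f\<in>l2_space X. f)"
    by (rule l2_bounded_ops_ext[where X = X])
      (auto simp: matrix_op_closed one_closed l2_op_one_closed matrix_op_one)
  then show "matrix_op X (\<one>\<^bsub>Bus\<^esub> :: ('d, 'h) op_matrix) = \<one>\<^bsub>l2_op_algebra X\<^esub>"
    by simp
qed

lemma matrix_op_cscale:
  assumes A: "A \<in> carrier Bus"
  shows "matrix_op X (c \<odot>\<^bsub>Bus\<^esub> A) = c \<odot>\<^bsub>l2_op_algebra X\<^esub> matrix_op X A"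
  unfolding Bus_algebra_simps l2_op_algebra_simps
  by (rule l2_bounded_ops_ext[where X = X])
    (use A in \<open>auto simp: matrix_op_closed cscale_closed l2_op_scale_closed bus_matrix_op_cscale\<close>)

lemma matrix_op_subalgebra:
  "subalgebra_via (matrix_op X)
    (Bus :: ('d, 'h::chilbert_space) op_matrix star_calgebra) (l2_op_algebra X)"
  unfolding subalgebra_via_def
proof (intro conjI ballI allI inj_onI)
  fix A B :: "('d, 'h) op_matrix"
  assume "A \<in> carrier Bus" "B \<in> carrier Bus"
    and "matrix_op X A = matrix_op X B"
  then show "A = B" by (intro bus_matrix_op_inject) auto
qed (use matrix_op_hom matrix_op_cscale in auto)

lemma matrix_op_minus_apply:
  fixes A B :: "('d, 'h::chilbert_space) op_matrix"
  assumes A: "A \<in> carrier Bus" and B: "B \<in> carrier Bus"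
    and f: "f \<in> l2_space X"
  shows "matrix_op X (A \<ominus>\<^bsub>Bus\<^esub> B) f = (\<lambda>k. matrix_op X A f k - matrix_op X B f k)"
proof -
  have "scaleC_blinfun (- 1) T = - T" for T :: "'h \<Rightarrow>\<^sub>L 'h"
    by (rule blinfun_eqI) (simp add: scaleC_blinfun.rep_eq scaleC_minus_left blinfun.minus_left)
  then have "A \<ominus>\<^bsub>Bus\<^esub> B = (\<lambda>k l. A k l + scaleC_blinfun (- 1) (B k l))"
    by (simp add: bus_minus_eq[OF A B])
  then show ?thesis
    by (simp add: bus_matrix_op_plus[OF A cscale_closed[OF B] f] bus_matrix_op_cscale[OF B f]
        scaleC_minus_left)
qed

lemma matrix_op_minus:
  assumes A: "A \<in> carrier Bus" and B: "B \<in> carrier Bus"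
  shows "matrix_op X (A \<ominus>\<^bsub>Bus\<^esub> B) = matrix_op X A \<ominus>\<^bsub>l2_op_algebra X\<^esub> matrix_op X B"
proof (rule l2_bounded_ops_ext)
  show "matrix_op X (A \<ominus>\<^bsub>Bus\<^esub> B) \<in> l2_bounded_ops X"
    by (intro matrix_op_closed abelian_group.minus_closed[OF bus_abelian_group] A B)
  show "matrix_op X A \<ominus>\<^bsub>l2_op_algebra X\<^esub> matrix_op X B \<in> l2_bounded_ops X"
    using abelian_group.minus_closed[OF ring.is_abelian_group[OF l2_op_ring]]
      matrix_op_closed[OF A] matrix_op_closed[OF B] by auto
qed (simp add: matrix_op_minus_apply[OF A B] l2_op_minus_eq matrix_op_closed A B)

lemma matrix_op_Units:
  assumes "A \<in> Units Bus"
  shows "matrix_op X A \<in> Units (l2_op_algebra X)"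
proof -
  note hom = ring_hom_mult[OF matrix_op_hom] ring_hom_one[OF matrix_op_hom] ring_hom_closed[OF matrix_op_hom]
  obtain B where AB: "A \<in> carrier Bus" "B \<in> carrier Bus"
    "B \<otimes>\<^bsub>Bus\<^esub> A = \<one>\<^bsub>Bus\<^esub>"
    "A \<otimes>\<^bsub>Bus\<^esub> B = \<one>\<^bsub>Bus\<^esub>"
    using assms unfolding Units_def by blast
  have "matrix_op X B \<otimes>\<^bsub>l2_op_algebra X\<^esub> matrix_op X A = \<one>\<^bsub>l2_op_algebra X\<^esub>"
    "matrix_op X A \<otimes>\<^bsub>l2_op_algebra X\<^esub> matrix_op X B = \<one>\<^bsub>l2_op_algebra X\<^esub>"
    unfolding hom(1)[OF AB(2,1), symmetric] hom(1)[OF AB(1,2), symmetric] AB(3,4) hom(2) by (rule refl)+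
  then show ?thesis using hom(3)[OF AB(1)] hom(3)[OF AB(2)] unfolding Units_def by blast
qed

lemma scalar_one_closed:
  "z \<odot>\<^bsub>Bus\<^esub> (\<one>\<^bsub>Bus\<^esub> :: ('d, 'h::chilbert_space) op_matrix) \<in> carrier Bus"
  using cscale_closed[OF one_closed, of z] by simp

lemma matrix_op_resolvent:
  fixes A :: "('d, 'h::chilbert_space) op_matrix"
  assumes A: "A \<in> carrier Bus"
  shows "matrix_op X ((z \<odot>\<^bsub>Bus\<^esub> \<one>\<^bsub>Bus\<^esub>) \<ominus>\<^bsub>Bus\<^esub> A) =
    (z \<odot>\<^bsub>l2_op_algebra X\<^esub> \<one>\<^bsub>l2_op_algebra X\<^esub>) \<ominus>\<^bsub>l2_op_algebra X\<^esub> matrix_op X A"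
proof -
  have one: "(\<one>\<^bsub>Bus\<^esub> :: ('d, 'h) op_matrix) \<in> carrier Bus"
    using one_closed by simp
  show ?thesis
    unfolding matrix_op_minus[OF scalar_one_closed A] matrix_op_cscale[OF one]
      ring_hom_one[OF matrix_op_hom] ..
qed

lemma alg_spectrum_matrix_op_subset:
  assumes A: "A \<in> carrier Bus"
  shows "alg_spectrum (l2_op_algebra X) (matrix_op X A) \<subseteq> alg_spectrum Bus A"
proof
  fix z assume z: "z \<in> alg_spectrum (l2_op_algebra X) (matrix_op X A)"
  show "z \<in> alg_spectrum Bus A"
  proof (rule ccontr)
    assume "z \<notin> alg_spectrum Bus A"
    then have "(z \<odot>\<^bsub>Bus\<^esub> \<one>\<^bsub>Bus\<^esub>) \<ominus>\<^bsub>Bus\<^esub> A \<in> Units Bus"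
      unfolding alg_spectrum_def by blast
    then have "matrix_op X ((z \<odot>\<^bsub>Bus\<^esub> \<one>\<^bsub>Bus\<^esub>) \<ominus>\<^bsub>Bus\<^esub> A)
        \<in> Units (l2_op_algebra X)"
      by (rule matrix_op_Units)
    then have "(z \<odot>\<^bsub>l2_op_algebra X\<^esub> \<one>\<^bsub>l2_op_algebra X\<^esub>) \<ominus>\<^bsub>l2_op_algebra X\<^esub> matrix_op X A
        \<in> Units (l2_op_algebra X)"
      unfolding matrix_op_resolvent[OF A] .
    then show False using z unfolding alg_spectrum_def by blast
  qed
qed

section \<open>Powers in the algebra norm and as operators\<close>

lemma bus_pow_closed:
  assumes A: "A \<in> carrier Bus"
  shows "A [^]\<^bsub>Bus\<^esub> (n::nat) \<in> carrier Bus"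
  by (rule monoid.nat_pow_closed[OF ring.is_monoid[OF bus_ring] A])

text \<open>The norm of the unit has to stay as a factor because it may exceed 1; it is the value at
  \<open>n = 0\<close>.\<close>

lemma anorm_pow_le:
  fixes A :: "('d, 'h::chilbert_space) op_matrix"
  assumes A: "A \<in> carrier Bus"
  shows "anorm Bus (A [^]\<^bsub>Bus\<^esub> (n::nat)) \<le>
    anorm Bus (\<one>\<^bsub>Bus\<^esub> :: ('d, 'h) op_matrix) * anorm Bus A ^ n"
proof (induction n)
  case (Suc n)
  let ?R = "Bus :: ('d, 'h) op_matrix star_calgebra"
  have "anorm ?R (A [^]\<^bsub>?R\<^esub> Suc n) \<le> anorm ?R (A [^]\<^bsub>?R\<^esub> n) * anorm ?R A"
    using anorm_mult_le[OF bus_pow_closed[OF A, of n] A] by simp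
  also have "\<dots> \<le> (anorm ?R \<one>\<^bsub>?R\<^esub> * anorm ?R A ^ n) * anorm ?R A"
    by (intro mult_right_mono Suc) (simp add: anorm_eq)
  finally show ?case by (simp add: mult_ac)
qed simp

lemma matrix_op_pow_bound:
  assumes A: "A \<in> carrier Bus" and "0 \<le> q"
    and q: "\<And>f. f \<in> l2_space X \<Longrightarrow> l2_norm X (matrix_op X A f) \<le> q * l2_norm X f"
    and f: "f \<in> l2_space X"
  shows "l2_norm X (matrix_op X (A [^]\<^bsub>Bus\<^esub> (n::nat)) f) \<le> q ^ n * l2_norm X f"
  using f
proof (induction n arbitrary: f)
  case 0
  then show ?case by (simp add: matrix_op_one)
next
  case (Suc n)
  have Af: "matrix_op X A f \<in> l2_space X" by (rule bus_matrix_op_in_l2[OF A Suc.prems])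
  have "matrix_op X (A [^]\<^bsub>Bus\<^esub> Suc n) f = matrix_op X (A [^]\<^bsub>Bus\<^esub> n) (matrix_op X A f)"
    using bus_matrix_op_mult[OF bus_pow_closed[OF A] A Suc.prems] by simp
  then have "l2_norm X (matrix_op X (A [^]\<^bsub>Bus\<^esub> Suc n) f) \<le> q ^ n * l2_norm X (matrix_op X A f)"
    using Suc.IH[OF Af] by simp
  also have "\<dots> \<le> q ^ n * (q * l2_norm X f)" using \<open>0 \<le> q\<close> by (intro mult_left_mono q Suc.prems) auto
  finally show ?case by (simp add: mult_ac)
qed

end

text \<open>
  The Schur and Jaffard norms for the weight \<open>w\<close> are controlled by splitting each row into entries near
  the diagonal, of which there are polynomially many and each is at most the operator norm, and the rest.
\<close>

lemma shifted_anorm_le: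
  fixes X :: "(real ^ 'd) set" and s \<delta> :: real
  assumes X: "relatively_separated X" and u: "bus_weight u s" and "0 < \<delta>"
    and ge: "\<And>x. poly_weight \<delta> x \<le> u x"
  obtains C where "0 < C" and "\<And>w \<sigma> A q. bus_weight w s \<Longrightarrow> 0 \<le> \<sigma> \<Longrightarrow>
      (\<And>x. w x \<le> 2 \<and> u x \<le> exp \<sigma> \<or> w x \<le> 2 * exp (- \<sigma>) * u x) \<Longrightarrow>
      (A :: ('d, 'h::chilbert_space) op_matrix) \<in> carrier (Bus_algebra X u s) \<Longrightarrow> 0 \<le> q \<Longrightarrow>
      (\<And>f. f \<in> l2_space X \<Longrightarrow> l2_norm X (matrix_op X A f) \<le> q * l2_norm X f) \<Longrightarrow>
      A \<in> carrier (Bus_algebra X w s) \<and>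
      anorm (Bus_algebra X w s) A \<le>
        C * (exp (\<sigma> / \<delta>) powr (real CARD('d) + s) * q + exp (- \<sigma>) * anorm (Bus_algebra X u s) A)"
proof -
  interpret u: bus_weight u X s by (rule u)
  obtain M :: real where "0 < M" and M: "\<And>k r F. 0 \<le> r \<Longrightarrow> finite F \<Longrightarrow> F \<subseteq> X \<Longrightarrow>
      (\<And>l. l \<in> F \<Longrightarrow> norm (l - k) \<le> r) \<Longrightarrow> real (card F) \<le> M * (1 + r) ^ CARD('d)"
    using relatively_separated_card_le[OF X] by blast
  show ?thesis
  \<comment> \<open>The first summand comes from counting near entries in the Schur norm, the second
    from the near entries in the Jaffard norm and from the factor 2 of the far ones. None of it
    involves \<open>w\<close> or \<sigma>.\<close>
  proof (rule that[of "2 powr s * 2 * M + 2"])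
    fix w \<sigma> q and A :: "('d, 'h) op_matrix"
    assume w: "bus_weight w s" and "0 \<le> \<sigma>"
      and dich: "\<And>x. w x \<le> 2 \<and> u x \<le> exp \<sigma> \<or> w x \<le> 2 * exp (- \<sigma>) * u x"
      and A: "A \<in> carrier (Bus_algebra X u s)" and "0 \<le> q"
      and q: "\<And>f. f \<in> l2_space X \<Longrightarrow> l2_norm X (matrix_op X A f) \<le> q * l2_norm X f"
    interpret w: bus_weight w X s by (rule w)
    have entry: "norm (A k l) \<le> q" for k l
      by (rule norm_entry_le_op_bound[OF u.Bus_D[OF A] q \<open>0 \<le> q\<close>])
    define L where "L = exp (\<sigma> / \<delta>)"
    define e where "e = 2 * exp (- \<sigma>)"
    have L1: "1 \<le> L" using \<open>0 \<le> \<sigma>\<close> \<open>0 < \<delta>\<close> by (simp add: L_def)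
    have e0: "0 \<le> e" by (simp add: e_def)
    \<comment> \<open>The polynomial lower bound puts the sublevel set of \<open>u\<close> inside a
      Euclidean ball of radius L - 1, where points of \<open>X\<close> can be counted.\<close>
    have near: "1 + norm x \<le> L" if "u x \<le> exp \<sigma>" for x
    proof -
      have "(1 + norm x) powr \<delta> \<le> exp \<sigma>" using ge[of x] that by (simp add: poly_weight_def)
      also have "\<dots> = L powr \<delta>" using \<open>0 < \<delta>\<close> by (simp add: L_def powr_def)
      finally have "(1 + norm x) powr \<delta> \<le> L powr \<delta>" .
      then show ?thesis
        using powr_less_mono2[OF \<open>0 < \<delta>\<close>, of L "1 + norm x"] L1 by (cases "1 + norm x \<le> L") auto
    qed
    let ?near = "\<lambda>x. u x \<le> exp \<sigma>"
    \<comment> \<open>Near the diagonal the entry is at most \<open>q\<close> and the weight at most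
      2; elsewhere \<open>w\<close> is a small multiple of \<open>u\<close>, and the full norm of
      \<open>A\<close> pays for it.\<close>
    have ptw: "norm (A k l) * w (k - l) \<le> (if ?near (k - l) then 2 * q else 0) + e * (norm (A k l) * u (k - l))"
      for k l
    proof (cases "w (k - l) \<le> 2 \<and> ?near (k - l)")
      case True
      then have "norm (A k l) * w (k - l) \<le> q * 2" using entry \<open>0 \<le> q\<close> by (intro mult_mono) auto
      moreover have "0 \<le> e * (norm (A k l) * u (k - l))" using e0 by simp
      ultimately show ?thesis using True by simp
    next
      case False
      then have "w (k - l) \<le> e * u (k - l)" using dich[of "k - l"] by (auto simp: e_def)
      then have "norm (A k l) * w (k - l) \<le> norm (A k l) * (e * u (k - l))"
        by (rule mult_left_mono) simp
      then show ?thesis using \<open>0 \<le> q\<close> by (simp add: mult_ac)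
    qed
    have count: "(\<Sum>l\<in>F. if ?near (k - l) then 2 * q else 0) \<le> 2 * q * (M * L ^ CARD('d))"
      if F: "finite F" "F \<subseteq> X" for k F
    proof -
      have "(\<Sum>l\<in>F. if ?near (k - l) then 2 * q else 0) = 2 * q * real (card {l \<in> F. ?near (k - l)})"
        using F by (simp add: sum.inter_filter[symmetric] mult.commute)
      also have "real (card {l \<in> F. ?near (k - l)}) \<le> M * (1 + (L - 1)) ^ CARD('d)"
      proof (rule M)
        show "norm (l - k) \<le> L - 1" if "l \<in> {l \<in> F. ?near (k - l)}" for l
          using near[of "k - l"] that by (simp add: norm_minus_commute)
      qed (use F L1 in auto)
      finally show ?thesis using \<open>0 \<le> q\<close> by (simp add: mult_left_mono)
    qed
    have sym: "u (l - k) = u (k - l)" for k l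
      using u.w_minus[of "k - l"] by simp
    have count': "(\<Sum>l\<in>F. if ?near (l - k) then 2 * q else 0) \<le> 2 * q * (M * L ^ CARD('d))"
      if F: "finite F" "F \<subseteq> X" for k F
      using count[OF F, of k] by (simp only: sym[of _ k])
    let ?C = "2 * q * (M * L ^ CARD('d)) + e * u.snorm A"
    have S: "row_col_le X (\<lambda>k l. norm (A k l) * w (k - l)) ?C"
    proof (rule row_col_le_mono[OF row_col_le_add])
      show "row_col_le X (\<lambda>k l. if ?near (k - l) then 2 * q else 0) (2 * q * (M * L ^ CARD('d)))"
        using count count' by (auto simp: row_col_le_def)
      show "row_col_le X (\<lambda>k l. e * (norm (A k l) * u (k - l))) (e * u.snorm A)"
        using u.Bus_row_col_le[OF A] e0
        by (auto simp: row_col_le_def sum_distrib_left[symmetric] intro!: mult_left_mono)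
    qed (use ptw in auto)
    let ?D = "2 * q * L powr s + e * u.jnorm A"
    have J: "norm (A k l) * (w (k - l) * poly_weight s (k - l)) \<le> ?D" if kl: "k \<in> X" "l \<in> X" for k l
    proof -
      let ?p = "poly_weight s (k - l)"
      have p0: "0 \<le> ?p" by (simp add: poly_weight_def)
      have "norm (A k l) * (w (k - l) * ?p) \<le>
          ((if ?near (k - l) then 2 * q else 0) + e * (norm (A k l) * u (k - l))) * ?p"
        using mult_right_mono[OF ptw p0, of k l] by (simp add: mult.assoc)
      also have "\<dots> = (if ?near (k - l) then 2 * q else 0) * ?p + e * (norm (A k l) * (u (k - l) * ?p))"
        by (simp add: algebra_simps)
      also have "\<dots> \<le> ?D"
      proof (rule add_mono)
        show "(if ?near (k - l) then 2 * q else 0) * ?p \<le> 2 * q * L powr s"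
          using near[of "k - l"] \<open>0 \<le> q\<close> u.s_nonneg
          by (auto simp: poly_weight_def intro!: mult_left_mono powr_mono2)
        show "e * (norm (A k l) * (u (k - l) * ?p)) \<le> e * u.jnorm A"
          using u.Bus_jaffard_le[OF A kl] e0 by (rule mult_left_mono)
      qed
      finally show ?thesis .
    qed
    have C0: "0 \<le> ?C" and D0: "0 \<le> ?D" using \<open>0 \<le> q\<close> \<open>0 < M\<close> L1 e0 by auto
    let ?N = "anorm (Bus_algebra X u s) A" and ?P = "L powr (real CARD('d) + s)"
    have "anorm (Bus_algebra X w s) A \<le> 2 powr s * ?C + ?D"
      by (rule w.anorm_le[OF u.Bus_op_matrices[OF A] S C0 J D0])
    also have "\<dots> = 2 powr s * 2 * M * (L ^ CARD('d) * q) + 2 * (L powr s * q) + e * ?N"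
      by (simp add: u.anorm_eq algebra_simps)
    also have "\<dots> \<le> 2 powr s * 2 * M * (?P * q) + 2 * (?P * q) + e * ?N"
    proof -
      have "L ^ CARD('d) = L powr CARD('d)" using L1 by (simp add: powr_realpow)
      also have "\<dots> \<le> ?P" using L1 u.s_nonneg by (intro powr_mono) auto
      finally have "L ^ CARD('d) * q \<le> ?P * q" using \<open>0 \<le> q\<close> by (rule mult_right_mono)
      moreover have "L powr s \<le> ?P" using L1 by (intro powr_mono) auto
      then have "L powr s * q \<le> ?P * q" using \<open>0 \<le> q\<close> by (rule mult_right_mono)
      ultimately show ?thesis using \<open>0 < M\<close> e0 by (intro add_mono mult_left_mono) auto
    qed
    also have "\<dots> \<le> (2 powr s * 2 * M + 2) * (?P * q + exp (- \<sigma>) * ?N)"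
    proof -
      have "0 \<le> 2 powr s * 2 * M * (exp (- \<sigma>) * ?N)"
        using \<open>0 < M\<close> by (simp add: u.anorm_eq)
      then show ?thesis by (simp add: e_def algebra_simps)
    qed
    finally show "A \<in> carrier (Bus_algebra X w s) \<and> anorm (Bus_algebra X w s) A \<le>
        (2 powr s * 2 * M + 2) * (exp (\<sigma> / \<delta>) powr (real CARD('d) + s) * q + exp (- \<sigma>) * ?N)"
      using w.Bus_carrierI[OF u.Bus_op_matrices[OF A] S C0 J D0] by (simp add: L_def)
  qed (use \<open>0 < M\<close> in \<open>simp add: add_pos_pos\<close>)
qed

text \<open>Brings an estimate in a shifted norm back to the original one, at the cost of a single
  factor \<open>K\<close>.\<close>

lemma anorm_le_equivalent:
  fixes X :: "(real ^ 'd) set" and A :: "('d, 'h::chilbert_space) op_matrix"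
  assumes "bus_weight u s" "bus_weight w s" and K: "0 < K" "\<And>x. u x \<le> K * w x"
    and A: "A \<in> carrier (Bus_algebra X w s)"
  shows "anorm (Bus_algebra X u s) A \<le> K * anorm (Bus_algebra X w s) A"
proof -
  interpret u: bus_weight u X s by fact
  interpret w: bus_weight w X s by fact
  have S: "row_col_le X (\<lambda>k l. norm (A k l) * u (k - l)) (K * w.snorm A)"
  proof (rule row_col_le_mono)
    show "row_col_le X (\<lambda>k l. K * (norm (A k l) * w (k - l))) (K * w.snorm A)"
      using w.Bus_row_col_le[OF A] K(1)
      by (auto simp: row_col_le_def sum_distrib_left[symmetric] intro!: mult_left_mono)
    show "norm (A k l) * u (k - l) \<le> K * (norm (A k l) * w (k - l))" for k l
      using mult_left_mono[OF K(2), of "norm (A k l)" "k - l"] by (simp add: mult_ac)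
  qed simp
  have J: "norm (A k l) * (u (k - l) * poly_weight s (k - l)) \<le> K * w.jnorm A" if "k \<in> X" "l \<in> X" for k l
  proof -
    have "norm (A k l) * (u (k - l) * poly_weight s (k - l)) \<le>
        norm (A k l) * ((K * w (k - l)) * poly_weight s (k - l))"
      by (intro mult_left_mono mult_right_mono K(2)) (auto simp: poly_weight_def)
    also have "\<dots> \<le> K * w.jnorm A"
      using mult_left_mono[OF w.Bus_jaffard_le[OF A that], of K] K(1) by (simp add: mult_ac)
    finally show ?thesis .
  qed
  have "anorm (Bus_algebra X u s) A \<le> 2 powr s * (K * w.snorm A) + K * w.jnorm A"
    by (rule u.anorm_le[OF w.Bus_op_matrices[OF A] S _ J]) (use K in auto)
  then show ?thesis by (simp add: w.anorm_eq algebra_simps)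
qed

text \<open>Product and unit do not involve the weight, so the same powers can be measured in
  different norms.\<close>

lemma Bus_algebra_pow_eq:
  "A [^]\<^bsub>Bus_algebra X w s\<^esub> (n::nat) = A [^]\<^bsub>Bus_algebra X u s\<^esub> n"
  by (induction n) simp_all

lemma (in unital_complex_algebra) cscale_Units:
  assumes x: "x \<in> Units R" and "z \<noteq> 0"
  shows "z \<odot> x \<in> Units R"
proof -
  obtain y where y: "x \<in> carrier R" "y \<in> carrier R" "y \<otimes> x = \<one>" "x \<otimes> y = \<one>"
    using x unfolding Units_def by blast
  have "(inverse z \<odot> y) \<otimes> (z \<odot> x) = \<one>" "(z \<odot> x) \<otimes> (inverse z \<odot> y) = \<one>"
    using y \<open>z \<noteq> 0\<close>
    by (simp_all add: cscale_mult_left cscale_mult_right cscale_closed cscale_cscale cscale_one)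
  then show ?thesis using y cscale_closed unfolding Units_def by blast
qed

lemma (in monoid) Units_if_left_right_inverse:
  assumes "x \<in> carrier G" "y \<in> carrier G" "z \<in> carrier G" "y \<otimes> x = \<one>" "x \<otimes> z = \<one>"
  shows "x \<in> Units G" and "inv x = y"
proof -
  have "y = z" using assms inv_unique by blast
  then show "x \<in> Units G" using assms unfolding Units_def by blast
  then show "inv x = y" using assms \<open>y = z\<close> by (metis inv_char)
qed

section \<open>Growth of powers and location of spectra for admissible weights\<close>

locale bus_admissible =
  fixes X :: "(real ^ 'd) set" and u :: "real ^ 'd \<Rightarrow> real" and \<delta> s :: real
  assumes separated: "relatively_separated X" and admissible: "admissible_weight u"
    and \<delta>_pos: "0 < \<delta>" and s_pos: "0 < s" and u_ge: "poly_weight \<delta> x \<le> u x"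

sublocale bus_admissible \<subseteq> bus_weight u X s
  using admissible_weight_bus_weight[OF admissible, of s] s_pos by simp

context bus_admissible
begin

text \<open>Any rate above the operator bound controls the powers in the algebra norm. Stated with a
  geometric bound instead of a limit of roots, it feeds directly into the Neumann series.\<close>

lemma anorm_pow_growth:
  fixes A :: "('d, 'h::chilbert_space) op_matrix"
  assumes A: "A \<in> carrier Bus" and "0 < q"
    and q: "\<And>f. f \<in> l2_space X \<Longrightarrow> l2_norm X (matrix_op X A f) \<le> q * l2_norm X f"
    and "q < g"
  shows "\<exists>K\<ge>0. \<forall>n::nat. anorm Bus (A [^]\<^bsub>Bus\<^esub> n) \<le> K * g ^ n"
proof -
  let ?R = "Bus :: ('d, 'h) op_matrix star_calgebra"
  interpret R: ring ?R by (rule bus_ring)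
  obtain C where "0 < C" and C: "\<And>w \<sigma> B q. bus_weight w s \<Longrightarrow> 0 \<le> \<sigma> \<Longrightarrow>
      (\<And>x. w x \<le> 2 \<and> u x \<le> exp \<sigma> \<or> w x \<le> 2 * exp (- \<sigma>) * u x) \<Longrightarrow>
      (B :: ('d, 'h) op_matrix) \<in> carrier ?R \<Longrightarrow> 0 \<le> q \<Longrightarrow>
      (\<And>f. f \<in> l2_space X \<Longrightarrow> l2_norm X (matrix_op X B f) \<le> q * l2_norm X f) \<Longrightarrow>
      B \<in> carrier (Bus_algebra X w s) \<and> anorm (Bus_algebra X w s) B \<le>
        C * (exp (\<sigma> / \<delta>) powr (real CARD('d) + s) * q + exp (- \<sigma>) * anorm ?R B)"
    using shifted_anorm_le[OF separated bus_weight_axioms \<delta>_pos u_ge, where 'h = 'h] by blast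
  show ?thesis
  proof (rule submultiplicative_growth[where C = C and p = "real CARD('d) + s" and \<delta> = \<delta> and q = q])
    show "0 \<le> anorm ?R (A [^]\<^bsub>?R\<^esub> n)" for n :: nat by (simp add: anorm_eq)
    show "anorm ?R (A [^]\<^bsub>?R\<^esub> (m + n)) \<le> anorm ?R (A [^]\<^bsub>?R\<^esub> m) * anorm ?R (A [^]\<^bsub>?R\<^esub> n)"
      for m n :: nat
      using anorm_mult_le[OF bus_pow_closed[OF A] bus_pow_closed[OF A], of m n]
      unfolding R.nat_pow_mult[OF A, symmetric] by simp
    fix m :: nat and L :: real
    assume L: "1 \<le> L"
    \<comment> \<open>Makes \<open>L\<close> the size of the near region and exp (- \<sigma>) the
      gain \<open>L powr (- \<delta>)\<close> outside it.\<close>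
    define \<sigma> where "\<sigma> = \<delta> * ln L"
    have \<sigma>: "0 \<le> \<sigma>" "exp (\<sigma> / \<delta>) = L" "exp (- \<sigma>) = L powr (- \<delta>)"
      using L \<delta>_pos by (simp_all add: \<sigma>_def powr_def)
    obtain w K where w: "bus_weight w s" "0 < K" "\<And>x. u x \<le> K * w x"
      "\<And>x. w x \<le> 2 \<and> u x \<le> exp \<sigma> \<or> w x \<le> 2 * exp (- \<sigma>) * u x"
      using admissible_weight_shift[OF admissible \<delta>_pos u_ge \<sigma>(1) less_imp_le[OF s_pos]] by metis
    interpret w: bus_weight w X s by (rule w(1))
    let ?W = "Bus_algebra X w s :: ('d, 'h) op_matrix star_calgebra"
    let ?B = "A [^]\<^bsub>?R\<^esub> m"
    let ?G = "C * (L powr (real CARD('d) + s) * q ^ m + L powr (- \<delta>) * anorm ?R ?B)"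
    have B: "?B \<in> carrier ?W" "anorm ?W ?B \<le> ?G"
      using C[OF w(1) \<sigma>(1) w(4) bus_pow_closed[OF A, of m] zero_le_power[OF less_imp_le[OF \<open>0 < q\<close>], of m]
          matrix_op_pow_bound[OF A less_imp_le[OF \<open>0 < q\<close>] q]] \<sigma>
      by auto
    have "anorm ?R (A [^]\<^bsub>?R\<^esub> (m * n)) \<le> (K * anorm ?W \<one>\<^bsub>?W\<^esub>) * ?G ^ n" for n
    proof -
      have "A [^]\<^bsub>?R\<^esub> (m * n) = ?B [^]\<^bsub>?W\<^esub> n"
        using R.nat_pow_pow[OF A, of m n] Bus_algebra_pow_eq[where w = w and u = u and A = ?B]
        by simp
      \<comment> \<open>The detour through \<open>?W\<close>: the constants \<open>K\<close> and the
        norm of the unit are paid once, while the power \<open>n\<close> falls on the improved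
        estimate of \<open>?B\<close>.\<close>
      then have "anorm ?R (A [^]\<^bsub>?R\<^esub> (m * n)) \<le> K * anorm ?W (?B [^]\<^bsub>?W\<^esub> n)"
        using anorm_le_equivalent[OF bus_weight_axioms w(1,2,3) w.bus_pow_closed[OF B(1)]] by simp
      also have "\<dots> \<le> K * (anorm ?W \<one>\<^bsub>?W\<^esub> * anorm ?W ?B ^ n)"
        using w(2) by (intro mult_left_mono w.anorm_pow_le B) auto
      also have "\<dots> \<le> K * (anorm ?W \<one>\<^bsub>?W\<^esub> * ?G ^ n)"
        using w(2) by (intro mult_left_mono power_mono B) (auto simp: w.anorm_eq)
      finally show ?thesis by (simp add: mult.assoc)
    qed
    moreover have "0 \<le> K * anorm ?W \<one>\<^bsub>?W\<^esub>" using w(2) by (simp add: w.anorm_eq)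
    ultimately show "\<exists>K\<ge>0. \<forall>n. anorm ?R (A [^]\<^bsub>?R\<^esub> (m * n)) \<le> K * ?G ^ n" by blast
  qed (use \<open>0 < C\<close> \<open>0 < q\<close> \<open>q < g\<close> \<delta>_pos s_pos in \<open>auto simp: add_pos_pos\<close>)
qed

lemma one_minus_Units:
  fixes A :: "('d, 'h::chilbert_space) op_matrix"
  assumes A: "A \<in> carrier Bus" and "q < 1"
    and q: "\<And>f. f \<in> l2_space X \<Longrightarrow> l2_norm X (matrix_op X A f) \<le> q * l2_norm X f"
  shows "\<one>\<^bsub>Bus\<^esub> \<ominus>\<^bsub>Bus\<^esub> A \<in> Units Bus"
proof -
  let ?R = "Bus :: ('d, 'h) op_matrix star_calgebra"
  interpret R: unital_banach_star_algebra ?R by (rule bus_unital_banach_star_algebra)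
  \<comment> \<open>The growth estimate asks for a positive bound, whereas \<open>q\<close> may be 0
    or negative.\<close>
  define q' where "q' = max q (1 / 2)"
  have q': "0 < q'" "q' < 1" using \<open>q < 1\<close> by (auto simp: q'_def)
  then obtain g where g: "q' < g" "g < 1" using dense by blast
  have "l2_norm X (matrix_op X A f) \<le> q' * l2_norm X f" if "f \<in> l2_space X" for f
    using q[OF that] mult_right_mono[of q q' "l2_norm X f"] by (simp add: q'_def)
  then obtain K where K: "\<And>n::nat. anorm ?R (A [^]\<^bsub>?R\<^esub> n) \<le> K * g ^ n"
    using anorm_pow_growth[OF A q'(1) _ g(1)] by blast
  have "summable (\<lambda>n::nat. anorm ?R (A [^]\<^bsub>?R\<^esub> n))"
  proof (rule summable_comparison_test')
    show "summable (\<lambda>n. K * g ^ n)" using g q' by (intro summable_mult summable_geometric) auto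
    show "norm (anorm ?R (A [^]\<^bsub>?R\<^esub> n)) \<le> K * g ^ n" for n using K[of n] by (simp add: anorm_eq)
  qed
  then show ?thesis by (rule R.one_minus_in_Units[OF A])
qed

text \<open>For larger \<open>z\<close> write z - A = z (1 - A / z), where A / z has operator bound
  below 1.\<close>

lemma alg_spectrum_norm_le:
  fixes A :: "('d, 'h::chilbert_space) op_matrix"
  assumes A: "A \<in> carrier Bus" and "0 \<le> q"
    and q: "\<And>f. f \<in> l2_space X \<Longrightarrow> l2_norm X (matrix_op X A f) \<le> q * l2_norm X f"
    and z: "z \<in> alg_spectrum Bus A"
  shows "cmod z \<le> q"
proof (rule ccontr)
  let ?R = "Bus :: ('d, 'h) op_matrix star_calgebra"
  interpret R: unital_banach_star_algebra ?R by (rule bus_unital_banach_star_algebra)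
  assume "\<not> cmod z \<le> q"
  then have zq: "q < cmod z" by simp
  then have "z \<noteq> 0" using \<open>0 \<le> q\<close> by auto
  define B where "B = inverse z \<odot>\<^bsub>?R\<^esub> A"
  have B: "B \<in> carrier ?R" unfolding B_def by (rule R.cscale_closed[OF A])
  have "\<one>\<^bsub>?R\<^esub> \<ominus>\<^bsub>?R\<^esub> B \<in> Units ?R"
  proof (rule one_minus_Units[OF B])
    show "q / cmod z < 1" using zq \<open>0 \<le> q\<close> by (simp add: divide_less_eq)
    fix f :: "real ^ 'd \<Rightarrow> 'h" assume f: "f \<in> l2_space X"
    have "l2_norm X (matrix_op X B f) = l2_norm X (matrix_op X A f) / cmod z"
      by (simp add: B_def bus_matrix_op_cscale[OF A f] l2_norm_scaleC norm_inverse divide_inverse mult.commute)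
    also have "\<dots> \<le> q * l2_norm X f / cmod z" by (intro divide_right_mono q f) simp
    finally show "l2_norm X (matrix_op X B f) \<le> q / cmod z * l2_norm X f" by simp
  qed
  then have "z \<odot>\<^bsub>?R\<^esub> (\<one>\<^bsub>?R\<^esub> \<ominus>\<^bsub>?R\<^esub> B) \<in> Units ?R" using \<open>z \<noteq> 0\<close> by (rule R.cscale_Units)
  moreover have "z \<odot>\<^bsub>?R\<^esub> (\<one>\<^bsub>?R\<^esub> \<ominus>\<^bsub>?R\<^esub> B) = (z \<odot>\<^bsub>?R\<^esub> \<one>\<^bsub>?R\<^esub>) \<ominus>\<^bsub>?R\<^esub> A"
    using bus_minus_eq[OF R.one_closed B] bus_minus_eq[OF scalar_one_closed[of z] A] \<open>z \<noteq> 0\<close>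
    by (auto simp: B_def fun_eq_iff scaleC_blinfun.rep_eq blinfun.diff_left scaleC_scaleC
        scaleC_add_right[of _ _ "- _", simplified scaleC_minus_right, simplified] intro!: blinfun_eqI)
  ultimately show False using z by (simp add: alg_spectrum_def)
qed

text \<open>
  With \<open>t = 1/\<parallel>M\<parallel>\<^sup>2\<close> one has
  \<open>\<parallel>f - t M\<^sup>* M f\<parallel>\<^sup>2 \<le> \<parallel>f\<parallel>\<^sup>2 - t \<parallel>M f\<parallel>\<^sup>2 \<le> (1 - t c\<^sup>2) \<parallel>f\<parallel>\<^sup>2\<close>.
\<close>

lemma adj_mult_Units_if_bounded_below:
  fixes M :: "('d, 'h::chilbert_space) op_matrix"
  assumes M: "M \<in> carrier Bus" and "0 < c"
    and c: "\<And>f. f \<in> l2_space X \<Longrightarrow> c * l2_norm X f \<le> l2_norm X (matrix_op X M f)"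
  shows "mat_adj M \<otimes>\<^bsub>Bus\<^esub> M \<in> Units Bus"
proof -
  let ?R = "Bus :: ('d, 'h) op_matrix star_calgebra"
  let ?n = "l2_norm X :: (real ^ 'd \<Rightarrow> 'h) \<Rightarrow> real"
  interpret R: unital_banach_star_algebra ?R by (rule bus_unital_banach_star_algebra)
  note M' = mat_adj_in_Bus[OF M]
  \<comment> \<open>A computable upper bound for the operator norms of \<open>M\<close> and of its
    adjoint, used in place of the norm itself; the 1 keeps it positive.\<close>
  define C where "C = snorm M + 1"
  have "0 < C" by (simp add: C_def add_nonneg_pos)
  define t where "t = 1 / C\<^sup>2"
  have t: "0 < t" "t * C\<^sup>2 = 1" using \<open>0 < C\<close> by (simp_all add: t_def)
  define P where "P = mat_mult X (mat_adj M) M"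
  have P: "P \<in> carrier ?R" unfolding P_def by (rule mat_mult_in_Bus[OF M' M])
  define x where "x = of_real t \<odot>\<^bsub>?R\<^esub> P"
  have x: "x \<in> carrier ?R" unfolding x_def by (rule R.cscale_closed[OF P])
  have T: "\<one>\<^bsub>?R\<^esub> \<ominus>\<^bsub>?R\<^esub> x \<in> carrier ?R" by (rule R.minus_closed[OF R.one_closed x])
  have "\<one>\<^bsub>?R\<^esub> \<ominus>\<^bsub>?R\<^esub> (\<one>\<^bsub>?R\<^esub> \<ominus>\<^bsub>?R\<^esub> x) \<in> Units ?R"
  \<comment> \<open>1 - x is a strict contraction, and subtracting it from 1 returns
    \<open>x\<close>, so it is \<open>x\<close> that gets inverted, a positive multiple of adj M
    M.\<close>
  proof (rule one_minus_Units[OF T])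
    show "sqrt (max 0 (1 - t * c\<^sup>2)) < 1" using t \<open>0 < c\<close> by simp
    fix f :: "real ^ 'd \<Rightarrow> 'h" assume f: "f \<in> l2_space X"
    let ?g = "matrix_op X P f"
    have g: "?g = matrix_op X (mat_adj M) (matrix_op X M f)"
      unfolding P_def by (rule bus_matrix_op_mult[OF M' M f])
    note Mf = bus_matrix_op_in_l2[OF M f]
    have gl: "?g \<in> l2_space X" by (rule bus_matrix_op_in_l2[OF P f])
    have "?n ?g \<le> snorm M * ?n (matrix_op X M f)"
      unfolding g by (rule matrix_op_norm_le[OF mat_adj_closed[OF Bus_D[OF M]]
            schur_bounded_mat_adj[OF Bus_D[OF M]] snorm_nonneg Mf])
    also have "\<dots> \<le> C * ?n (matrix_op X M f)" by (intro mult_right_mono) (auto simp: C_def)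
    finally have "?n ?g \<le> C * ?n (matrix_op X M f)" .
    from power_mono[OF this, of 2] have gC: "(?n ?g)\<^sup>2 \<le> C\<^sup>2 * (?n (matrix_op X M f))\<^sup>2"
      by (simp add: power_mult_distrib)
    have fg: "l2_inner X f ?g = of_real ((?n (matrix_op X M f))\<^sup>2)"
      unfolding g using matrix_op_adj[OF Bus_D[OF M] f Mf] l2_inner_self[OF Mf] by simp
    have Tf: "matrix_op X (\<one>\<^bsub>?R\<^esub> \<ominus>\<^bsub>?R\<^esub> x) f = (\<lambda>k. f k - of_real t *\<^sub>C ?g k)"
      unfolding matrix_op_minus_apply[OF R.one_closed x f]
      by (simp add: x_def matrix_op_one[OF f] bus_matrix_op_cscale[OF P f])
    have "(?n (\<lambda>k. f k - of_real t *\<^sub>C ?g k))\<^sup>2 =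
        (?n f)\<^sup>2 - 2 * (t * (?n (matrix_op X M f))\<^sup>2) + (t * ?n ?g)\<^sup>2"
      unfolding l2_norm_diff_sq[OF f l2_space_scaleC[OF gl]] l2_inner_scaleC_right fg l2_norm_scaleC
      using t by simp
    also have "\<dots> \<le> (?n f)\<^sup>2 - t * (?n (matrix_op X M f))\<^sup>2"
    proof -
      have "(t * ?n ?g)\<^sup>2 \<le> t\<^sup>2 * (C\<^sup>2 * (?n (matrix_op X M f))\<^sup>2)"
        unfolding power_mult_distrib using gC by (intro mult_left_mono) auto
      also have "\<dots> = t * ((t * C\<^sup>2) * (?n (matrix_op X M f))\<^sup>2)"
        by (simp add: power2_eq_square mult_ac)
      finally show ?thesis using t by simp
    qed
    also have "\<dots> \<le> (?n f)\<^sup>2 - t * (c * ?n f)\<^sup>2"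
      using t \<open>0 < c\<close> by (intro diff_left_mono mult_left_mono power_mono c f) auto
    also have "\<dots> = (1 - t * c\<^sup>2) * (?n f)\<^sup>2" by (simp add: power_mult_distrib algebra_simps)
    also have "\<dots> \<le> max 0 (1 - t * c\<^sup>2) * (?n f)\<^sup>2" by (intro mult_right_mono) auto
    also have "\<dots> = (sqrt (max 0 (1 - t * c\<^sup>2)) * ?n f)\<^sup>2" by (simp add: power_mult_distrib)
    finally show "?n (matrix_op X (\<one>\<^bsub>?R\<^esub> \<ominus>\<^bsub>?R\<^esub> x) f) \<le> sqrt (max 0 (1 - t * c\<^sup>2)) * ?n f"
      unfolding Tf by (rule power2_le_imp_le) simp
  qed
  moreover have "\<one>\<^bsub>?R\<^esub> \<ominus>\<^bsub>?R\<^esub> (\<one>\<^bsub>?R\<^esub> \<ominus>\<^bsub>?R\<^esub> x) = x"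
    using bus_minus_eq[OF R.one_closed T] bus_minus_eq[OF R.one_closed x] by simp
  ultimately have "of_real (1 / t) \<odot>\<^bsub>?R\<^esub> x \<in> Units ?R"
    using t by (intro R.cscale_Units) auto
  moreover have "of_real (1 / t) \<odot>\<^bsub>?R\<^esub> x = P"
    unfolding x_def R.cscale_cscale[OF P] using t R.cscale_one[OF P] by simp
  ultimately show ?thesis by (simp add: P_def)
qed

text \<open>inv(adj M M) adj M is a left inverse, and it belongs to the algebra because adj M M is
  invertible there.\<close>

lemma left_inverse_if_bounded_below:
  fixes M :: "('d, 'h::chilbert_space) op_matrix"
  assumes M: "M \<in> carrier Bus" and "0 < c"
    and c: "\<And>f. f \<in> l2_space X \<Longrightarrow> c * l2_norm X f \<le> l2_norm X (matrix_op X M f)"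
  shows "\<exists>Y\<in>carrier Bus. Y \<otimes>\<^bsub>Bus\<^esub> M = \<one>\<^bsub>Bus\<^esub>"
proof -
  let ?R = "Bus :: ('d, 'h) op_matrix star_calgebra"
  interpret R: unital_banach_star_algebra ?R by (rule bus_unital_banach_star_algebra)
  note M' = mat_adj_in_Bus[OF M]
  obtain V where V: "V \<in> carrier ?R" "V \<otimes>\<^bsub>?R\<^esub> (mat_adj M \<otimes>\<^bsub>?R\<^esub> M) = \<one>\<^bsub>?R\<^esub>"
    using adj_mult_Units_if_bounded_below[OF assms] unfolding Units_def by blast
  show ?thesis
  proof (rule bexI)
    show "(V \<otimes>\<^bsub>?R\<^esub> mat_adj M) \<otimes>\<^bsub>?R\<^esub> M = \<one>\<^bsub>?R\<^esub>"
      using V R.m_assoc[OF V(1) M' M] by simp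
    show "V \<otimes>\<^bsub>?R\<^esub> mat_adj M \<in> carrier ?R" using V(1) M' by (rule R.m_closed)
  qed
qed

section \<open>Spectral radius, inverse-closedness and symmetry\<close>

lemma spectral_radius_eq:
  fixes A :: "('d, 'h::chilbert_space) op_matrix"
  assumes A: "A \<in> carrier Bus" and sa: "mat_adj A = A"
  shows "alg_spectral_radius Bus A = alg_spectral_radius (l2_op_algebra X) (matrix_op X A)"
proof (rule antisym)
  let ?R = "Bus :: ('d, 'h) op_matrix star_calgebra"
  let ?r = "alg_spectral_radius (l2_op_algebra X) (matrix_op X A)"
  show "?r \<le> alg_spectral_radius ?R A"
    unfolding alg_spectral_radius_def
    by (rule SUP_subset_mono[OF alg_spectrum_matrix_op_subset[OF A]]) simp
  show "alg_spectral_radius ?R A \<le> ?r"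
  \<comment> \<open>An infinite radius leaves nothing to show. An empty spectrum, as in the zero
    algebra, falls under the real case with \<open>r = 0\<close>.\<close>
  proof (cases ?r)
    case (real r)
    have "cmod z \<le> r" if z: "z \<in> alg_spectrum ?R A" for z
    proof (rule alg_spectrum_norm_le[OF A \<open>0 \<le> r\<close> _ z])
      fix f :: "real ^ 'd \<Rightarrow> 'h" assume f: "f \<in> l2_space X"
      show "l2_norm X (matrix_op X A f) \<le> r * l2_norm X f"
      proof (rule selfadjoint_norm_le_spectral_bound[OF matrix_op_closed[OF A] _ \<open>0 \<le> r\<close> _ f])
        show "l2_inner X (matrix_op X A f) g = l2_inner X f (matrix_op X A g)"
          if "f \<in> l2_space X" "g \<in> l2_space X" for f g
          using matrix_op_adj[OF Bus_D[OF A] that] by (simp add: sa)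
        fix z assume "z \<in> alg_spectrum (l2_op_algebra X) (matrix_op X A)"
        then have "ennreal (cmod z) \<le> ?r" unfolding alg_spectral_radius_def by (rule SUP_upper)
        then show "cmod z \<le> r" using real by simp
      qed
    qed
    then show ?thesis
      unfolding real(2) unfolding alg_spectral_radius_def
      by (intro SUP_least) (simp add: ennreal_leI)
  qed simp
qed

lemma matrix_op_inverse_closed:
  "inverse_closed_via (matrix_op X)
    (Bus :: ('d, 'h::chilbert_space) op_matrix star_calgebra) (l2_op_algebra X)"
  (is "inverse_closed_via _ ?R ?L")
  unfolding inverse_closed_via_def
proof (intro conjI ballI impI matrix_op_subalgebra)
  fix A assume A: "A \<in> carrier ?R" and unit: "matrix_op X A \<in> Units ?L"
  interpret L: ring ?L by (rule l2_op_ring)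
  obtain c where "0 < c" "\<forall>f\<in>l2_space X. c * l2_norm X f \<le> l2_norm X (matrix_op X A f)"
    using l2_op_Units_bounded_below[OF unit] by blast
  then obtain Y where Y: "Y \<in> carrier ?R" "Y \<otimes>\<^bsub>?R\<^esub> A = \<one>\<^bsub>?R\<^esub>"
    using left_inverse_if_bounded_below[OF A] by blast
  have YA: "matrix_op X Y \<otimes>\<^bsub>?L\<^esub> matrix_op X A = \<one>\<^bsub>?L\<^esub>"
    using ring_hom_mult[OF matrix_op_hom Y(1) A] ring_hom_one[OF matrix_op_hom]
    unfolding Y(2) by metis
  \<comment> \<open>The left inverse \<open>Y\<close> found in the algebra becomes a left inverse of
    an invertible operator, hence equals the operator inverse.\<close>
  have "inv\<^bsub>?L\<^esub> (matrix_op X A) = matrix_op X Y"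
    by (rule L.Units_if_left_right_inverse(2)[OF _ _ _ YA L.Units_r_inv[OF unit]])
      (use unit ring_hom_closed[OF matrix_op_hom Y(1)] in \<open>auto simp del: l2_op_algebra_simps\<close>)
  then show "inv\<^bsub>?L\<^esub> (matrix_op X A) \<in> matrix_op X ` carrier ?R" using Y(1) by blast
qed

text \<open>A numerical range argument: for f of positive norm, pairing (z - P) f with
  \<open>f\<close> gives z - t times |f|^2, where t = |A f|^2 / |f|^2 is nonnegative. Thus
  \<open>z\<close> stays away from every such \<open>t\<close>.\<close>

lemma adj_mult_resolvent_bounded_below:
  fixes A :: "('d, 'h::chilbert_space) op_matrix"
  assumes A: "A \<in> carrier Bus" and z: "z \<notin> \<real>\<^sub>\<ge>\<^sub>0"
  shows "\<exists>c>0. \<forall>f\<in>l2_space X. c * l2_norm X f \<le> l2_norm X (matrix_op X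
    ((z \<odot>\<^bsub>Bus\<^esub> \<one>\<^bsub>Bus\<^esub>) \<ominus>\<^bsub>Bus\<^esub> mat_mult X (mat_adj A) A) f)"
proof -
  let ?R = "Bus :: ('d, 'h) op_matrix star_calgebra"
  let ?n = "l2_norm X :: (real ^ 'd \<Rightarrow> 'h) \<Rightarrow> real"
  interpret R: unital_banach_star_algebra ?R by (rule bus_unital_banach_star_algebra)
  \<comment> \<open>A lower bound for the distance of \<open>z\<close> from the nonnegative
    half-line: the imaginary part off the real axis, the absolute value on the negative
    axis.\<close>
  define c where "c = (if Im z = 0 then \<bar>Re z\<bar> else \<bar>Im z\<bar>)"
  have "0 < c" using z by (auto simp: c_def complex_nonneg_Reals_iff)
  have dist: "c \<le> cmod (z - of_real t)" if "0 \<le> t" for t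
  proof (cases "Im z = 0")
    case True
    then have "Re z < 0" using z by (auto simp: complex_nonneg_Reals_iff)
    then have "c \<le> \<bar>Re (z - of_real t)\<bar>" using True that by (simp add: c_def)
    then show ?thesis using abs_Re_le_cmod order_trans by blast
  next
    case False
    then have "c = \<bar>Im (z - of_real t)\<bar>" by (simp add: c_def)
    then show ?thesis using abs_Im_le_cmod by metis
  qed
  define P where "P = mat_mult X (mat_adj A) A"
  have A': "mat_adj A \<in> carrier ?R" by (rule mat_adj_in_Bus[OF A])
  have P: "P \<in> carrier ?R" unfolding P_def by (rule mat_mult_in_Bus[OF A' A])
  have "c * ?n f \<le> ?n (matrix_op X ((z \<odot>\<^bsub>?R\<^esub> \<one>\<^bsub>?R\<^esub>) \<ominus>\<^bsub>?R\<^esub> P) f)" if f: "f \<in> l2_space X" for f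
  proof (cases "?n f = 0")
    case False
    then have pos: "0 < ?n f" by (simp add: order_less_le)
    let ?g = "matrix_op X P f" and ?h = "\<lambda>k. z *\<^sub>C f k - matrix_op X P f k"
    note Af = bus_matrix_op_in_l2[OF A f] and g = bus_matrix_op_in_l2[OF P f]
    have "l2_inner X f ?g = of_real ((?n (matrix_op X A f))\<^sup>2)"
      unfolding P_def bus_matrix_op_mult[OF A' A f]
      using matrix_op_adj[OF Bus_D[OF A] f Af] l2_inner_self[OF Af] by simp
    then have gf: "l2_inner X ?g f = of_real ((?n (matrix_op X A f))\<^sup>2)"
      by (subst l2_inner_commute) simp
    define t where "t = (?n (matrix_op X A f))\<^sup>2 / (?n f)\<^sup>2"
    have "l2_inner X ?h f = (z - of_real t) * of_real ((?n f)\<^sup>2)"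
      unfolding l2_inner_diff_left[OF l2_space_scaleC[OF f] g f] l2_inner_scaleC_left gf
      using pos by (simp add: l2_inner_self[OF f] t_def left_diff_distrib)
    then have "cmod (l2_inner X ?h f) = cmod (z - of_real t) * (?n f)\<^sup>2"
      by (simp add: norm_mult norm_power)
    moreover have "cmod (l2_inner X ?h f) \<le> ?n ?h * ?n f"
      by (rule l2_inner_cauchy_schwarz[OF l2_space_diff[OF l2_space_scaleC[OF f] g] f])
    moreover have "c * (?n f)\<^sup>2 \<le> cmod (z - of_real t) * (?n f)\<^sup>2"
      by (intro mult_right_mono dist) (auto simp: t_def)
    ultimately have "(c * ?n f) * ?n f \<le> ?n ?h * ?n f" by (simp add: power2_eq_square mult.assoc)
    then have "c * ?n f \<le> ?n ?h" using pos by simp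
    moreover have "matrix_op X ((z \<odot>\<^bsub>?R\<^esub> \<one>\<^bsub>?R\<^esub>) \<ominus>\<^bsub>?R\<^esub> P) f = ?h"
      unfolding matrix_op_minus_apply[OF scalar_one_closed P f]
      using bus_matrix_op_cscale[OF one_closed f, of z] by (simp add: matrix_op_one[OF f])
    ultimately show ?thesis by simp
  qed simp
  then show ?thesis using \<open>0 < c\<close> unfolding P_def by blast
qed

text \<open>A lower bound gives only a left inverse. The complement of the half-line is invariant
  under conjugation and the adjoint of z - P is cnj z - P, so a left inverse of the latter yields a
  right inverse of the former.\<close>

lemma bus_symmetric:
  "symmetric_banach_algebra (Bus :: ('d, 'h::chilbert_space) op_matrix star_calgebra)"
  (is "symmetric_banach_algebra ?R")
  unfolding symmetric_banach_algebra_def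
proof (intro conjI ballI subsetI)
  show "unital_banach_star_algebra ?R" by (rule bus_unital_banach_star_algebra)
  interpret R: unital_banach_star_algebra ?R by (rule bus_unital_banach_star_algebra)
  fix A z assume A: "A \<in> carrier ?R" and z: "z \<in> alg_spectrum ?R (invol ?R A \<otimes>\<^bsub>?R\<^esub> A)"
  define P where "P = mat_mult X (mat_adj A) A"
  have A': "mat_adj A \<in> carrier ?R" by (rule mat_adj_in_Bus[OF A])
  have P: "P \<in> carrier ?R" unfolding P_def by (rule mat_mult_in_Bus[OF A' A])
  have P_adj: "mat_adj P = P"
    using R.invol_mult[OF A' A] R.invol_invol[OF A] by (simp add: P_def)
  let ?M = "\<lambda>z. (z \<odot>\<^bsub>?R\<^esub> \<one>\<^bsub>?R\<^esub>) \<ominus>\<^bsub>?R\<^esub> P"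
  have M: "?M z \<in> carrier ?R" for z using R.minus_closed[OF scalar_one_closed P] .
  \<comment> \<open>Rewritten as a sum with a scalar multiple, to which the additive and
    conjugate-linear laws of the involution apply.\<close>
  have M_eq: "?M z = (z \<odot>\<^bsub>?R\<^esub> \<one>\<^bsub>?R\<^esub>) \<oplus>\<^bsub>?R\<^esub> ((- 1) \<odot>\<^bsub>?R\<^esub> P)" for z
    unfolding bus_minus_eq[OF scalar_one_closed P]
    by (auto simp: fun_eq_iff scaleC_blinfun.rep_eq blinfun.diff_left blinfun.add_left blinfun.minus_left
        scaleC_minus_left intro!: blinfun_eqI)
  have one_adj: "mat_adj (mat_one X) = (mat_one X :: ('d, 'h) op_matrix)"
  proof -
    have "adj_blinfun (id_blinfun :: 'h \<Rightarrow>\<^sub>L 'h) = id_blinfun" by (rule adj_blinfun_unique) simp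
    then show ?thesis by (auto simp: mat_adj_def mat_one_def fun_eq_iff)
  qed
  have M_adj: "mat_adj (?M z) = ?M (cnj z)" for z
    using R.invol_add[OF scalar_one_closed R.cscale_closed[OF P]]
      R.invol_cscale[OF R.one_closed, of z] R.invol_cscale[OF P, of "-1"]
    unfolding M_eq by (simp add: P_adj one_adj)
  show "z \<in> \<real>\<^sub>\<ge>\<^sub>0"
  proof (rule ccontr)
    assume nz: "z \<notin> \<real>\<^sub>\<ge>\<^sub>0"
    then have nz': "cnj z \<notin> \<real>\<^sub>\<ge>\<^sub>0" by (simp add: complex_nonneg_Reals_iff)
    have left: "\<exists>Y\<in>carrier ?R. Y \<otimes>\<^bsub>?R\<^esub> ?M x = \<one>\<^bsub>?R\<^esub>" if x: "x \<notin> \<real>\<^sub>\<ge>\<^sub>0" for x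
    proof -
      obtain c where "0 < c" "\<forall>f\<in>l2_space X. c * l2_norm X f \<le> l2_norm X (matrix_op X (?M x) f)"
        using adj_mult_resolvent_bounded_below[OF A x] unfolding P_def by blast
      then show ?thesis using left_inverse_if_bounded_below[OF M, of c x] by blast
    qed
    obtain Y where Y: "Y \<in> carrier ?R" "Y \<otimes>\<^bsub>?R\<^esub> ?M z = \<one>\<^bsub>?R\<^esub>" using left[OF nz] by blast
    obtain V where V: "V \<in> carrier ?R" "V \<otimes>\<^bsub>?R\<^esub> ?M (cnj z) = \<one>\<^bsub>?R\<^esub>" using left[OF nz'] by blast
    have "?M z \<otimes>\<^bsub>?R\<^esub> mat_adj V = \<one>\<^bsub>?R\<^esub>"
      using arg_cong[OF V(2), of "invol ?R"] R.invol_mult[OF V(1) M[of "cnj z"]] M_adj[of "cnj z"]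
      by (simp add: one_adj)
    then have "?M z \<in> Units ?R"
      by (rule R.Units_if_left_right_inverse(1)[OF M Y(1) mat_adj_in_Bus[OF V(1)] Y(2)])
    then show False using z by (simp add: alg_spectrum_def P_def)
  qed
qed

end

theorem theorem4p4:
  fixes X :: "(real ^ 'd) set" and u :: "real ^ 'd \<Rightarrow> real" and \<delta> s :: real
  defines "\<B> \<equiv> (Bus_algebra X u s :: ('d, 'h::chilbert_space) op_matrix star_calgebra)"
    and "\<L> \<equiv> (l2_op_algebra X :: ((real ^ 'd \<Rightarrow> 'h) \<Rightarrow> (real ^ 'd \<Rightarrow> 'h)) calgebra)"
  assumes "separable_space (euclidean :: 'h topology)"
    and "relatively_separated X"
    and "admissible_weight u"
    and "\<delta> > 0" and "s > 0"
    and "\<And>x. poly_weight \<delta> x \<le> u x"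
  shows "(\<forall>A\<in>carrier \<B>. invol \<B> A = A \<longrightarrow>
            alg_spectral_radius \<B> A = alg_spectral_radius \<L> (matrix_op X A)) \<and>
         inverse_closed_via (matrix_op X) \<B> \<L> \<and>
         symmetric_banach_algebra \<B>"
proof -
  interpret bus_admissible X u \<delta> s
    using assms(4-8) by unfold_locales auto
  show ?thesis
    unfolding \<B>_def \<L>_def
    using spectral_radius_eq matrix_op_inverse_closed bus_symmetric by auto
qed

end
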